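(* Let $d\ge 2$ and let $\{\phi_{s,t}(x,\omega): 0\le s\le t<\infty\}$ be a transient isotropic Brownian flow on $\mathbb{R}^d$, and write $\phi_t:=\phi_{0,t}$. Let $m$ be an atomless nonzero finite measure on the Borel sets $\mathcal{B}(\mathbb{R}^d)$. For $t>0$ let the random measure $l_t$ on $\mathcal{B}(\mathbb{R}^d)$ be defined by $$l_t(A):=\frac{1}{m(\mathbb{R}^d)}\,m\big(\{x\in\mathbb{R}^d:\ \phi_t(x)\in\sqrt{t}A\}\big).$$ Then for every $A\in\mathcal{B}(\mathbb{R}^d)$, $$l_t(A)\longrightarrow \mathcal{N}(0,\mathrm{Id}_{\mathbb{R}^d})(A)\quad\text{in } L^2 \text{ as } t\to+\infty.$$ In particular, $l_t$ converges to $\mathcal{N}(0,\mathrm{Id}_{\mathbb{R}^d})$ weakly in probability as $t\to\infty$.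
   Context: A stochastic flow of homeomorphisms on $\mathbb{R}^d$ is a family $\{\phi_{s,t}:0\le s\le t<\infty\}$ of random homeomorphisms of $\mathbb{R}^d$ such that, up to a null set, $\phi_{u,t}\circ\phi_{s,u}=\phi_{s,t}$ for all $s\le u\le t$ and $(s,t,x)\mapsto\phi_{s,t}(x)$ is continuous. It is Brownian if for all $s_1\le t_1\le s_2\le\dots\le t_n$ the maps $\phi_{s_1,t_1},\dots,\phi_{s_n,t_n}$ are independent; temporally homogeneous if the increments are stationary; spatially homogeneous if for every translation $T$ of $\mathbb{R}^d$ the flows $T\circ\phi$ and $\phi\circ T$ have the same law. An isotropic Brownian flow (IBF) is a spatially and temporally homogeneous Brownian flow which is, in the same sense, also invariant under orthogonal transformations of $\mathbb{R}^d$. For an IBF each one-point motion $t\mapsto\phi_{s,t}(x)$ is a $d$-dimensional Brownian motion started at $x$ at time $s$. The covariance tensor is $b_{i,j}(x):=\frac{\mathrm{d}\langle\phi^i_{0,t}(x),\phi^j_{0,t}(0)\rangle}{\mathrm{d}t}\big|_{t=0}$, where $\langle\cdot,\cdot\rangle$ denotes covariation, and one has $\mathrm{d}\langle\phi^i_{s,t}(x),\phi^j_{s,t}(y)\rangle=b_{i,j}(\phi_{s,t}(x)-\phi_{s,t}(y))\,\mathrm{d}t$ for all $x,y\in\mathbb{R}^d$, $0\le s\le t$. Standing assumptions: $d\ge2$, $b(0)=\mathrm{Id}_{\mathbb{R}^d}$, $x\mapsto b(x)$ is $C^4$, and $\lim_{|x|\to\infty}b(x)=0$. The IBF is called transient if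 for all $x\ne y$ in $\mathbb{R}^d$, $|\phi_t(x)-\phi_t(y)|\to\infty$ in probability as $t\to\infty$. $\mathcal{N}(0,\mathrm{Id}_{\mathbb{R}^d})$ denotes the standard Gaussian distribution on $\mathbb{R}^d$, and $\mathcal{N}(0,\mathrm{Id}_{\mathbb{R}^d})(A)$ its value on $A$. Weak convergence in probability of $l_t$ to a measure $\nu$ means that $\int f\,\mathrm{d}l_t\to\int f\,\mathrm{d}\nu$ in probability for every bounded continuous $f:\mathbb{R}^d\to\mathbb{R}$. *)

theory Defs
  imports "HOL-Probability.Probability"
begin

section \<open>Stochastic flows\<close>

text \<open>\<open>\<phi> s t \<omega> x\<close> is the position at time \<open>t\<close> of the particle that is at \<open>x\<close> at time \<open>s\<close>; only
  \<open>0 \<le> s \<le> t\<close> is relevant.  Every single \<open>\<phi> s t \<omega>\<close> is a homeomorphism, while the flow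
  property and the joint continuity hold outside one null set that depends on neither times nor
  points.\<close>

locale stochastic_flow = prob_space M
  for M :: "'w measure" +
  fixes \<phi> :: "real \<Rightarrow> real \<Rightarrow> 'w \<Rightarrow> real ^ 'n \<Rightarrow> real ^ 'n"
  assumes flow_measurable:
      "\<And>s t x. \<lbrakk>0 \<le> s; s \<le> t\<rbrakk> \<Longrightarrow> (\<lambda>\<omega>. \<phi> s t \<omega> x) \<in> borel_measurable M"
    and flow_homeomorphism:
      "\<And>s t \<omega>. \<lbrakk>0 \<le> s; s \<le> t; \<omega> \<in> space M\<rbrakk> \<Longrightarrow> \<exists>g. homeomorphism UNIV UNIV (\<phi> s t \<omega>) g"
    and flow_compose:
      "AE \<omega> in M. \<forall>s u t. 0 \<le> s \<and> s \<le> u \<and> u \<le> t \<longrightarrow> \<phi> u t \<omega> \<circ> \<phi> s u \<omega> = \<phi> s t \<omega>"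
    and flow_continuous:
      "AE \<omega> in M. continuous_on {(s, t, x). 0 \<le> s \<and> s \<le> t} (\<lambda>(s, t, x). \<phi> s t \<omega> x)"

text \<open>Random maps are regarded as random elements of the product space indexed by
  the points of \<open>\<real>\<^sup>d\<close>, so that the generated sigma-algebras are those of all evaluations.\<close>

abbreviation map_space :: "(real ^ 'n \<Rightarrow> real ^ 'n) measure" where
  "map_space \<equiv> Pi\<^sub>M UNIV (\<lambda>_. borel)"

locale Brownian_flow = stochastic_flow M \<phi>
  for M :: "'w measure" and \<phi> :: "real \<Rightarrow> real \<Rightarrow> 'w \<Rightarrow> real ^ 'n \<Rightarrow> real ^ 'n" +
  assumes independent_increments:
    "\<And>(n::nat) s t. \<lbrakk>\<And>k. k < n \<Longrightarrow> 0 \<le> s k \<and> s k \<le> t k; \<And>k. Suc k < n \<Longrightarrow> t k \<le> s (Suc k)\<rbrakk>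
      \<Longrightarrow> indep_vars (\<lambda>_. map_space) (\<lambda>k \<omega>. \<phi> (s k) (t k) \<omega>) {..<n}"

definition flow_index :: "(real \<times> real \<times> (real ^ 'n)) set" where
  "flow_index = {(s, t, x). 0 \<le> s \<and> s \<le> t}"

definition flow_law ::
  "'w measure \<Rightarrow> (real \<Rightarrow> real \<Rightarrow> 'w \<Rightarrow> real ^ 'n \<Rightarrow> real ^ 'n) \<Rightarrow> (real \<times> real \<times> (real ^ 'n) \<Rightarrow> real ^ 'n) measure"
  where "flow_law M \<phi> =
    distr M (Pi\<^sub>M flow_index (\<lambda>_. borel)) (\<lambda>\<omega>. restrict (\<lambda>(s, t, x). \<phi> s t \<omega> x) flow_index)"

definition commutes_in_law ::
  "'w measure \<Rightarrow> (real \<Rightarrow> real \<Rightarrow> 'w \<Rightarrow> real ^ 'n \<Rightarrow> real ^ 'n) \<Rightarrow> (real ^ 'n \<Rightarrow> real ^ 'n) \<Rightarrow> bool"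
  where "commutes_in_law M \<phi> T \<longleftrightarrow>
    flow_law M (\<lambda>s t \<omega>. T \<circ> \<phi> s t \<omega>) = flow_law M (\<lambda>s t \<omega>. \<phi> s t \<omega> \<circ> T)"

locale isotropic_Brownian_flow = Brownian_flow M \<phi>
  for M :: "'w measure" and \<phi> :: "real \<Rightarrow> real \<Rightarrow> 'w \<Rightarrow> real ^ 'n \<Rightarrow> real ^ 'n" +
  assumes temporally_homogeneous:
      "\<And>s t h. \<lbrakk>0 \<le> s; s \<le> t; 0 \<le> h\<rbrakk>
        \<Longrightarrow> distr M map_space (\<phi> (s + h) (t + h)) = distr M map_space (\<phi> s t)"
    and spatially_homogeneous: "\<And>a. commutes_in_law M \<phi> (\<lambda>x. a + x)"
    and isotropic: "\<And>U. orthogonal_transformation U \<Longrightarrow> commutes_in_law M \<phi> U"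

definition transient ::
  "'w measure \<Rightarrow> (real \<Rightarrow> real \<Rightarrow> 'w \<Rightarrow> real ^ 'n \<Rightarrow> real ^ 'n) \<Rightarrow> bool" where
  "transient M \<phi> \<longleftrightarrow>
    (\<forall>x y. x \<noteq> y \<longrightarrow> (\<forall>R. ((\<lambda>t. measure M {\<omega> \<in> space M. R < norm (\<phi> 0 t \<omega> x - \<phi> 0 t \<omega> y)}) \<longlongrightarrow> 1) at_top))"


section \<open>Covariation and the covariance tensor\<close>

text \<open>The covariation of continuous processes on \<open>[0,\<infinity>)\<close>: the continuous process whose value at
  each \<open>t\<close> is the limit in probability of the sums of products of increments along partitions of
  \<open>[0,t]\<close> as the mesh tends to 0.\<close>

definition is_covariation ::
  "'w measure \<Rightarrow> (real \<Rightarrow> 'w \<Rightarrow> real) \<Rightarrow> (real \<Rightarrow> 'w \<Rightarrow> real) \<Rightarrow> (real \<Rightarrow> 'w \<Rightarrow> real) \<Rightarrow> bool" where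
  "is_covariation M X Y C \<longleftrightarrow>
    (\<forall>t\<ge>0. C t \<in> borel_measurable M) \<and>
    (AE \<omega> in M. continuous_on {0..} (\<lambda>t. C t \<omega>)) \<and>
    (\<forall>t\<ge>0. \<forall>\<epsilon>>0. \<exists>\<delta>>0. \<forall>(n::nat) \<tau>.
      \<tau> 0 = 0 \<and> \<tau> n = t \<and> (\<forall>k<n. \<tau> k \<le> \<tau> (Suc k) \<and> \<tau> (Suc k) - \<tau> k < \<delta>) \<longrightarrow>
      measure M {\<omega> \<in> space M.
        \<epsilon> < \<bar>(\<Sum>k<n. (X (\<tau> (Suc k)) \<omega> - X (\<tau> k) \<omega>) * (Y (\<tau> (Suc k)) \<omega> - Y (\<tau> k) \<omega>)) - C t \<omega>\<bar>} < \<epsilon>)"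

text \<open>The covariation is a random process; its derivative at time 0 is required to be almost
  surely equal to the deterministic number \<open>b x $ i $ j\<close>.\<close>

definition is_covariance_tensor ::
  "'w measure \<Rightarrow> (real \<Rightarrow> real \<Rightarrow> 'w \<Rightarrow> real ^ 'n \<Rightarrow> real ^ 'n) \<Rightarrow> (real ^ 'n \<Rightarrow> real ^ 'n ^ 'n) \<Rightarrow> bool" where
  "is_covariance_tensor M \<phi> b \<longleftrightarrow>
    (\<forall>x i j. \<exists>C. is_covariation M (\<lambda>t \<omega>. \<phi> 0 t \<omega> x $ i) (\<lambda>t \<omega>. \<phi> 0 t \<omega> 0 $ j) C \<and>
      (AE \<omega> in M. ((\<lambda>t. C t \<omega>) has_real_derivative b x $ i $ j) (at 0 within {0..})))"

fun C_differentiable :: "nat \<Rightarrow> ('a::euclidean_space \<Rightarrow> 'b::euclidean_space) \<Rightarrow> bool" where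
  "C_differentiable 0 f \<longleftrightarrow> continuous_on UNIV f"
| "C_differentiable (Suc k) f \<longleftrightarrow>
    (\<forall>x. f differentiable (at x)) \<and> (\<forall>v. C_differentiable k (\<lambda>x. frechet_derivative f (at x) v))"


section \<open>The measures and the modes of convergence\<close>

definition atomless :: "'a measure \<Rightarrow> bool" where
  "atomless m \<longleftrightarrow>
    (\<forall>A\<in>sets m. 0 < emeasure m A \<longrightarrow> (\<exists>B\<in>sets m. B \<subseteq> A \<and> 0 < emeasure m B \<and> emeasure m B < emeasure m A))"

definition rescaled_image ::
  "(real ^ 'n) measure \<Rightarrow> (real \<Rightarrow> real \<Rightarrow> 'w \<Rightarrow> real ^ 'n \<Rightarrow> real ^ 'n) \<Rightarrow> real \<Rightarrow> 'w \<Rightarrow> (real ^ 'n) measure" where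
  "rescaled_image m \<phi> t \<omega> =
    measure_of UNIV (sets borel)
      (\<lambda>A. emeasure m {x. \<phi> 0 t \<omega> x \<in> (\<lambda>y. sqrt t *\<^sub>R y) ` A} / emeasure m UNIV)"

definition std_gaussian :: "(real ^ 'n) measure" where
  "std_gaussian =
    density lborel (\<lambda>x. ennreal ((2 * pi) powr (- real CARD('n) / 2) * exp (- (norm x)\<^sup>2 / 2)))"

text \<open>Measurability and integrability are part of both notions, since \<open>integral\<^sup>L\<close> and
  \<open>measure\<close> are 0 where they are undefined.\<close>

definition tendsto_L2 ::
  "'w measure \<Rightarrow> ('t \<Rightarrow> 'w \<Rightarrow> real) \<Rightarrow> real \<Rightarrow> 't filter \<Rightarrow> bool" where
  "tendsto_L2 M X c F \<longleftrightarrow>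
    (\<forall>\<^sub>F t in F. X t \<in> borel_measurable M \<and> integrable M (\<lambda>\<omega>. (X t \<omega>)\<^sup>2)) \<and>
    ((\<lambda>t. \<integral>\<omega>. (X t \<omega> - c)\<^sup>2 \<partial>M) \<longlongrightarrow> 0) F"

definition tendsto_in_probability ::
  "'w measure \<Rightarrow> ('t \<Rightarrow> 'w \<Rightarrow> real) \<Rightarrow> real \<Rightarrow> 't filter \<Rightarrow> bool" where
  "tendsto_in_probability M X c F \<longleftrightarrow>
    (\<forall>\<^sub>F t in F. X t \<in> borel_measurable M) \<and>
    (\<forall>\<epsilon>>0. ((\<lambda>t. measure M {\<omega> \<in> space M. \<epsilon> < \<bar>X t \<omega> - c\<bar>}) \<longlongrightarrow> 0) F)"

definition weakly_in_probability ::
  "'w measure \<Rightarrow> ('t \<Rightarrow> 'w \<Rightarrow> (real ^ 'n) measure) \<Rightarrow> (real ^ 'n) measure \<Rightarrow> 't filter \<Rightarrow> bool" where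
  "weakly_in_probability M l \<nu> F \<longleftrightarrow>
    (\<forall>f :: real ^ 'n \<Rightarrow> real. continuous_on UNIV f \<and> bounded (range f) \<longrightarrow>
      tendsto_in_probability M (\<lambda>t \<omega>. \<integral>x. f x \<partial>l t \<omega>) (\<integral>x. f x \<partial>\<nu>) F)"

text \<open>The set function defining \<open>rescaled_image\<close> is countably additive, so that \<open>measure_of\<close> does
  not collapse to the zero measure.\<close>

lemma rescaled_image_eq:
  fixes \<phi> :: "real \<Rightarrow> real \<Rightarrow> 'w \<Rightarrow> real ^ 'n \<Rightarrow> real ^ 'n"
  assumes "stochastic_flow M \<phi>" "\<omega> \<in> space M" "sets m = sets borel" "0 < t"
  shows "rescaled_image m \<phi> t \<omega> =
    scale_measure (1 / emeasure m UNIV) (distr m borel (\<lambda>x. \<phi> 0 t \<omega> x /\<^sub>R sqrt t))"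
proof -
  have sp: "space m = UNIV" using sets_eq_imp_space_eq[OF assms(3)] by simp
  obtain g where "homeomorphism UNIV UNIV (\<phi> 0 t \<omega>) g"
    using stochastic_flow.flow_homeomorphism[OF assms(1), of 0 t \<omega>] assms by auto
  then have "continuous_on UNIV (\<phi> 0 t \<omega>)" by (simp add: homeomorphism_def)
  then have "(\<lambda>x. \<phi> 0 t \<omega> x /\<^sub>R sqrt t) \<in> borel_measurable borel"
    by (intro borel_measurable_continuous_onI continuous_intros)
  then have meas: "(\<lambda>x. \<phi> 0 t \<omega> x /\<^sub>R sqrt t) \<in> measurable m borel"
    by (simp add: measurable_cong_sets[OF assms(3) refl])
  have img: "{x. \<phi> 0 t \<omega> x \<in> (\<lambda>y. sqrt t *\<^sub>R y) ` A} = (\<lambda>x. \<phi> 0 t \<omega> x /\<^sub>R sqrt t) -` A" for A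
  proof (rule set_eqI)
    fix x
    have "\<phi> 0 t \<omega> x = sqrt t *\<^sub>R y \<longleftrightarrow> \<phi> 0 t \<omega> x /\<^sub>R sqrt t = y" for y
      using assms(4) by auto
    then show "x \<in> {x. \<phi> 0 t \<omega> x \<in> (\<lambda>y. sqrt t *\<^sub>R y) ` A}
        \<longleftrightarrow> x \<in> (\<lambda>x. \<phi> 0 t \<omega> x /\<^sub>R sqrt t) -` A"
      by (auto simp: image_iff)
  qed
  show ?thesis
    unfolding rescaled_image_def scale_measure_def
    by (simp, intro measure_of_eq)
      (auto simp: sets.sigma_sets_eq[of borel, simplified] emeasure_distr[OF meas] img sp
        ennreal_times_divide divide_ennreal_def mult.commute)
qed

end

theory Submission
  imports Defs "HOL-Real_Asymp.Real_Asymp"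
begin

text \<open>Write \<open>X\<^sub>t(x) = \<phi>\<^sub>t(x) / sqrt t\<close>, let \<open>\<mu>\<close> be \<open>m\<close> normalised to a probability measure, let \<open>\<gamma>\<close> be the
  standard Gaussian measure, and put \<open>l\<^sub>t(f) = \<integral> f(X\<^sub>t(x)) \<mu>(dx)\<close>.  The theorem is a law of large numbers
  for asymptotically independent particles.  For the wave \<open>e\<^sub>u(x) = exp(i u \<bullet> x)\<close>, the second moment of
  \<open>l\<^sub>t(e\<^sub>u)\<close> is \<open>\<integral>\<integral> E exp(i u \<bullet> (X\<^sub>t(x) - X\<^sub>t(y))) \<mu>(dx) \<mu>(dy)\<close>, and the diagonal \<open>x = y\<close> is negligible since
  \<open>m\<close> has no atoms.  If for \<open>x \<noteq> y\<close> the integrand tends to \<open>exp(-|u|\<^sup>2)\<close>, the squared modulus of the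
  characteristic function of \<open>\<gamma>\<close>, and if \<open>E l\<^sub>t(e\<^sub>u)\<close> tends to that characteristic function, then
  \<open>l\<^sub>t(e\<^sub>u)\<close> converges to \<open>\<integral> e\<^sub>u d\<gamma>\<close> in \<open>L\<^sup>2\<close>.  The step from waves to indicators of Borel sets is possible
  because the law of \<open>X\<^sub>t(x)\<close> converges to \<open>\<gamma>\<close> on every bounded Borel function: this makes the class of
  bounded functions \<open>f\<close> with \<open>l\<^sub>t(f) \<longlongrightarrow> \<integral> f d\<gamma>\<close> in \<open>L\<^sup>2\<close> stable under bounded pointwise limits
  (\<open>converging_limit\<close>), and indicators of orthants are bounded limits of trigonometric polynomials.

  One particle.  The displacements of a particle form a continuous process with independent and
  stationary increments and a symmetric law, so their characteristic function is \<open>exp(-t \<psi>(u))\<close> with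
  \<open>\<psi> \<ge> 0\<close>.  Continuity of the paths rules out jumps, that is
  \<open>n P(|u \<bullet> \<phi>\<^bsub>1/n\<^esub>(0)| > \<epsilon>) \<longlongrightarrow> 0\<close>, and this forces \<open>\<psi>(r u) = r\<^sup>2 \<psi>(u)\<close> (\<open>exponent_scale\<close>).  With
  isotropy, \<open>\<psi>(u) = \<kappa> |u|\<^sup>2\<close>, and the normalisation of the covariance tensor gives \<open>\<kappa> = 1/2\<close>
  (\<open>\<kappa>_eq\<close>).

  Two particles.  Let \<open>D\<^sub>s = \<phi>\<^sub>s(x) - \<phi>\<^sub>s(y)\<close>.  Increments over disjoint time intervals are orthogonal, so the
  mixed second moment of two displacements equals the expectation of every Riemann sum that approximates
  the covariation; as these sums are bounded in \<open>L\<^sup>2\<close>, the mixed moments over \<open>[0,h]\<close>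
  divided by \<open>h\<close> tend to the covariance tensor \<open>b\<close> (\<open>cross_moment_tensor\<close>).  A Taylor expansion of the
  cosine and the Markov property of \<open>D\<close> then show that \<open>c(s) = E cos(v \<bullet> D\<^sub>s)\<close> has the right derivative
  \<open>-|v|\<^sup>2 c(s) + E((v \<bullet> b(D\<^sub>s) v) cos(v \<bullet> D\<^sub>s))\<close>.  For \<open>v = u / sqrt t\<close>, the function
  \<open>exp(|u|\<^sup>2 s / t) c(s)\<close> therefore changes between \<open>s = 0\<close> and \<open>s = t\<close> by at most \<open>exp(|u|\<^sup>2)\<close> times the
  mean over \<open>s \<in> [0,t]\<close> of \<open>E|u \<bullet> b(D\<^sub>s) u|\<close>.  Transience and the decay of \<open>b\<close> make this mean
  vanish as \<open>t \<longlongrightarrow> \<infinity>\<close>, and the limit \<open>exp(-|u|\<^sup>2)\<close> follows (\<open>two_point_cos_limit\<close>).\<close>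

section \<open>Trigonometric polynomials and characteristic functions\<close>

text \<open>With an arbitrary phase in each wave, constants and sines are waves, and the product of two waves is
  a sum of two waves.\<close>

inductive trig_poly :: "('a::euclidean_space \<Rightarrow> real) \<Rightarrow> bool" where
  trig_wave: "trig_poly (\<lambda>x. r * cos (u \<bullet> x + c))"
| trig_add: "trig_poly f \<Longrightarrow> trig_poly g \<Longrightarrow> trig_poly (\<lambda>x. f x + g x)"

lemma trig_poly_const: "trig_poly (\<lambda>x. r)"
  using trig_wave[of r 0 0] by simp

lemma trig_poly_sin: "trig_poly (\<lambda>x. sin (u \<bullet> x))"
  using trig_wave[of 1 u "- (pi / 2)"] by (simp add: cos_diff)

lemma trig_poly_mult:
  assumes "trig_poly f" "trig_poly g"
  shows "trig_poly (\<lambda>x. f x * g x)"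
  using assms
proof (induction rule: trig_poly.induct)
  case (trig_wave r u c)
  then show ?case
  proof (induction rule: trig_poly.induct)
    case (trig_wave r' u' c')
    have "(\<lambda>x. r * cos (u \<bullet> x + c) * (r' * cos (u' \<bullet> x + c')))
        = (\<lambda>x. (r * r' / 2) * cos ((u - u') \<bullet> x + (c - c')) + (r * r' / 2) * cos ((u + u') \<bullet> x + (c + c')))"
    proof
      fix x
      show "r * cos (u \<bullet> x + c) * (r' * cos (u' \<bullet> x + c'))
        = (r * r' / 2) * cos ((u - u') \<bullet> x + (c - c')) + (r * r' / 2) * cos ((u + u') \<bullet> x + (c + c'))"
      proof -
        have e: "(u - u') \<bullet> x + (c - c') = (u \<bullet> x + c) - (u' \<bullet> x + c')"
          "(u + u') \<bullet> x + (c + c') = (u \<bullet> x + c) + (u' \<bullet> x + c')"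
          by (simp_all add: inner_diff_left inner_add_left)
        have "cos (u \<bullet> x + c) * cos (u' \<bullet> x + c') = (cos ((u - u') \<bullet> x + (c - c')) + cos ((u + u') \<bullet> x + (c + c'))) / 2"
          unfolding e by (rule cos_times_cos)
        then show ?thesis by (simp add: field_simps)
      qed
    qed
    then show ?case
      by (simp only:) (intro trig_poly.intros)
  next
    case (trig_add f g)
    then show ?case by (simp only: distrib_left trig_poly.trig_add)
  qed
next
  case (trig_add f g)
  then show ?case by (simp only: distrib_right trig_poly.trig_add)
qed

lemma trig_poly_prod:
  assumes "finite I" "\<And>i. i \<in> I \<Longrightarrow> trig_poly (f i)"
  shows "trig_poly (\<lambda>x. \<Prod>i\<in>I. f i x)"
  using assms by (induction I rule: finite_induct) (auto intro: trig_poly_const trig_poly_mult)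

lemma trig_poly_polynomial:
  fixes p :: "real \<Rightarrow> real"
  assumes "real_polynomial_function p" "trig_poly f"
  shows "trig_poly (\<lambda>x. p (f x))"
  using assms(1)
proof (induction rule: real_polynomial_function.induct)
  case (linear h)
  then interpret bounded_linear h .
  have "h y = h 1 * y" for y using scale[of y 1] by simp
  then have "(\<lambda>x. h (f x)) = (\<lambda>x. h 1 * f x)" by (intro ext)
  then show ?case using trig_poly_mult[OF trig_poly_const assms(2)] by simp
qed (auto intro: trig_poly_const trig_add trig_poly_mult)

lemma trig_poly_continuous: "trig_poly f \<Longrightarrow> continuous_on UNIV f"
  by (induction rule: trig_poly.induct) (auto intro!: continuous_intros)

lemma trig_poly_borel [measurable_dest]: "trig_poly f \<Longrightarrow> f \<in> borel_measurable borel"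
  by (intro borel_measurable_continuous_onI trig_poly_continuous)

lemma trig_poly_bounded: "trig_poly f \<Longrightarrow> \<exists>K. \<forall>x. \<bar>f x\<bar> \<le> K"
proof (induction rule: trig_poly.induct)
  case (trig_wave r u c)
  have "\<bar>r * cos (u \<bullet> x + c)\<bar> \<le> \<bar>r\<bar>" for x
    using mult_left_mono[OF abs_cos_le_one, of "\<bar>r\<bar>"] by (simp add: abs_mult)
  then show ?case by blast
next
  case (trig_add f g)
  then obtain K L where "\<forall>x. \<bar>f x\<bar> \<le> K" "\<forall>x. \<bar>g x\<bar> \<le> L" by blast
  then have "\<bar>f x + g x\<bar> \<le> K + L" for x
    using abs_triangle_ineq[of "f x" "g x"] by (meson add_mono order_trans)
  then show ?case by blast
qed

text \<open>The function \<open>n sin(y / n)\<close> is bounded and converges to \<open>y\<close>.  A continuous cutoff of it is, by the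
  Weierstrass theorem on \<open>[-1,1]\<close>, uniformly close to a polynomial in \<open>sin(y / n)\<close>.  In this way the
  approximations are bounded on the whole line and not only on compact sets.\<close>

lemma trig_poly_approx_halfline:
  fixes a :: real and v :: "'a::euclidean_space"
  shows "\<exists>P. (\<forall>n. trig_poly (P n)) \<and> (\<forall>n x. \<bar>P n x\<bar> \<le> 2)
    \<and> (\<forall>x. (\<lambda>n. P n x) \<longlonglongrightarrow> indicator {..a} (v \<bullet> x))"
proof -
  define cut where "cut n y = max 0 (min 1 (1 - real n * (y - a)))" for n y
  define w where "w n y = real (Suc n) * sin (y / real (Suc n))" for n y
  have "\<exists>p. real_polynomial_function p \<and> (\<forall>s\<in>{-1..1}. \<bar>cut n (real (Suc n) * s) - p s\<bar> < 1 / real (Suc n))" for n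
    by (rule Stone_Weierstrass_real_polynomial_function[of "{-1..1::real}" "\<lambda>s. cut n (real (Suc n) * s)" "1 / real (Suc n)"])
      (auto simp: cut_def intro!: continuous_intros)
  then obtain p where p: "\<And>n. real_polynomial_function (p n)"
    "\<And>n s. s \<in> {-1..1} \<Longrightarrow> \<bar>cut n (real (Suc n) * s) - p n s\<bar> < 1 / real (Suc n)"
    by metis
  define P where "P n x = p n (sin ((v /\<^sub>R real (Suc n)) \<bullet> x))" for n x
  have close: "\<bar>cut n (w n (v \<bullet> x)) - P n x\<bar> < 1 / real (Suc n)" for n x
    using p(2)[of "sin ((v /\<^sub>R real (Suc n)) \<bullet> x)" n]
    by (simp add: w_def P_def field_simps del: of_nat_Suc)
  have "trig_poly (P n)" for n
    unfolding P_def by (intro trig_poly_polynomial[OF p(1)] trig_poly_sin)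
  moreover have "\<bar>P n x\<bar> \<le> 2" for n x
  proof -
    have "\<bar>cut n (w n (v \<bullet> x))\<bar> \<le> 1" by (auto simp: cut_def)
    moreover have "1 / real (Suc n) \<le> 1" by simp
    ultimately show ?thesis using close[of n x] by linarith
  qed
  moreover have "(\<lambda>n. P n x) \<longlonglongrightarrow> indicator {..a} (v \<bullet> x)" for x
  proof -
    define y where "y = v \<bullet> x"
    have w: "(\<lambda>n. w n y) \<longlonglongrightarrow> y"
    proof (cases y "0::real" rule: linorder_cases)
      case less then show ?thesis unfolding w_def by real_asymp
    next
      case equal then show ?thesis by (simp add: w_def)
    next
      case greater then show ?thesis unfolding w_def by real_asymp
    qed
    have "(\<lambda>n. cut n (w n y)) \<longlonglongrightarrow> indicator {..a} y"
    proof (cases "y < a" "y = a" rule: bool.exhaust[case_product bool.exhaust])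
      case True_True then show ?thesis by simp
    next
      case True_False
      then have "eventually (\<lambda>n. w n y < a) sequentially" using w by (intro order_tendstoD) auto
      then have "eventually (\<lambda>n. cut n (w n y) = 1) sequentially"
        by eventually_elim (auto simp: cut_def mult_nonneg_nonpos)
      then show ?thesis using True_False by (auto intro: tendsto_eventually)
    next
      case False_True
      then have "y = a" by simp
      have "(\<lambda>n. real n * (w n a - a)) \<longlonglongrightarrow> 0"
      proof (cases a "0::real" rule: linorder_cases)
        case less then show ?thesis unfolding w_def by real_asymp
      next
        case equal then show ?thesis by (simp add: w_def)
      next
        case greater then show ?thesis unfolding w_def by real_asymp
      qed
      then have "(\<lambda>n. max 0 (min 1 (1 - real n * (w n a - a)))) \<longlonglongrightarrow> max 0 (min 1 (1 - 0))"
        by (intro tendsto_intros)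
      then show ?thesis using \<open>y = a\<close> by (simp add: cut_def)
    next
      case False_False
      have "(\<lambda>n. w n y - a) \<longlonglongrightarrow> y - a" by (intro tendsto_intros w)
      then have "filterlim (\<lambda>n. (w n y - a) * real n) at_top sequentially"
        using False_False by (intro filterlim_tendsto_pos_mult_at_top[OF _ _ filterlim_real_sequentially]) auto
      then have "filterlim (\<lambda>n. real n * (w n y - a)) at_top sequentially" by (simp add: mult.commute)
      then have "eventually (\<lambda>n. 1 \<le> real n * (w n y - a)) sequentially"
        by (simp add: filterlim_at_top)
      then have "eventually (\<lambda>n. cut n (w n y) = 0) sequentially"
        by eventually_elim (auto simp: cut_def)
      then show ?thesis using False_False by (auto intro: tendsto_eventually)
    qed
    moreover have "(\<lambda>n. P n x - cut n (w n y)) \<longlonglongrightarrow> 0"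
    proof (rule Lim_null_comparison)
      show "\<forall>\<^sub>F n in sequentially. norm (P n x - cut n (w n y)) \<le> 1 / real (Suc n)"
        using close[of _ x] by (intro always_eventually allI) (simp add: y_def abs_minus_commute less_imp_le del: of_nat_Suc)
      show "(\<lambda>n. 1 / real (Suc n)) \<longlonglongrightarrow> 0" by real_asymp
    qed
    ultimately show ?thesis
      using tendsto_add[of "\<lambda>n. P n x - cut n (w n y)" 0 sequentially "\<lambda>n. cut n (w n y)"]
      by (simp add: y_def)
  qed
  ultimately show ?thesis by blast
qed

text \<open>Since the bound is global, dominated convergence applies to these approximations under every
  probability measure, whatever its tails.\<close>

lemma trig_poly_approx_orthant:
  fixes a :: "real ^ 'n"
  shows "\<exists>P B. (\<forall>n. trig_poly (P n)) \<and> (\<forall>n x. \<bar>P n x\<bar> \<le> B)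
    \<and> (\<forall>x. (\<lambda>n. P n x) \<longlonglongrightarrow> indicator {..a} x)"
proof -
  have "\<forall>i. \<exists>P. (\<forall>n. trig_poly (P n)) \<and> (\<forall>n (x::real^'n). \<bar>P n x\<bar> \<le> 2)
    \<and> (\<forall>x. (\<lambda>n. P n x) \<longlonglongrightarrow> indicator {..a $ i} (axis i 1 \<bullet> x))"
    by (intro allI trig_poly_approx_halfline)
  then obtain P where P: "\<And>i n. trig_poly (P i n)" "\<And>i n x. \<bar>P i n (x::real^'n)\<bar> \<le> 2"
    "\<And>i x. (\<lambda>n. P i n x) \<longlonglongrightarrow> indicator {..a $ i} (axis i 1 \<bullet> x)"
    by metis
  have "trig_poly (\<lambda>x. \<Prod>i\<in>UNIV. P i n x)" for n by (intro trig_poly_prod P) auto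
  moreover have "\<bar>\<Prod>i\<in>UNIV. P i n x\<bar> \<le> 2 ^ CARD('n)" for n x
    unfolding abs_prod using prod_mono[of UNIV "\<lambda>i. \<bar>P i n x\<bar>" "\<lambda>_. 2"] P(2) by simp
  moreover have "(\<lambda>n. \<Prod>i\<in>UNIV. P i n x) \<longlonglongrightarrow> indicator {..a} x" for x
  proof -
    have "(\<lambda>n. \<Prod>i\<in>UNIV. P i n x) \<longlonglongrightarrow> (\<Prod>i\<in>UNIV. indicator {..a $ i} (x $ i))"
      using P(3)[of _ x] by (intro tendsto_prod) (auto simp: inner_axis' )
    moreover have "(\<Prod>i\<in>UNIV. indicator {..a $ i} (x $ i)) = (indicator {..a} x :: real)"
      by (auto simp: indicator_def less_eq_vec_def)
    ultimately show ?thesis by simp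
  qed
  ultimately show ?thesis by (intro exI[of _ "\<lambda>n x. \<Prod>i\<in>UNIV. P i n x"] exI[of _ "2 ^ CARD('n)"]) auto
qed

lemma Int_stable_orthants: "Int_stable (range (\<lambda>a::real^'n. {..a}))"
proof (rule Int_stableI_image)
  fix a b :: "real^'n"
  show "\<exists>c\<in>UNIV. {..a} \<inter> {..b} = {..c}"
    by (intro bexI[of _ "inf a b"]) auto
qed

lemma integrable_bounded_borel:
  fixes f :: "'a \<Rightarrow> real"
  assumes "prob_space M" "f \<in> borel_measurable M" "\<And>x. \<bar>f x\<bar> \<le> K"
  shows "integrable M f"
proof -
  interpret prob_space M by fact
  show ?thesis by (rule integrable_const_bound[where B=K]) (use assms in auto)
qed

lemma trig_poly_integral_eq:
  fixes f :: "'a::euclidean_space \<Rightarrow> real"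
  assumes "trig_poly f"
    and M: "prob_space M" "sets M = sets borel" and N: "prob_space N" "sets N = sets borel"
    and c: "\<And>u. (\<integral>x. cos (u \<bullet> x) \<partial>M) = (\<integral>x. cos (u \<bullet> x) \<partial>N)"
    and s: "\<And>u. (\<integral>x. sin (u \<bullet> x) \<partial>M) = (\<integral>x. sin (u \<bullet> x) \<partial>N)"
  shows "integral\<^sup>L M f = integral\<^sup>L N f"
  using assms(1)
proof (induction rule: trig_poly.induct)
  case (trig_wave r u c)
  have *: "r * cos (u \<bullet> x + c) = r * cos c * cos (u \<bullet> x) - r * sin c * sin (u \<bullet> x)" for x
    by (simp add: cos_add algebra_simps)
  have i: "integrable Q (\<lambda>x. cos (u \<bullet> x))" "integrable Q (\<lambda>x. sin (u \<bullet> x))"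
    if "prob_space Q" "sets Q = sets borel" for Q
    using that by (auto intro!: integrable_bounded_borel[where K=1] simp: measurable_cong_sets[OF that(2) refl])
  show ?case
    unfolding * using i[OF M] i[OF N] by (simp add: c s)
next
  case (trig_add f g)
  have i: "integrable Q h"
    if "prob_space Q" "sets Q = sets borel" "trig_poly h" for Q h
    using that trig_poly_bounded[OF that(3)] trig_poly_borel[OF that(3)]
    by (auto intro!: integrable_bounded_borel simp: measurable_cong_sets[OF that(2) refl])
  show ?case
    using trig_add i[OF M] i[OF N] by simp
qed

text \<open>Equal characteristic functions give equal integrals of trigonometric polynomials, hence equal
  masses of orthants, and the orthants are an intersection-stable generator of the Borel sets.\<close>

theorem characteristic_function_unique:
  fixes M N :: "(real ^ 'n) measure"
  assumes M: "prob_space M" "sets M = sets borel" and N: "prob_space N" "sets N = sets borel"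
    and c: "\<And>u. (\<integral>x. cos (u \<bullet> x) \<partial>M) = (\<integral>x. cos (u \<bullet> x) \<partial>N)"
    and s: "\<And>u. (\<integral>x. sin (u \<bullet> x) \<partial>M) = (\<integral>x. sin (u \<bullet> x) \<partial>N)"
  shows "M = N"
proof (rule measure_eqI_generator_eq[OF Int_stable_orthants, of UNIV])
  interpret M: prob_space M by fact
  interpret N: prob_space N by fact
  show "range atMost \<subseteq> Pow (UNIV :: (real^'n) set)" by simp
  show "sets M = sigma_sets UNIV (range (\<lambda>a. {..a}))" "sets N = sigma_sets UNIV (range (\<lambda>a. {..a}))"
    using M N by (simp_all add: borel_eq_atMost)
  show "range (\<lambda>n::nat. {..(\<chi> i. real n) :: real^'n}) \<subseteq> range atMost" by auto
  show "(\<Union>n::nat. {..(\<chi> i. real n) :: real^'n}) = UNIV"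
  proof -
    have "\<exists>n::nat. x \<le> (\<chi> i. real n)" for x :: "real^'n"
    proof -
      obtain n :: nat where "norm x \<le> real n" using real_arch_simple by blast
      moreover have "x $ i \<le> norm x" for i using component_le_norm_cart[of x i] by linarith
      ultimately show ?thesis unfolding less_eq_vec_def by (auto intro: order_trans)
    qed
    then show ?thesis by auto
  qed
  show "emeasure M {..(\<chi> i. real n) :: real^'n} \<noteq> \<infinity>" for n :: nat by simp
  fix X assume "X \<in> range (\<lambda>a::real^'n. {..a})"
  then obtain a where X: "X = {..a}" by auto
  obtain P B where P: "\<And>n. trig_poly (P n)" "\<And>n x. \<bar>P n x\<bar> \<le> B"
    "\<And>x. (\<lambda>n. P n x) \<longlonglongrightarrow> indicator {..a} x"
    using trig_poly_approx_orthant[of a] by blast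
  have lim: "(\<lambda>n. integral\<^sup>L Q (P n)) \<longlonglongrightarrow> measure Q {..a}"
    if "prob_space Q" "sets Q = sets borel" for Q :: "(real^'n) measure"
  proof -
    interpret prob_space Q by fact
    note [measurable_cong] = that(2)
    have [measurable]: "P n \<in> borel_measurable Q" for n
      using trig_poly_borel[OF P(1)] by measurable
    have "(\<lambda>n. integral\<^sup>L Q (P n)) \<longlonglongrightarrow> integral\<^sup>L Q (indicator {..a})"
      by (rule integral_dominated_convergence[where w="\<lambda>_. B"])
        (use P that in \<open>auto simp: measurable_cong_sets[OF that(2) refl]\<close>)
    then show ?thesis by (simp add: that(2) sets_eq_imp_space_eq[OF that(2)])
  qed
  have "measure M {..a} = measure N {..a}"
    using lim[OF M] lim[OF N] trig_poly_integral_eq[OF P(1) M N c s]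
    by (simp add: LIMSEQ_unique)
  then show "emeasure M X = emeasure N X"
    by (simp add: X M.emeasure_eq_measure N.emeasure_eq_measure)
qed

section \<open>The standard Gaussian distribution on Euclidean space\<close>

lemma abs_integral_le:
  fixes f g :: "'a \<Rightarrow> real"
  assumes "integrable M f" "integrable M g" "\<And>x. x \<in> space M \<Longrightarrow> \<bar>f x\<bar> \<le> g x"
  shows "\<bar>integral\<^sup>L M f\<bar> \<le> integral\<^sup>L M g"
  by (rule order_trans[OF integral_abs_bound]) (rule integral_mono, use assms in auto)

definition gauss_density :: "real ^ 'n \<Rightarrow> real" where
  "gauss_density x = (2 * pi) powr (- real CARD('n) / 2) * exp (- (norm x)\<^sup>2 / 2)"

lemma std_gaussian_eq: "std_gaussian = density lborel (\<lambda>x. ennreal (gauss_density x))"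
  by (simp add: std_gaussian_def gauss_density_def)

lemma gauss_density_pos: "0 < gauss_density x"
  by (simp add: gauss_density_def)

lemma gauss_density_borel [measurable]: "gauss_density \<in> borel_measurable borel"
  unfolding gauss_density_def by measurable

lemma sets_std_gaussian [simp, measurable_cong]: "sets std_gaussian = sets borel"
  by (simp add: std_gaussian_eq)

lemma space_std_gaussian [simp]: "space std_gaussian = UNIV"
  by (simp add: std_gaussian_eq)

lemma prod_exp_Basis: "(\<Prod>b\<in>Basis. exp (- (x \<bullet> b)\<^sup>2 / 2)) = exp (- (norm (x :: 'a::euclidean_space))\<^sup>2 / 2)"
proof -
  have "(norm x)\<^sup>2 = (\<Sum>b\<in>Basis. (x \<bullet> b)\<^sup>2)"
    unfolding power2_norm_eq_inner by (subst euclidean_inner) (simp add: power2_eq_square)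
  then show ?thesis
    by (simp add: sum_negf sum_divide_distrib flip: exp_sum)
qed

lemma gauss_density_prod:
  "gauss_density (x :: real ^ 'n) = (\<Prod>b\<in>Basis. std_normal_density (x \<bullet> b))"
proof -
  have "(\<Prod>b\<in>Basis. std_normal_density (x \<bullet> b))
      = (1 / sqrt (2 * pi)) ^ CARD('n) * (\<Prod>b\<in>Basis. exp (- (x \<bullet> b)\<^sup>2 / 2))"
    by (simp add: std_normal_density_def prod.distrib prod_dividef power_divide)
  also have "(\<Prod>b\<in>Basis. exp (- (x \<bullet> b)\<^sup>2 / 2)) = exp (- (norm x)\<^sup>2 / 2)"
    by (rule prod_exp_Basis)
  also have "(1 / sqrt (2 * pi)) ^ CARD('n) = (2 * pi) powr (- real CARD('n) / 2)"
  proof -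
    have "1 / sqrt (2 * pi) = (2 * pi) powr (- (1 / 2))"
      using powr_half_sqrt[of "2 * pi"] by (simp add: powr_minus_divide del: powr_half_sqrt)
    then have "(1 / sqrt (2 * pi)) ^ CARD('n) = (2 * pi) powr (real CARD('n) * (- (1 / 2)))"
      using powr_power[of "2 * pi" "- (1 / 2)" "CARD('n)"] by simp
    then show ?thesis by (simp add: mult.commute)
  qed
  finally show ?thesis by (simp add: gauss_density_def)
qed

text \<open>Lebesgue measure is the image of a product measure, so integrals of products of functions of the
  single coordinates factorise.\<close>

lemma integral_lborel_prod:
  fixes f :: "'a::euclidean_space \<Rightarrow> real \<Rightarrow> complex"
  assumes f: "\<And>b. b \<in> Basis \<Longrightarrow> integrable lborel (f b)"
  shows "(\<integral>x. (\<Prod>b\<in>Basis. f b (x \<bullet> b)) \<partial>(lborel :: 'a measure)) = (\<Prod>b\<in>Basis. (\<integral>x. f b x \<partial>lborel))"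
proof -
  interpret product_sigma_finite "\<lambda>_::'a. lborel :: real measure" ..
  have [measurable]: "f b \<in> borel_measurable borel" if "b \<in> Basis" for b
    using borel_measurable_integrable[OF f[OF that]] by simp
  have "(\<integral>x. (\<Prod>b\<in>Basis. f b (x \<bullet> b)) \<partial>(lborel :: 'a measure))
      = (\<integral>y. (\<Prod>b\<in>Basis. f b ((\<Sum>b\<in>Basis. y b *\<^sub>R b) \<bullet> b)) \<partial>(\<Pi>\<^sub>M b\<in>(Basis :: 'a set). lborel))"
    by (subst lborel_eq, subst integral_distr) auto
  also have "\<dots> = (\<integral>y. (\<Prod>b\<in>Basis. f b (y b)) \<partial>(\<Pi>\<^sub>M b\<in>(Basis :: 'a set). lborel))"
    by (intro Bochner_Integration.integral_cong refl prod.cong) (simp add: inner_sum_left inner_Basis if_distrib cong: if_cong)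
  also have "\<dots> = (\<Prod>b\<in>Basis. (\<integral>x. f b x \<partial>lborel))"
    by (intro product_integral_prod f) auto
  finally show ?thesis .
qed

lemma nn_integral_gauss_density: "(\<integral>\<^sup>+x. ennreal (gauss_density (x :: real ^ 'n)) \<partial>lborel) = 1"
proof -
  have "(\<integral>\<^sup>+x. ennreal (std_normal_density x) \<partial>lborel) = 1"
    using prob_space.emeasure_space_1[OF prob_space_normal_density[of 1 0]]
    by (simp add: emeasure_density)
  then show ?thesis
    unfolding gauss_density_prod
    using nn_integral_lborel_prod[of "\<lambda>_::real^'n. \<lambda>x. ennreal (std_normal_density x)"]
    by (simp add: prod_ennreal[symmetric])
qed

lemma prob_space_std_gaussian: "prob_space (std_gaussian :: (real ^ 'n) measure)"
  by (rule prob_spaceI) (simp add: std_gaussian_eq emeasure_density nn_integral_gauss_density)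

lemma std_gaussian_char:
  "(\<integral>x. iexp (u \<bullet> x) \<partial>std_gaussian) = complex_of_real (exp (- (norm (u :: real ^ 'n))\<^sup>2 / 2))"
proof -
  have c: "(\<integral>x. std_normal_density x *\<^sub>R iexp (t * x) \<partial>lborel) = complex_of_real (exp (- (t\<^sup>2) / 2))" for t
    using fun_cong[OF char_std_normal_distribution, of t]
    by (simp add: char_def integral_density)
  have i: "integrable lborel (\<lambda>x. std_normal_density x *\<^sub>R iexp (t * x))" for t
    by (rule Bochner_Integration.integrable_bound[OF integrable_std_normal_moment[of 0]]) auto
  have "(\<integral>x. iexp (u \<bullet> x) \<partial>std_gaussian) = (\<integral>x. gauss_density x *\<^sub>R iexp (u \<bullet> x) \<partial>lborel)"
    unfolding std_gaussian_eq using gauss_density_pos by (subst integral_density) (auto intro: less_imp_le)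
  also have "\<dots> = (\<integral>x. (\<Prod>b\<in>Basis. std_normal_density (x \<bullet> b) *\<^sub>R iexp ((u \<bullet> b) * (x \<bullet> b))) \<partial>lborel)"
  proof (rule Bochner_Integration.integral_cong[OF refl])
    fix x :: "real ^ 'n"
    have "iexp (u \<bullet> x) = (\<Prod>b\<in>Basis. iexp ((u \<bullet> b) * (x \<bullet> b)))"
      by (subst exp_sum[symmetric]) (simp_all add: euclidean_inner[of u x] sum_distrib_left)
    then show "gauss_density x *\<^sub>R iexp (u \<bullet> x) = (\<Prod>b\<in>Basis. std_normal_density (x \<bullet> b) *\<^sub>R iexp ((u \<bullet> b) * (x \<bullet> b)))"
      by (simp add: gauss_density_prod scaleR_conv_of_real prod.distrib)
  qed
  also have "\<dots> = (\<Prod>b\<in>Basis. complex_of_real (exp (- ((u \<bullet> b)\<^sup>2) / 2)))"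
    by (subst integral_lborel_prod) (simp_all only: i c)
  also have "\<dots> = complex_of_real (\<Prod>b\<in>Basis. exp (- ((u \<bullet> b)\<^sup>2) / 2))" by simp
  also have "(\<Prod>b\<in>Basis. exp (- ((u \<bullet> b)\<^sup>2) / 2)) = exp (- (norm u)\<^sup>2 / 2)"
    by (rule prod_exp_Basis)
  finally show ?thesis .
qed

lemma std_gaussian_cos: "(\<integral>x. cos (u \<bullet> x) \<partial>std_gaussian) = exp (- (norm (u :: real ^ 'n))\<^sup>2 / 2)"
  and std_gaussian_sin: "(\<integral>x. sin (u \<bullet> x) \<partial>std_gaussian) = 0"
proof -
  interpret prob_space "std_gaussian :: (real ^ 'n) measure" by (rule prob_space_std_gaussian)
  have i: "integrable std_gaussian (\<lambda>x. iexp (u \<bullet> x))"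
    by (rule integrable_const_bound[where B=1]) auto
  have "Re (\<integral>x. iexp (u \<bullet> x) \<partial>std_gaussian) = (\<integral>x. cos (u \<bullet> x) \<partial>std_gaussian)"
    "Im (\<integral>x. iexp (u \<bullet> x) \<partial>std_gaussian) = (\<integral>x. sin (u \<bullet> x) \<partial>std_gaussian)"
    unfolding integral_Re[OF i, symmetric] integral_Im[OF i, symmetric]
    by (simp_all add: exp_Euler cos_of_real sin_of_real)
  then show "(\<integral>x. cos (u \<bullet> x) \<partial>std_gaussian) = exp (- (norm u)\<^sup>2 / 2)"
    "(\<integral>x. sin (u \<bullet> x) \<partial>std_gaussian) = 0"
    unfolding std_gaussian_char by simp_all
qed

text \<open>Scheffe's lemma: the densities of the translates converge pointwise and have the same integral, so
  they converge in \<open>L\<^sup>1\<close>.  Hence \<open>f\<close> may be any bounded Borel function.\<close>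

lemma std_gaussian_translate_continuous:
  fixes f :: "real ^ 'n \<Rightarrow> real"
  assumes [measurable]: "f \<in> borel_measurable borel" and K: "\<And>x. \<bar>f x\<bar> \<le> K"
  shows "isCont (\<lambda>w. \<integral>x. f (x + w) \<partial>std_gaussian) 0"
proof -
  have int: "integrable lborel (\<lambda>x. gauss_density (x - w :: real^'n))" for w
  proof -
    have "(\<integral>\<^sup>+x. ennreal (gauss_density (x - w)) \<partial>lborel) = (\<integral>\<^sup>+x. ennreal (gauss_density (x :: real^'n)) \<partial>lborel)"
      using nn_integral_distr[of "(+) w" lborel borel "\<lambda>x. ennreal (gauss_density (x - w))"]
      by (simp add: lborel_distr_plus)
    then show ?thesis
      using nn_integral_gauss_density[where 'n='n]
      by (subst integrable_iff_bounded) (simp add: abs_of_pos gauss_density_pos)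
  qed
  have nn: "(\<integral>\<^sup>+x. ennreal (gauss_density (x - w :: real^'n)) \<partial>lborel) = 1" for w
    using nn_integral_distr[of "(+) w" lborel borel "\<lambda>x. ennreal (gauss_density (x - w))"]
    by (simp add: lborel_distr_plus nn_integral_gauss_density)
  have Kpos: "0 \<le> K" using K[of 0] by linarith
  have fint: "integrable lborel (\<lambda>x. gauss_density (x - w) * f x)" for w
    by (rule Bochner_Integration.integrable_bound[OF integrable_mult_left[OF int[of w], of K]])
      (use K Kpos in \<open>auto simp: abs_mult intro!: mult_left_mono AE_I2\<close>)
  have shift: "(\<integral>x. f (x + w) \<partial>std_gaussian) = (\<integral>x. gauss_density (x - w) * f x \<partial>lborel)" for w
  proof -
    have "(\<integral>x. f (x + w) \<partial>std_gaussian) = (\<integral>x. gauss_density x * f (x + w) \<partial>lborel)"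
      unfolding std_gaussian_eq using gauss_density_pos by (subst integral_density) (auto intro: less_imp_le)
    also have "\<dots> = (\<integral>x. gauss_density (x - w) * f x \<partial>lborel)"
      using integral_distr[of "(+) w" lborel borel "\<lambda>x. gauss_density (x - w) * f x"]
      by (simp add: lborel_distr_plus add.commute)
    finally show ?thesis .
  qed
  show ?thesis
  proof (rule continuous_at_sequentiallyI)
    fix w :: "nat \<Rightarrow> real ^ 'n" assume w: "w \<longlonglongrightarrow> 0"
    have "(\<lambda>n. \<integral>\<^sup>+x. ennreal (norm (gauss_density (x - w n) - gauss_density x)) \<partial>lborel) \<longlonglongrightarrow> ennreal 0"
      unfolding ennreal_0
    proof (rule Scheffe_lemma2)
      show "integrable lborel (gauss_density :: real^'n \<Rightarrow> real)" using int[of 0] by simp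
      have "(\<lambda>n. gauss_density (x - w n)) \<longlonglongrightarrow> gauss_density (x - 0)" for x
        unfolding gauss_density_def using w by (intro tendsto_intros) auto
      then show "AE x in lborel. (\<lambda>n. gauss_density (x - w n)) \<longlonglongrightarrow> gauss_density x" by simp
      show "(\<integral>\<^sup>+ x. ennreal (norm (gauss_density (x - w n))) \<partial>lborel)
          \<le> (\<integral>\<^sup>+ x. ennreal (norm (gauss_density (x::real^'n))) \<partial>lborel)" for n
        using nn[of "w n"] nn[of 0] by (simp add: abs_of_pos gauss_density_pos)
    qed auto
    then have "(\<lambda>n. enn2real (\<integral>\<^sup>+x. ennreal (norm (gauss_density (x - w n) - gauss_density x)) \<partial>lborel)) \<longlonglongrightarrow> 0"
      by (rule tendsto_enn2real) simp
    then have lim: "(\<lambda>n. \<integral>x. \<bar>gauss_density (x - w n) - gauss_density x\<bar> \<partial>lborel) \<longlonglongrightarrow> 0"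
      by (subst integral_eq_nn_integral) auto
    have bound: "\<bar>(\<integral>x. f (x + w n) \<partial>std_gaussian) - (\<integral>x. f (x + 0) \<partial>std_gaussian)\<bar>
        \<le> (\<integral>x. \<bar>gauss_density (x - w n) - gauss_density x\<bar> \<partial>lborel) * K" for n
    proof -
      have "(\<integral>x. f (x + w n) \<partial>std_gaussian) - (\<integral>x. f (x + 0) \<partial>std_gaussian)
          = (\<integral>x. (gauss_density (x - w n) - gauss_density x) * f x \<partial>lborel)"
        unfolding shift using fint[of "w n"] fint[of 0] by (simp add: left_diff_distrib)
      also have "\<bar>\<dots>\<bar> \<le> (\<integral>x. \<bar>gauss_density (x - w n) - gauss_density x\<bar> * K \<partial>lborel)"
      proof (rule abs_integral_le)
        show "integrable lborel (\<lambda>x. (gauss_density (x - w n) - gauss_density x) * f x)"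
          using fint[of "w n"] fint[of 0] by (simp add: left_diff_distrib)
        show "integrable lborel (\<lambda>x. \<bar>gauss_density (x - w n) - gauss_density x\<bar> * K)"
          using int[of "w n"] int[of 0] by auto
      qed (use K in \<open>auto simp: abs_mult intro!: mult_left_mono\<close>)
      finally show ?thesis by simp
    qed
    show "(\<lambda>n. \<integral>x. f (x + w n) \<partial>std_gaussian) \<longlonglongrightarrow> (\<integral>x. f (x + 0) \<partial>std_gaussian)"
    proof (rule LIM_zero_cancel, rule Lim_null_comparison)
      show "(\<lambda>n. (\<integral>x. \<bar>gauss_density (x - w n) - gauss_density x\<bar> \<partial>lborel) * K) \<longlonglongrightarrow> 0"
        by (rule tendsto_mult_left_zero[OF lim])
    qed (intro always_eventually allI, unfold real_norm_def, rule bound)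
  qed
qed

section \<open>Empirical measures of asymptotically independent particles\<close>

lemma (in prob_space) square_expectation_le:
  fixes f :: "'a \<Rightarrow> real"
  assumes "f \<in> borel_measurable M" "\<And>x. \<bar>f x\<bar> \<le> K"
  shows "(expectation f)\<^sup>2 \<le> expectation (\<lambda>x. (f x)\<^sup>2)"
proof -
  have K: "0 \<le> K" using assms(2)[of undefined] by linarith
  have "integrable M f"
    by (rule integrable_const_bound[where B=K]) (use assms in auto)
  moreover have "integrable M (\<lambda>x. (f x)\<^sup>2)"
    by (rule integrable_const_bound[where B="K\<^sup>2"])
      (use assms K in \<open>auto simp: abs_le_square_iff[symmetric]\<close>)
  ultimately show ?thesis
    using variance_positive[of f] variance_eq[of f] by simp
qed

lemma tendsto_zero_le:
  fixes f g :: "'a \<Rightarrow> real"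
  assumes "(g \<longlongrightarrow> 0) F" "\<And>x. 0 \<le> f x" "\<And>x. f x \<le> g x"
  shows "(f \<longlongrightarrow> 0) F"
  by (rule tendsto_sandwich[OF _ _ tendsto_const assms(1)]) (simp_all add: assms(2,3))

lemma square_sum_le: "(a + b)\<^sup>2 \<le> 2 * a\<^sup>2 + 2 * (b::real)\<^sup>2"
  using zero_le_power2[of "a - b"] by (simp add: power2_eq_square algebra_simps)

lemma square_sum3_le: "(a + b + c)\<^sup>2 \<le> 3 * a\<^sup>2 + 3 * b\<^sup>2 + 3 * (c::real)\<^sup>2"
  using zero_le_power2[of "a - b"] zero_le_power2[of "a - c"] zero_le_power2[of "b - c"]
  by (simp add: power2_eq_square algebra_simps)

text \<open>\<open>X t \<omega> x\<close> is the position at time \<open>t\<close> of the particle with label \<open>x\<close>, and \<open>\<mu>\<close> weighs the labels.  The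
  right-hand side of \<open>two_point\<close> is the squared modulus of the characteristic function of \<open>\<gamma>\<close>, that is
  the characteristic function of the difference of two independent variables with law \<open>\<gamma>\<close>.\<close>

locale asymptotically_independent = prob_space M + \<mu>: prob_space \<mu> + \<gamma>: prob_space \<gamma>
  for M :: "'w measure" and \<mu> :: "'b measure" and \<gamma> :: "(real ^ 'n) measure" +
  fixes X :: "real \<Rightarrow> 'w \<Rightarrow> 'b \<Rightarrow> real ^ 'n"
  assumes sets_\<gamma> [measurable_cong]: "sets \<gamma> = sets borel"
    and X_measurable: "\<And>t. (\<lambda>(\<omega>, x). X t \<omega> x) \<in> borel_measurable (M \<Otimes>\<^sub>M \<mu>)"
    and one_point: "\<And>(f :: real ^ 'n \<Rightarrow> real) K x. \<lbrakk>f \<in> borel_measurable borel; \<And>z. \<bar>f z\<bar> \<le> K; x \<in> space \<mu>\<rbrakk>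
      \<Longrightarrow> ((\<lambda>t. \<integral>\<omega>. f (X t \<omega> x) \<partial>M) \<longlongrightarrow> (\<integral>z. f z \<partial>\<gamma>)) at_top"
    and two_point: "\<And>u. AE x in \<mu>. AE y in \<mu>.
      ((\<lambda>t. \<integral>\<omega>. cos (u \<bullet> (X t \<omega> x - X t \<omega> y)) \<partial>M)
        \<longlongrightarrow> (\<integral>z. cos (u \<bullet> z) \<partial>\<gamma>)\<^sup>2 + (\<integral>z. sin (u \<bullet> z) \<partial>\<gamma>)\<^sup>2) at_top"
begin

lemma X_measurable' [measurable (raw)]:
  "f \<in> measurable N M \<Longrightarrow> g \<in> measurable N \<mu> \<Longrightarrow> (\<lambda>n. X t (f n) (g n)) \<in> borel_measurable N"
  using measurable_compose[OF measurable_Pair X_measurable, of f N g] by simp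

sublocale P: pair_sigma_finite M \<mu> ..
sublocale PP: pair_prob_space M \<mu> ..

definition average :: "(real ^ 'n \<Rightarrow> real) \<Rightarrow> real \<Rightarrow> 'w \<Rightarrow> real" where
  "average f t \<omega> = (\<integral>x. f (X t \<omega> x) \<partial>\<mu>)"

definition converging :: "(real ^ 'n \<Rightarrow> real) \<Rightarrow> bool" where
  "converging f \<longleftrightarrow> f \<in> borel_measurable borel \<and> (\<exists>K. \<forall>z. \<bar>f z\<bar> \<le> K) \<and>
    ((\<lambda>t. \<integral>\<omega>. (average f t \<omega> - (\<integral>z. f z \<partial>\<gamma>))\<^sup>2 \<partial>M) \<longlongrightarrow> 0) at_top"

lemma convergingI:
  assumes "f \<in> borel_measurable borel" "\<And>z. \<bar>f z\<bar> \<le> K"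
    "((\<lambda>t. \<integral>\<omega>. (average f t \<omega> - (\<integral>z. f z \<partial>\<gamma>))\<^sup>2 \<partial>M) \<longlongrightarrow> 0) at_top"
  shows "converging f"
  using assms unfolding converging_def by blast

lemma convergingD:
  assumes "converging f"
  shows "f \<in> borel_measurable borel" "\<exists>K. \<forall>z. \<bar>f z\<bar> \<le> K"
    "((\<lambda>t. \<integral>\<omega>. (average f t \<omega> - (\<integral>z. f z \<partial>\<gamma>))\<^sup>2 \<partial>M) \<longlongrightarrow> 0) at_top"
  using assms unfolding converging_def by blast+

lemma average_measurable [measurable]:
  assumes [measurable]: "f \<in> borel_measurable borel"
  shows "average f t \<in> borel_measurable M"
  unfolding average_def by measurable

lemma
  fixes f :: "real ^ 'n \<Rightarrow> real"
  assumes [measurable]: "f \<in> borel_measurable borel" and K: "\<And>z. \<bar>f z\<bar> \<le> K"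
  shows integrable_bounded_\<mu>: "\<omega> \<in> space M \<Longrightarrow> integrable \<mu> (\<lambda>x. f (X t \<omega> x))"
    and integrable_bounded_M: "x \<in> space \<mu> \<Longrightarrow> integrable M (\<lambda>\<omega>. f (X t \<omega> x))"
    and integrable_bounded_\<gamma>: "integrable \<gamma> f"
    and integrable_bounded_pair: "integrable (M \<Otimes>\<^sub>M \<mu>) (\<lambda>(\<omega>, x). f (X t \<omega> x))"
  using K by (auto intro!: \<mu>.integrable_const_bound[where B=K] \<gamma>.integrable_const_bound[where B=K]
      integrable_const_bound[where B=K] PP.integrable_const_bound[where B=K])

lemma abs_average_le:
  fixes f :: "real ^ 'n \<Rightarrow> real"
  assumes [measurable]: "f \<in> borel_measurable borel" and K: "\<And>z. \<bar>f z\<bar> \<le> K"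
  shows "\<bar>average f t \<omega>\<bar> \<le> K"
proof -
  have "0 \<le> K" using K[of 0] by linarith
  show ?thesis
  proof (cases "integrable \<mu> (\<lambda>x. f (X t \<omega> x))")
    case True
    then have "\<bar>average f t \<omega>\<bar> \<le> (\<integral>x. K \<partial>\<mu>)"
      unfolding average_def
      by (intro abs_integral_le) (use K in auto)
    then show ?thesis by (simp add: \<mu>.prob_space)
  next
    case False
    then show ?thesis unfolding average_def using \<open>0 \<le> K\<close> by (simp add: not_integrable_integral_eq)
  qed
qed

lemma integrable_average:
  fixes f :: "real ^ 'n \<Rightarrow> real"
  assumes [measurable]: "f \<in> borel_measurable borel" and K: "\<And>z. \<bar>f z\<bar> \<le> K"
  shows "integrable M (average f t)" "integrable M (\<lambda>\<omega>. (average f t \<omega>)\<^sup>2)"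
    "integrable M (\<lambda>\<omega>. (average f t \<omega> - c)\<^sup>2)"
proof -
  have b: "\<bar>average f t \<omega>\<bar> \<le> K" for \<omega> by (rule abs_average_le[OF assms])
  show i: "integrable M (average f t)"
    by (rule integrable_const_bound[where B=K]) (use b in auto)
  have "(average f t \<omega>)\<^sup>2 \<le> K\<^sup>2" for \<omega>
    using power_mono[OF b, of \<omega> 2] by simp
  then show i2: "integrable M (\<lambda>\<omega>. (average f t \<omega>)\<^sup>2)"
    by (intro integrable_const_bound[where B="K\<^sup>2"]) auto
  show "integrable M (\<lambda>\<omega>. (average f t \<omega> - c)\<^sup>2)"
    unfolding power2_diff using i i2 by auto
qed

lemma mean_average:
  fixes f :: "real ^ 'n \<Rightarrow> real"
  assumes [measurable]: "f \<in> borel_measurable borel" and K: "\<And>z. \<bar>f z\<bar> \<le> K"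
  shows "((\<lambda>t. \<integral>\<omega>. average f t \<omega> \<partial>M) \<longlongrightarrow> (\<integral>z. f z \<partial>\<gamma>)) at_top"
proof -
  have "(\<integral>\<omega>. average f t \<omega> \<partial>M) = (\<integral>x. (\<integral>\<omega>. f (X t \<omega> x) \<partial>M) \<partial>\<mu>)" for t
    unfolding average_def using integrable_bounded_pair[OF assms, of t] by (intro P.Fubini_integral[symmetric])
  moreover have "((\<lambda>t. \<integral>x. (\<integral>\<omega>. f (X t \<omega> x) \<partial>M) \<partial>\<mu>) \<longlongrightarrow> (\<integral>x. (\<integral>z. f z \<partial>\<gamma>) \<partial>\<mu>)) at_top"
  proof (rule integral_dominated_convergence_at_top[where w="\<lambda>_. K"])
    show "AE x in \<mu>. ((\<lambda>t. \<integral>\<omega>. f (X t \<omega> x) \<partial>M) \<longlongrightarrow> (\<integral>z. f z \<partial>\<gamma>)) at_top"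
      using one_point[of f K] K by auto
    have "\<bar>\<integral>\<omega>. f (X t \<omega> x) \<partial>M\<bar> \<le> K" if "x \<in> space \<mu>" for t x
    proof -
      have "\<bar>\<integral>\<omega>. f (X t \<omega> x) \<partial>M\<bar> \<le> (\<integral>\<omega>. K \<partial>M)"
        by (intro abs_integral_le integrable_bounded_M[OF assms that])
          (use K in auto)
      then show ?thesis by (simp add: prob_space)
    qed
    then show "\<forall>\<^sub>F t in at_top. AE x in \<mu>. norm (\<integral>\<omega>. f (X t \<omega> x) \<partial>M) \<le> K"
      by (intro always_eventually allI AE_I2) auto
  qed auto
  ultimately show ?thesis by (simp add: \<mu>.prob_space)
qed

text \<open>The sum of the squares of the averages of \<open>cos(u \<bullet> z)\<close> and \<open>sin(u \<bullet> z)\<close> is the double integral of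
  \<open>cos(u \<bullet> (X(x) - X(y)))\<close>, whose expectation is controlled by \<open>two_point\<close>.  Together with the convergence of
  the means this shows that the two mean square errors have a sum that tends to \<open>0\<close>.\<close>

lemma converging_wave: "converging (\<lambda>z. cos (u \<bullet> z))" "converging (\<lambda>z. sin (u \<bullet> z))"
proof -
  let ?c = "\<lambda>z::real^'n. cos (u \<bullet> z)" and ?s = "\<lambda>z::real^'n. sin (u \<bullet> z)"
  define C where "C = (\<integral>z. ?c z \<partial>\<gamma>)"
  define S where "S = (\<integral>z. ?s z \<partial>\<gamma>)"
  define g where "g t \<omega> x y = cos (u \<bullet> (X t \<omega> x - X t \<omega> y))" for t \<omega> x y
  have [measurable]: "?c \<in> borel_measurable borel" "?s \<in> borel_measurable borel" by measurable
  have b: "\<bar>?c z\<bar> \<le> 1" "\<bar>?s z\<bar> \<le> 1" for z by auto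
  have g_mult: "g t \<omega> x y = ?c (X t \<omega> x) * ?c (X t \<omega> y) + ?s (X t \<omega> x) * ?s (X t \<omega> y)" for t \<omega> x y
    by (simp add: g_def inner_diff_right cos_diff)
  have g1: "\<bar>g t \<omega> x y\<bar> \<le> 1" for t \<omega> x y by (simp add: g_def)
  have g_meas: "(\<lambda>n. g t (p n) (q n) (r n)) \<in> borel_measurable N"
    if "p \<in> measurable N M" "q \<in> measurable N \<mu>" "r \<in> measurable N \<mu>" for p q r t and N :: "'c measure"
    using that unfolding g_def by measurable
  note g_meas [measurable (raw)]
  have i\<mu>: "integrable \<mu> (\<lambda>x. ?c (X t \<omega> x))" "integrable \<mu> (\<lambda>x. ?s (X t \<omega> x))" if "\<omega> \<in> space M" for t \<omega>
    using that by (auto intro!: \<mu>.integrable_const_bound[where B=1])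
  have gy: "(\<integral>y. g t \<omega> x y \<partial>\<mu>) = ?c (X t \<omega> x) * average ?c t \<omega> + ?s (X t \<omega> x) * average ?s t \<omega>"
    if "\<omega> \<in> space M" for t \<omega> x
    using i\<mu>[OF that]
    by (simp add: g_mult average_def)
  have sq: "(\<integral>x. (\<integral>y. g t \<omega> x y \<partial>\<mu>) \<partial>\<mu>) = (average ?c t \<omega>)\<^sup>2 + (average ?s t \<omega>)\<^sup>2"
    if "\<omega> \<in> space M" for t \<omega>
    using i\<mu>[OF that] that
    by (simp add: gy average_def power2_eq_square)
  have bd\<mu>: "\<bar>\<integral>y. h y \<partial>\<mu>\<bar> \<le> 1" if "h \<in> borel_measurable \<mu>" "\<And>y. \<bar>h y\<bar> \<le> 1" for h :: "'b \<Rightarrow> real"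
  proof -
    have "integrable \<mu> h" using that by (intro \<mu>.integrable_const_bound[where B=1]) auto
    then have "\<bar>\<integral>y. h y \<partial>\<mu>\<bar> \<le> (\<integral>y. 1 \<partial>\<mu>)"
      by (intro abs_integral_le) (use that in auto)
    then show ?thesis by (simp add: \<mu>.prob_space)
  qed
  have bdM: "\<bar>\<integral>\<omega>. h \<omega> \<partial>M\<bar> \<le> 1" if "h \<in> borel_measurable M" "\<And>y. y \<in> space M \<Longrightarrow> \<bar>h y\<bar> \<le> 1" for h :: "'w \<Rightarrow> real"
  proof -
    have "integrable M h" using that by (intro integrable_const_bound[where B=1]) auto
    then have "\<bar>\<integral>y. h y \<partial>M\<bar> \<le> (\<integral>y. 1 \<partial>M)"
      by (intro abs_integral_le) (use that in auto)
    then show ?thesis by (simp add: prob_space)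
  qed
  have inner: "((\<lambda>t. \<integral>y. (\<integral>\<omega>. g t \<omega> x y \<partial>M) \<partial>\<mu>) \<longlongrightarrow> (\<integral>y. C\<^sup>2 + S\<^sup>2 \<partial>\<mu>)) at_top"
    if x: "x \<in> space \<mu>" and lim: "AE y in \<mu>. ((\<lambda>t. \<integral>\<omega>. g t \<omega> x y \<partial>M) \<longlongrightarrow> C\<^sup>2 + S\<^sup>2) at_top" for x
    by (rule integral_dominated_convergence_at_top[where w="\<lambda>_. 1"])
      (use x lim g1 in \<open>auto intro!: always_eventually bdM AE_I2\<close>)
  have swap1: "(\<integral>\<omega>. (\<integral>y. g t \<omega> x y \<partial>\<mu>) \<partial>M) = (\<integral>y. (\<integral>\<omega>. g t \<omega> x y \<partial>M) \<partial>\<mu>)" if "x \<in> space \<mu>" for t x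
    using that g1 by (intro P.Fubini_integral[symmetric] PP.integrable_const_bound[where B=1])
      auto
  have swap2: "(\<integral>\<omega>. (\<integral>x. (\<integral>y. g t \<omega> x y \<partial>\<mu>) \<partial>\<mu>) \<partial>M) = (\<integral>x. (\<integral>\<omega>. (\<integral>y. g t \<omega> x y \<partial>\<mu>) \<partial>M) \<partial>\<mu>)" for t
  proof (intro P.Fubini_integral[symmetric] PP.integrable_const_bound[where B=1])
    show "(\<lambda>(\<omega>, x). \<integral>y. g t \<omega> x y \<partial>\<mu>) \<in> borel_measurable (M \<Otimes>\<^sub>M \<mu>)"
      by measurable
    show "AE p in M \<Otimes>\<^sub>M \<mu>. norm (case p of (\<omega>, x) \<Rightarrow> \<integral>y. g t \<omega> x y \<partial>\<mu>) \<le> 1"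
      by (intro AE_I2) (auto simp: space_pair_measure intro!: bd\<mu> g1)
  qed
  have "((\<lambda>t. \<integral>x. (\<integral>\<omega>. (\<integral>y. g t \<omega> x y \<partial>\<mu>) \<partial>M) \<partial>\<mu>) \<longlongrightarrow> (\<integral>x. (\<integral>y. C\<^sup>2 + S\<^sup>2 \<partial>\<mu>) \<partial>\<mu>)) at_top"
  proof (rule integral_dominated_convergence_at_top[where w="\<lambda>_. 1"])
    show "AE x in \<mu>. ((\<lambda>t. \<integral>\<omega>. (\<integral>y. g t \<omega> x y \<partial>\<mu>) \<partial>M) \<longlongrightarrow> (\<integral>y. C\<^sup>2 + S\<^sup>2 \<partial>\<mu>)) at_top"
      using two_point[of u]
    proof (rule AE_mp, intro AE_I2 impI)
      fix x assume x: "x \<in> space \<mu>" and lim: "AE y in \<mu>.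
         ((\<lambda>t. \<integral>\<omega>. cos (u \<bullet> (X t \<omega> x - X t \<omega> y)) \<partial>M) \<longlongrightarrow> (\<integral>z. ?c z \<partial>\<gamma>)\<^sup>2 + (\<integral>z. ?s z \<partial>\<gamma>)\<^sup>2) at_top"
      show "((\<lambda>t. \<integral>\<omega>. (\<integral>y. g t \<omega> x y \<partial>\<mu>) \<partial>M) \<longlongrightarrow> (\<integral>y. C\<^sup>2 + S\<^sup>2 \<partial>\<mu>)) at_top"
        unfolding swap1[OF x] using lim unfolding g_def[symmetric] C_def[symmetric] S_def[symmetric]
        by (rule inner[OF x])
    qed
    show "(\<lambda>x. \<integral>\<omega>. (\<integral>y. g t \<omega> x y \<partial>\<mu>) \<partial>M) \<in> borel_measurable \<mu>" for t
      by measurable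
    show "\<forall>\<^sub>F t in at_top. AE x in \<mu>. norm (\<integral>\<omega>. (\<integral>y. g t \<omega> x y \<partial>\<mu>) \<partial>M) \<le> 1"
      by (intro always_eventually allI AE_I2)
        (auto intro!: bdM bd\<mu> g1)
  qed auto
  then have lim2: "((\<lambda>t. (\<integral>\<omega>. (average ?c t \<omega>)\<^sup>2 + (average ?s t \<omega>)\<^sup>2 \<partial>M)) \<longlongrightarrow> C\<^sup>2 + S\<^sup>2) at_top"
    unfolding swap2[symmetric] by (simp add: sq \<mu>.prob_space cong: Bochner_Integration.integral_cong)
  have lims: "((\<lambda>t. \<integral>\<omega>. average ?c t \<omega> \<partial>M) \<longlongrightarrow> C) at_top" "((\<lambda>t. \<integral>\<omega>. average ?s t \<omega> \<partial>M) \<longlongrightarrow> S) at_top"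
    unfolding C_def S_def by (rule mean_average[where K=1]; simp)+
  have eq: "(\<integral>\<omega>. (average ?c t \<omega> - C)\<^sup>2 \<partial>M) + (\<integral>\<omega>. (average ?s t \<omega> - S)\<^sup>2 \<partial>M)
      = (\<integral>\<omega>. (average ?c t \<omega>)\<^sup>2 + (average ?s t \<omega>)\<^sup>2 \<partial>M) - 2 * C * (\<integral>\<omega>. average ?c t \<omega> \<partial>M)
        - 2 * S * (\<integral>\<omega>. average ?s t \<omega> \<partial>M) + C\<^sup>2 + S\<^sup>2" for t
    unfolding power2_diff using integrable_average[of ?c 1 t] integrable_average[of ?s 1 t]
    by (simp add: prob_space algebra_simps)
  have "((\<lambda>t. (\<integral>\<omega>. (average ?c t \<omega> - C)\<^sup>2 \<partial>M) + (\<integral>\<omega>. (average ?s t \<omega> - S)\<^sup>2 \<partial>M))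
      \<longlongrightarrow> C\<^sup>2 + S\<^sup>2 - 2 * C * C - 2 * S * S + C\<^sup>2 + S\<^sup>2) at_top"
    unfolding eq by (intro tendsto_intros lim2 lims)
  then have sum0: "((\<lambda>t. (\<integral>\<omega>. (average ?c t \<omega> - C)\<^sup>2 \<partial>M) + (\<integral>\<omega>. (average ?s t \<omega> - S)\<^sup>2 \<partial>M)) \<longlongrightarrow> 0) at_top"
    by (simp add: power2_eq_square)
  have "((\<lambda>t. \<integral>\<omega>. (average ?c t \<omega> - C)\<^sup>2 \<partial>M) \<longlongrightarrow> 0) at_top" "((\<lambda>t. \<integral>\<omega>. (average ?s t \<omega> - S)\<^sup>2 \<partial>M) \<longlongrightarrow> 0) at_top"
    by (rule tendsto_sandwich[OF _ _ tendsto_const sum0]; auto intro!: always_eventually)+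
  then show "converging ?c" "converging ?s"
    unfolding converging_def C_def S_def using b by (auto intro!: exI[of _ 1])
qed

lemma converging_add:
  assumes f: "converging f" and g: "converging g"
  shows "converging (\<lambda>z. f z + g z)"
proof -
  obtain K L where K: "\<And>z. \<bar>f z\<bar> \<le> K" and L: "\<And>z. \<bar>g z\<bar> \<le> L" using convergingD(1,2)[OF f] convergingD(1,2)[OF g] by blast+
  have [measurable]: "f \<in> borel_measurable borel" "g \<in> borel_measurable borel" using convergingD(1,2)[OF f] convergingD(1,2)[OF g] by blast+
  let ?F = "\<integral>z. f z \<partial>\<gamma>" and ?G = "\<integral>z. g z \<partial>\<gamma>"
  have KL: "\<bar>f z + g z\<bar> \<le> K + L" for z using K[of z] L[of z] by linarith
  have int: "(\<integral>z. f z + g z \<partial>\<gamma>) = ?F + ?G"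
    using integrable_bounded_\<gamma>[of f K, OF _ K] integrable_bounded_\<gamma>[of g L, OF _ L] by simp
  have avg: "average (\<lambda>z. f z + g z) t \<omega> = average f t \<omega> + average g t \<omega>" if "\<omega> \<in> space M" for t \<omega>
    unfolding average_def using integrable_bounded_\<mu>[of f K, OF _ K that] integrable_bounded_\<mu>[of g L, OF _ L that] by simp
  have le: "(\<integral>\<omega>. (average (\<lambda>z. f z + g z) t \<omega> - (\<integral>z. f z + g z \<partial>\<gamma>))\<^sup>2 \<partial>M)
    \<le> 2 * (\<integral>\<omega>. (average f t \<omega> - ?F)\<^sup>2 \<partial>M) + 2 * (\<integral>\<omega>. (average g t \<omega> - ?G)\<^sup>2 \<partial>M)" for t
  proof -
    have "(\<integral>\<omega>. (average (\<lambda>z. f z + g z) t \<omega> - (\<integral>z. f z + g z \<partial>\<gamma>))\<^sup>2 \<partial>M)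
      \<le> (\<integral>\<omega>. 2 * (average f t \<omega> - ?F)\<^sup>2 + 2 * (average g t \<omega> - ?G)\<^sup>2 \<partial>M)"
    proof (rule integral_mono)
      show "integrable M (\<lambda>\<omega>. 2 * (average f t \<omega> - ?F)\<^sup>2 + 2 * (average g t \<omega> - ?G)\<^sup>2)"
        using integrable_average(3)[of f K, OF _ K] integrable_average(3)[of g L, OF _ L] by auto
      show "integrable M (\<lambda>\<omega>. (average (\<lambda>z. f z + g z) t \<omega> - (\<integral>z. f z + g z \<partial>\<gamma>))\<^sup>2)"
        by (rule integrable_average(3)[of "\<lambda>z. f z + g z" "K + L", OF _ KL]) auto
      fix \<omega> assume w: "\<omega> \<in> space M"
      have "((average f t \<omega> - ?F) + (average g t \<omega> - ?G))\<^sup>2 \<le> 2 * (average f t \<omega> - ?F)\<^sup>2 + 2 * (average g t \<omega> - ?G)\<^sup>2"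
        by (rule square_sum_le)
      then show "(average (\<lambda>z. f z + g z) t \<omega> - (\<integral>z. f z + g z \<partial>\<gamma>))\<^sup>2
          \<le> 2 * (average f t \<omega> - ?F)\<^sup>2 + 2 * (average g t \<omega> - ?G)\<^sup>2"
        unfolding int avg[OF w] by (simp add: algebra_simps)
    qed
    then show ?thesis using integrable_average(3)[of f K, OF _ K] integrable_average(3)[of g L, OF _ L] by simp
  qed
  have "((\<lambda>t. 2 * (\<integral>\<omega>. (average f t \<omega> - ?F)\<^sup>2 \<partial>M) + 2 * (\<integral>\<omega>. (average g t \<omega> - ?G)\<^sup>2 \<partial>M)) \<longlongrightarrow> 2 * 0 + 2 * 0) at_top"
    by (intro tendsto_intros convergingD(3) f g)
  then have "((\<lambda>t. 2 * (\<integral>\<omega>. (average f t \<omega> - ?F)\<^sup>2 \<partial>M) + 2 * (\<integral>\<omega>. (average g t \<omega> - ?G)\<^sup>2 \<partial>M)) \<longlongrightarrow> 0) at_top"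
    by simp
  then have "((\<lambda>t. \<integral>\<omega>. (average (\<lambda>z. f z + g z) t \<omega> - (\<integral>z. f z + g z \<partial>\<gamma>))\<^sup>2 \<partial>M) \<longlongrightarrow> 0) at_top"
    by (rule tendsto_zero_le[OF _ _ le]) simp
  then show ?thesis by (intro convergingI[OF _ KL]) simp
qed

lemma converging_scale:
  assumes f: "converging f"
  shows "converging (\<lambda>z. c * f z)"
proof -
  obtain K where K: "\<And>z. \<bar>f z\<bar> \<le> K" using convergingD(1,2)[OF f] by blast
  have [measurable]: "f \<in> borel_measurable borel" using convergingD(1,2)[OF f] by blast
  have "\<bar>c * f z\<bar> \<le> \<bar>c\<bar> * K" for z using K[of z] by (simp add: abs_mult mult_left_mono)
  moreover have "(\<lambda>\<omega>. (average (\<lambda>z. c * f z) t \<omega> - (\<integral>z. c * f z \<partial>\<gamma>))\<^sup>2)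
      = (\<lambda>\<omega>. c\<^sup>2 * (average f t \<omega> - (\<integral>z. f z \<partial>\<gamma>))\<^sup>2)" for t
    by (simp add: average_def right_diff_distrib[symmetric] power_mult_distrib)
  moreover have "((\<lambda>t. c\<^sup>2 * (\<integral>\<omega>. (average f t \<omega> - (\<integral>z. f z \<partial>\<gamma>))\<^sup>2 \<partial>M)) \<longlongrightarrow> c\<^sup>2 * 0) at_top"
    by (intro tendsto_intros convergingD(3) f)
  ultimately show ?thesis by (intro convergingI[of _ "\<bar>c\<bar> * K"]) simp_all
qed

lemma converging_trig_poly: "trig_poly f \<Longrightarrow> converging f"
proof (induction rule: trig_poly.induct)
  case (trig_wave r u c)
  have "(\<lambda>x. r * cos (u \<bullet> x + c)) = (\<lambda>x. (r * cos c) * cos (u \<bullet> x) + (- r * sin c) * sin (u \<bullet> x))"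
    by (auto simp: cos_add algebra_simps)
  then show ?case by (simp only:) (intro converging_add converging_scale converging_wave)
qed (rule converging_add)

text \<open>Replacing \<open>f\<close> by \<open>P n\<close> costs at most the average of \<open>(f - P n)\<^sup>2\<close>, by Jensen's inequality.  The
  expectation of this average tends to \<open>\<integral> (f - P n)\<^sup>2 d\<gamma>\<close> as \<open>t \<longlongrightarrow> \<infinity>\<close>, since \<open>one_point\<close> holds for bounded
  Borel functions, and the latter integral is small for large \<open>n\<close>.\<close>

lemma converging_limit:
  assumes P: "\<And>n::nat. converging (P n)" and B: "\<And>n z. \<bar>P n z\<bar> \<le> B"
    and lim: "\<And>z. (\<lambda>n. P n z) \<longlonglongrightarrow> f z"
  shows "converging f"
proof -
  have [measurable]: "P n \<in> borel_measurable borel" for n by (rule convergingD(1)[OF P])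
  have f_meas [measurable]: "f \<in> borel_measurable borel"
    by (rule borel_measurable_LIMSEQ_real[OF lim]) auto
  have fB: "\<bar>f z\<bar> \<le> B" for z
    by (rule LIMSEQ_le_const2[OF tendsto_rabs[OF lim]]) (use B in auto)
  define d where "d n z = (f z - P n z)\<^sup>2" for n z
  have [measurable]: "d n \<in> borel_measurable borel" for n unfolding d_def by measurable
  have diffB: "\<bar>f z - P n z\<bar> \<le> 2 * B" for n z using B[of n z] fB[of z] by linarith
  have dB: "\<bar>d n z\<bar> \<le> (2 * B)\<^sup>2" for n z
    using power_mono[OF diffB, of z n 2] by (simp add: d_def)
  define q where "q n = (\<integral>z. d n z \<partial>\<gamma>)" for n
  have "q \<longlonglongrightarrow> (\<integral>z. 0 \<partial>\<gamma>)"
    unfolding q_def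
  proof (rule integral_dominated_convergence[where w="\<lambda>_. (2 * B)\<^sup>2"])
    have "(\<lambda>n. d n z) \<longlonglongrightarrow> (f z - f z)\<^sup>2" for z unfolding d_def by (intro tendsto_intros lim)
    then show "AE z in \<gamma>. (\<lambda>n. d n z) \<longlonglongrightarrow> 0" by simp
  qed (use dB in auto)
  then have q0: "q \<longlonglongrightarrow> 0" by simp
  let ?E = "\<lambda>f t. \<integral>\<omega>. (average f t \<omega> - (\<integral>z. f z \<partial>\<gamma>))\<^sup>2 \<partial>M"
  \<comment> \<open>The error splits into three parts: approximation under \<open>X\<close>, error for \<open>P n\<close>, approximation under \<open>\<gamma>\<close>.\<close>
  have le: "?E f t \<le> 3 * (\<integral>\<omega>. average (d n) t \<omega> \<partial>M) + 3 * ?E (P n) t + 3 * q n" for n t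
  proof -
    have "?E f t \<le> (\<integral>\<omega>. 3 * average (d n) t \<omega> + 3 * (average (P n) t \<omega> - (\<integral>z. P n z \<partial>\<gamma>))\<^sup>2 + 3 * q n \<partial>M)"
    proof (rule integral_mono)
      show "integrable M (\<lambda>\<omega>. (average f t \<omega> - (\<integral>z. f z \<partial>\<gamma>))\<^sup>2)"
        by (rule integrable_average(3)[of f B, OF _ fB]) auto
      show "integrable M (\<lambda>\<omega>. 3 * average (d n) t \<omega> + 3 * (average (P n) t \<omega> - (\<integral>z. P n z \<partial>\<gamma>))\<^sup>2 + 3 * q n)"
        using integrable_average(3)[of "P n" B, OF _ B] integrable_average(1)[of "d n" "(2 * B)\<^sup>2", OF _ dB] by auto
      fix \<omega> assume w: "\<omega> \<in> space M"
      define a1 where "a1 = average f t \<omega> - average (P n) t \<omega>"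
      define a2 where "a2 = average (P n) t \<omega> - (\<integral>z. P n z \<partial>\<gamma>)"
      define a3 where "a3 = (\<integral>z. P n z \<partial>\<gamma>) - (\<integral>z. f z \<partial>\<gamma>)"
      have "a1 = (\<integral>x. f (X t \<omega> x) - P n (X t \<omega> x) \<partial>\<mu>)"
        unfolding a1_def average_def
        using integrable_bounded_\<mu>[of f B, OF _ fB w] integrable_bounded_\<mu>[of "P n" B, OF _ B w] by simp
      then have 1: "a1\<^sup>2 \<le> average (d n) t \<omega>"
        unfolding average_def d_def using \<mu>.square_expectation_le[of "\<lambda>x. f (X t \<omega> x) - P n (X t \<omega> x)" "2*B"] w diffB
        by simp
      have "- a3 = (\<integral>z. f z - P n z \<partial>\<gamma>)"
        unfolding a3_def using integrable_bounded_\<gamma>[of f B, OF _ fB] integrable_bounded_\<gamma>[of "P n" B, OF _ B] by simp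
      then have "(- a3)\<^sup>2 \<le> q n"
        unfolding q_def d_def using \<gamma>.square_expectation_le[of "\<lambda>z. f z - P n z" "2*B"] diffB
        by simp
      then have 3: "a3\<^sup>2 \<le> q n" by simp
      have "(a1 + a2 + a3)\<^sup>2 \<le> 3 * a1\<^sup>2 + 3 * a2\<^sup>2 + 3 * a3\<^sup>2"
        by (rule square_sum3_le)
      also have "\<dots> \<le> 3 * average (d n) t \<omega> + 3 * a2\<^sup>2 + 3 * q n" using 1 3 by linarith
      finally show "(average f t \<omega> - (\<integral>z. f z \<partial>\<gamma>))\<^sup>2
          \<le> 3 * average (d n) t \<omega> + 3 * (average (P n) t \<omega> - (\<integral>z. P n z \<partial>\<gamma>))\<^sup>2 + 3 * q n"
        by (simp add: a1_def a2_def a3_def)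
    qed
    then show ?thesis
      using integrable_average(3)[of "P n" B t, OF _ B] integrable_average(1)[of "d n" "(2 * B)\<^sup>2" t, OF _ dB] by (simp add: prob_space)
  qed
  have "(?E f \<longlongrightarrow> 0) at_top"
  proof (rule order_tendstoI)
    show "\<forall>\<^sub>F t in at_top. a < ?E f t" if "a < 0" for a
      using that by (intro always_eventually allI) (auto intro: order.strict_trans2 integral_nonneg)
    fix e :: real assume "0 < e"
    then have "eventually (\<lambda>n. q n < e / 6) sequentially"
      by (intro order_tendstoD(2)[OF q0]) auto
    then obtain n where n: "q n < e / 6" by (auto dest: eventually_happens)
    have "((\<lambda>t. 3 * (\<integral>\<omega>. average (d n) t \<omega> \<partial>M) + 3 * ?E (P n) t + 3 * q n) \<longlongrightarrow> 3 * q n + 3 * 0 + 3 * q n) at_top"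
      unfolding q_def using P[of n] by (intro tendsto_intros mean_average[of "d n" "(2 * B)\<^sup>2", OF _ dB]) (auto simp: converging_def)
    then have "eventually (\<lambda>t. 3 * (\<integral>\<omega>. average (d n) t \<omega> \<partial>M) + 3 * ?E (P n) t + 3 * q n < e) at_top"
      by (rule order_tendstoD(2)) (use n in simp)
    then show "\<forall>\<^sub>F t in at_top. ?E f t < e"
      by eventually_elim (use le[of _ n] in \<open>auto intro: order.strict_trans1\<close>)
  qed
  then show ?thesis by (rule convergingI[OF f_meas fB])
qed

lemma converging_const: "converging (\<lambda>_. c)"
  by (rule converging_trig_poly[OF trig_poly_const])

text \<open>Dynkin's argument, starting from the orthants.\<close>

lemma converging_indicator:
  assumes "A \<in> sets borel"
  shows "converging (indicator A)"
proof -
  have "range (\<lambda>a::real^'n. {..a}) \<subseteq> Pow UNIV" by simp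
  moreover have "A \<in> sigma_sets UNIV (range (\<lambda>a::real^'n. {..a}))"
    using assms by (simp add: borel_eq_atMost)
  ultimately show ?thesis
  proof (induction rule: sigma_sets_induct_disjoint[OF Int_stable_orthants, consumes 2, case_names basic empty compl union])
    case (basic A)
    then obtain a where a: "A = {..a}" by auto
    obtain P B where P: "\<And>n. trig_poly (P n)" "\<And>n x. \<bar>P n x\<bar> \<le> B" "\<And>x. (\<lambda>n. P n x) \<longlonglongrightarrow> indicator {..a} x"
      using trig_poly_approx_orthant[of a] by blast
    show ?case unfolding a by (rule converging_limit[OF converging_trig_poly[OF P(1)] P(2,3)])
  next
    case empty show ?case using converging_const[of 0] by (simp add: indicator_def)
  next
    case (compl A)
    have "(indicator (UNIV - A) :: real^'n \<Rightarrow> real) = (\<lambda>z. 1 + (-1) * indicator A z)"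
      by (auto simp: indicator_def)
    then show ?case by (simp only:) (intro converging_add converging_const converging_scale compl.IH)
  next
    case (union A)
    have fin: "converging (\<lambda>z. \<Sum>i<n. indicator (A i) z)" for n
    proof (induction n)
      case 0 then show ?case by (simp add: converging_const)
    next
      case (Suc n) then show ?case using converging_add[OF Suc union.IH[of n]] by simp
    qed
    have eq: "(\<lambda>z. \<Sum>i<n. indicator (A i) z) = (indicator (\<Union>i<n. A i) :: real^'n \<Rightarrow> real)" for n
      using union.hyps(1) by (intro ext, subst indicator_UN_disjoint) (auto simp: disjoint_family_on_def)
    have bound: "\<bar>indicator (\<Union>i<n. A i) z :: real\<bar> \<le> 1" for n z by (simp add: indicator_def)
    show ?case
      by (rule converging_limit[OF fin[unfolded eq] bound LIMSEQ_indicator_UN])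
  qed
qed

theorem converging_bounded_borel:
  assumes "f \<in> borel_measurable borel" "\<And>z. \<bar>f z\<bar> \<le> K"
  shows "converging f"
proof -
  have nonneg: "(\<forall>z. g z \<le> L) \<longrightarrow> converging g" if "g \<in> borel_measurable borel" "\<And>z. 0 \<le> g z" for g :: "real^'n \<Rightarrow> real" and L
    using that
  proof (induction g arbitrary: L rule: borel_measurable_induct_real)
    case (set A) then show ?case by (simp add: converging_indicator)
  next
    case (mult g c)
    show ?case
    proof (cases "c = 0")
      case True then show ?thesis by (simp add: converging_const)
    next
      case False
      show ?thesis
      proof
        assume "\<forall>z. c * g z \<le> L"
        then have "\<forall>z. g z \<le> L / c" using False mult.hyps by (simp add: field_simps)
        then show "converging (\<lambda>z. c * g z)" using mult.IH converging_scale by blast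
      qed
    qed
  next
    case (add g h)
    show ?case
    proof
      assume L: "\<forall>z. h z + g z \<le> L"
      then have "g z \<le> L" "h z \<le> L" for z
        using add.hyps(2)[of z] add.hyps(4)[of z] L[rule_format, of z] by linarith+
      then show "converging (\<lambda>z. h z + g z)" using add.IH converging_add by blast
    qed
  next
    case (seq U)
    show ?case
    proof
      assume L: "\<forall>z. g z \<le> L"
      have "U i z \<le> g z" for i z
        using seq.hyps(3,4) by (intro incseq_le[of "\<lambda>i. U i z"]) (simp_all add: incseq_def le_fun_def)
      then have le: "U i z \<le> L" for i z
        using L order_trans by blast
      have bound: "\<bar>U i z\<bar> \<le> L" for i z using le[of i z] seq.hyps(2)[of i z] by simp
      have conv: "converging (U i)" for i using seq.IH le by blast
      have lim: "(\<lambda>n. U n z) \<longlonglongrightarrow> g z" for z using seq.hyps(4)[of z] by simp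
      show "converging g"
        by (rule converging_limit[OF conv bound lim])
    qed
  qed
  have "0 \<le> f z + K" "f z + K \<le> 2 * K" for z using assms(2)[of z] by linarith+
  then have "converging (\<lambda>z. f z + K)"
    using nonneg[of "\<lambda>z. f z + K" "2 * K"] assms(1) by simp
  from converging_add[OF this converging_const[of "-K"]] show ?thesis by simp
qed

end

section \<open>Elementary analysis\<close>

text \<open>A mean value inequality for functions with right derivatives only.  If it failed, then
  \<open>f s - f a - (K + e) (s - a)\<close> would be positive at \<open>b\<close> for some \<open>e > 0\<close>.  At the infimum \<open>c\<close> of the set
  where it is positive it is at most \<open>0\<close> and has a negative right derivative, so it stays negative
  directly after \<open>c\<close>, which contradicts the choice of \<open>c\<close>.\<close>

lemma right_derivative_le:
  fixes f :: "real \<Rightarrow> real"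
  assumes ab: "a \<le> b" and cont: "continuous_on {a..b} f"
    and deriv: "\<And>s. a \<le> s \<Longrightarrow> s < b \<Longrightarrow> (f has_real_derivative f' s) (at_right s)"
    and K: "\<And>s. a \<le> s \<Longrightarrow> s < b \<Longrightarrow> f' s \<le> K"
  shows "f b - f a \<le> K * (b - a)"
proof (rule ccontr)
  assume "\<not> ?thesis"
  then have gt: "K * (b - a) < f b - f a" by simp
  then have "a < b" using ab by (cases "a = b") auto
  define w where "w = b - a"
  define D where "D = f b - f a - K * w"
  define e where "e = D / (2 * w)"
  have wD: "0 < w" "0 < D" using gt \<open>a < b\<close> by (simp_all add: w_def D_def)
  then have "0 < e" "e * w < D" by (simp_all add: e_def)
  then have e: "0 < e" "e * (b - a) < f b - f a - K * (b - a)"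
    by (simp_all add: w_def D_def)
  define g where "g s = f s - f a - (K + e) * (s - a)" for s
  have gcont: "continuous_on {a..b} g" unfolding g_def by (intro continuous_intros cont)
  define T where "T = {s \<in> {a..b}. 0 < g s}"
  have "b \<in> T" using e ab by (simp add: T_def g_def algebra_simps)
  define c where "c = Inf T"
  have bdd: "bdd_below T" by (rule bdd_belowI[of _ a]) (simp add: T_def)
  have cb: "c \<le> b" unfolding c_def by (rule cInf_lower[OF \<open>b \<in> T\<close> bdd])
  have ac: "a \<le> c" unfolding c_def by (rule cInf_greatest) (use \<open>b \<in> T\<close> in \<open>auto simp: T_def\<close>)
  have before: "g s \<le> 0" if "a \<le> s" "s < c" for s
  proof (rule ccontr)
    assume "\<not> g s \<le> 0"
    then have "s \<in> T" using that cb by (simp add: T_def)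
    then have "c \<le> s" unfolding c_def by (rule cInf_lower[OF _ bdd])
    then show False using that by simp
  qed
  have gc: "g c \<le> 0"
  proof (cases "c = a")
    case True then show ?thesis by (simp add: g_def)
  next
    case False
    then have "a < c" using ac by simp
    have "(g \<longlongrightarrow> g c) (at_left c)"
      using \<open>a < c\<close> cb by (intro continuous_on_Icc_at_leftD[where a=a] continuous_on_subset[OF gcont]) auto
    moreover have "eventually (\<lambda>s. g s \<le> 0) (at_left c)"
      using \<open>a < c\<close> before by (auto simp: eventually_at_left intro!: exI[of _ a])
    ultimately show ?thesis by (intro tendsto_upperbound) auto
  qed
  then have "c \<noteq> b" using \<open>b \<in> T\<close> by (auto simp: T_def)
  then have "c < b" using cb by simp
  have "(g has_real_derivative (f' c - (K + e))) (at_right c)"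
    unfolding g_def using deriv[OF ac \<open>c < b\<close>] by (auto intro!: derivative_eq_intros)
  moreover have "f' c - (K + e) < 0" using K[OF ac \<open>c < b\<close>] e by simp
  ultimately obtain d where d: "0 < d" "\<And>h. 0 < h \<Longrightarrow> c + h \<in> {c<..} \<Longrightarrow> h < d \<Longrightarrow> g (c + h) < g c"
    using has_real_derivative_neg_dec_right by blast
  have "c + d \<le> Inf T"
  proof (rule cInf_greatest)
    show "T \<noteq> {}" using \<open>b \<in> T\<close> by auto
    fix s assume s: "s \<in> T"
    then have "c \<le> s" unfolding c_def by (rule cInf_lower[OF _ bdd])
    show "c + d \<le> s"
    proof (rule ccontr)
      assume "\<not> c + d \<le> s"
      then have "s < c + d" by simp
      moreover have "s \<noteq> c" using s gc by (auto simp: T_def)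
      ultimately have "g s < g c" using d(2)[of "s - c"] \<open>c \<le> s\<close> by simp
      then show False using s gc by (simp add: T_def)
    qed
  qed
  then have "c + d \<le> c" by (simp only: c_def)
  then show False using d by simp
qed

lemma right_derivative_abs_le:
  fixes f :: "real \<Rightarrow> real"
  assumes ab: "a \<le> b" and cont: "continuous_on {a..b} f"
    and deriv: "\<And>s. a \<le> s \<Longrightarrow> s < b \<Longrightarrow> (f has_real_derivative f' s) (at_right s)"
    and K: "\<And>s. a \<le> s \<Longrightarrow> s < b \<Longrightarrow> \<bar>f' s\<bar> \<le> K"
  shows "\<bar>f b - f a\<bar> \<le> K * (b - a)"
proof -
  have "f b - f a \<le> K * (b - a)"
    using K by (intro right_derivative_le[OF ab cont deriv]) (auto simp: abs_le_iff)
  moreover have "- f b - - f a \<le> K * (b - a)"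
    by (rule right_derivative_le[OF ab, where f'="\<lambda>s. - f' s"])
      (use K in \<open>auto simp: abs_le_iff intro!: continuous_intros cont DERIV_minus deriv\<close>)
  ultimately show ?thesis by (simp add: abs_le_iff)
qed

text \<open>Nonnegativity makes \<open>l\<close> monotone, so its values are squeezed between those at multiples of \<open>1 / n\<close>.\<close>

lemma nonneg_additive_linear:
  fixes l :: "real \<Rightarrow> real"
  assumes add: "\<And>s t. 0 \<le> s \<Longrightarrow> 0 \<le> t \<Longrightarrow> l (s + t) = l s + l t"
    and nonneg: "\<And>t. 0 \<le> t \<Longrightarrow> 0 \<le> l t" and t: "0 \<le> t"
  shows "l t = t * l 1"
proof -
  have l0: "l 0 = 0" using add[of 0 0] by simp
  have mult: "l (real k * s) = real k * l s" if "0 \<le> s" for k s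
    using that by (induction k) (simp_all add: l0 distrib_right add)
  have mono: "l s \<le> l t" if "0 \<le> s" "s \<le> t" for s t
    using add[of s "t - s"] nonneg[of "t - s"] that by simp
  have bound: "\<bar>l t - t * l 1\<bar> \<le> l 1 / real (Suc n)" for n
  proof -
    define N where "N = real (Suc n)"
    have N: "0 < N" by (simp add: N_def)
    have lN: "l (1 / N) = l 1 / N"
      using mult[of "1 / N" "Suc n"] N by (simp add: N_def field_simps del: of_nat_Suc)
    define k where "k = nat \<lfloor>N * t\<rfloor>"
    have "0 \<le> N * t" using N t by simp
    then have k: "real k \<le> N * t" "N * t \<le> real (Suc k)" by (simp_all add: k_def) linarith+
    have t': "real k * (1 / N) \<le> t" "t \<le> real (Suc k) * (1 / N)"
      using k N by (simp_all add: field_simps)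
    have "real k * (l 1 / N) \<le> l t" "l t \<le> real (Suc k) * (l 1 / N)"
      using mono[OF _ t'(1)] mono[OF t t'(2)] mult[of "1 / N" k] mult[of "1 / N" "Suc k"] lN N by simp_all
    moreover have "real k * (1 / N) * l 1 \<le> t * l 1" "t * l 1 \<le> real (Suc k) * (1 / N) * l 1"
      using t' nonneg[of 1] by (intro mult_right_mono; simp)+
    ultimately show ?thesis unfolding N_def[symmetric]
      by (simp add: abs_le_iff distrib_right add_divide_distrib)
  qed
  have "(\<lambda>n. l 1 / real (Suc n)) \<longlonglongrightarrow> 0" by real_asymp
  then have "\<bar>l t - t * l 1\<bar> \<le> 0"
    by (rule LIMSEQ_le_const) (use bound in blast)
  then show ?thesis by simp
qed

text \<open>For small arguments \<open>1 - cos(r y)\<close> is \<open>r\<^sup>2 (1 - cos y)\<close> up to a relative error \<open>\<delta>\<close>.  Comparing with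
  \<open>1 - cos y\<close> instead of \<open>y\<^sup>2 / 2\<close> lets the estimate be integrated in terms of characteristic
  functions alone.\<close>

lemma one_minus_cos_scale:
  fixes r \<delta> :: real
  assumes "0 < \<delta>"
  obtains \<epsilon> where "0 < \<epsilon>"
    "\<And>y. \<bar>y\<bar> \<le> \<epsilon> \<Longrightarrow> \<bar>(1 - cos (r * y)) - r\<^sup>2 * (1 - cos y)\<bar> \<le> \<delta> * (1 - cos y)"
proof -
  have "((\<lambda>y. (1 - cos (r * y)) / (1 - cos y)) \<longlongrightarrow> r\<^sup>2) (at 0)"
  proof (cases "r = 0")
    case True then show ?thesis by simp
  next
    case False
    then consider "r < 0" | "0 < r" by linarith
    then show ?thesis
    proof cases
      case 1 then show ?thesis unfolding power2_eq_square by real_asymp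
    next
      case 2 then show ?thesis unfolding power2_eq_square by real_asymp
    qed
  qed
  then have "eventually (\<lambda>y. \<bar>(1 - cos (r * y)) / (1 - cos y) - r\<^sup>2\<bar> < \<delta>) (at 0)"
    using assms by (auto simp: tendsto_iff dist_real_def)
  moreover have "eventually (\<lambda>y::real. 0 < 1 - cos y) (at 0)" by real_asymp
  ultimately have "eventually (\<lambda>y. \<bar>(1 - cos (r * y)) - r\<^sup>2 * (1 - cos y)\<bar> \<le> \<delta> * (1 - cos y)) (at 0)"
  proof eventually_elim
    case (elim y)
    have "(1 - cos (r * y)) - r\<^sup>2 * (1 - cos y) = ((1 - cos (r * y)) / (1 - cos y) - r\<^sup>2) * (1 - cos y)"
      using elim by (simp add: field_simps)
    then show ?case using elim by (simp add: abs_mult)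
  qed
  then obtain d where d: "0 < d"
    "\<And>y. y \<noteq> 0 \<Longrightarrow> dist y 0 < d \<Longrightarrow> \<bar>(1 - cos (r * y)) - r\<^sup>2 * (1 - cos y)\<bar> \<le> \<delta> * (1 - cos y)"
    unfolding eventually_at by blast
  show ?thesis
  proof (rule that[of "d / 2"])
    show "0 < d / 2" using d by simp
    fix y assume "\<bar>y\<bar> \<le> d / 2"
    then show "\<bar>(1 - cos (r * y)) - r\<^sup>2 * (1 - cos y)\<bar> \<le> \<delta> * (1 - cos y)"
      using d(1) d(2)[of y] by (cases "y = 0") auto
  qed
qed

lemma cos_taylor2:
  fixes w z :: real
  shows "\<bar>cos (w + z) - cos w + z * sin w + z\<^sup>2 / 2 * cos w\<bar> \<le> \<bar>z\<bar> ^ 3"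
proof -
  obtain t where t: "cos z = (\<Sum>m<3. cos_coeff m * z ^ m) + (cos (t + 1/2 * real 3 * pi) / fact 3) * z ^ 3"
    using Maclaurin_cos_expansion[of z 3] by blast
  obtain t' where t': "sin z = (\<Sum>m<3. sin_coeff m * z ^ m) + (sin (t' + 1/2 * real 3 * pi) / fact 3) * z ^ 3"
    using Maclaurin_sin_expansion[of z 3] by blast
  define p where "p = cos (t + 1/2 * real 3 * pi)"
  define q where "q = sin (t' + 1/2 * real 3 * pi)"
  have pq: "\<bar>p\<bar> \<le> 1" "\<bar>q\<bar> \<le> 1" by (simp_all add: p_def q_def)
  have c: "cos z = 1 - z\<^sup>2 / 2 + p / 6 * z ^ 3"
    using t by (simp add: p_def cos_coeff_def eval_nat_numeral fact_numeral)
  have s: "sin z = z + q / 6 * z ^ 3"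
    using t' by (simp add: q_def sin_coeff_def eval_nat_numeral fact_numeral)
  have "cos (w + z) - cos w + z * sin w + z\<^sup>2 / 2 * cos w = (cos w * p - sin w * q) / 6 * z ^ 3"
    unfolding cos_add c s by (simp add: algebra_simps)
  then have "\<bar>cos (w + z) - cos w + z * sin w + z\<^sup>2 / 2 * cos w\<bar> = \<bar>cos w * p - sin w * q\<bar> / 6 * \<bar>z\<bar> ^ 3"
    by (simp only:) (simp add: abs_mult power_abs)
  moreover have "\<bar>cos w * p - sin w * q\<bar> \<le> 6"
  proof -
    have "\<bar>cos w * p\<bar> \<le> 1 * 1" "\<bar>sin w * q\<bar> \<le> 1 * 1"
      unfolding abs_mult using pq by (intro mult_mono; simp)+
    then show ?thesis by linarith
  qed
  ultimately show ?thesis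
    using mult_right_mono[of "\<bar>cos w * p - sin w * q\<bar> / 6" 1 "\<bar>z\<bar> ^ 3"] by simp
qed

text \<open>A function that is measurable in one variable and continuous in the other can be evaluated at a
  random point: approximate this point by simple functions.\<close>

lemma caratheodory_measurable:
  fixes F :: "'w \<Rightarrow> 'a::{metric_space, second_countable_topology} \<Rightarrow> 'b::{metric_space, second_countable_topology, banach}"
  assumes F: "\<And>z. (\<lambda>\<omega>. F \<omega> z) \<in> borel_measurable N"
    and cont: "\<And>\<omega>. \<omega> \<in> space N \<Longrightarrow> continuous_on UNIV (F \<omega>)"
    and W: "W \<in> measurable K N" and Z: "Z \<in> borel_measurable K"
  shows "(\<lambda>k. F (W k) (Z k)) \<in> borel_measurable K"
proof -
  obtain S where S: "\<And>i. simple_function K (S i)" "\<And>k. k \<in> space K \<Longrightarrow> (\<lambda>i. S i k) \<longlonglongrightarrow> Z k"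
    using borel_measurable_implies_sequence_metric[OF Z] by metis
  show ?thesis
  proof (rule borel_measurable_LIMSEQ_metric)
    show "(\<lambda>k. F (W k) (S i k)) \<in> borel_measurable K" for i
    proof (rule measurable_compose_countable'[where I="S i ` space K"])
      show "(\<lambda>k. F (W k) z) \<in> borel_measurable K" for z
        by (rule measurable_compose[OF W F])
      show "S i \<in> measurable K (count_space (S i ` space K))"
        using S(1)[of i] unfolding simple_function_def by (subst measurable_count_space_eq2) auto
      show "countable (S i ` space K)"
        using simple_functionD(1)[OF S(1)] by (rule countable_finite)
    qed
    fix k assume k: "k \<in> space K"
    then have "continuous_on UNIV (F (W k))" by (intro cont measurable_space[OF W])
    then show "(\<lambda>i. F (W k) (S i k)) \<longlonglongrightarrow> F (W k) (Z k)"
      by (rule continuous_on_tendsto_compose[OF _ S(2)[OF k]]) auto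
  qed
qed

section \<open>Independence and homogeneity of the increments of a flow\<close>

text \<open>When \<open>G\<close> and \<open>F\<close> are independent, the diagonal map \<open>\<omega> \<mapsto> (\<omega>, \<omega>)\<close> into \<open>G \<Otimes> F\<close> has the
  product of the two marginals as its law.  So, in the expectation, an \<open>F\<close>-measurable randomness can be averaged
  while the \<open>G\<close>-measurable one is kept fixed.\<close>

lemma (in prob_space) freezing:
  fixes H :: "'a \<Rightarrow> 'a \<Rightarrow> real"
  assumes G: "subalgebra M G" and F: "subalgebra M F" and indep: "indep_set (sets G) (sets F)"
    and H: "(\<lambda>(a, b). H a b) \<in> borel_measurable (G \<Otimes>\<^sub>M F)"
    and int: "integrable M (\<lambda>\<omega>. H \<omega> \<omega>)"
  shows "expectation (\<lambda>\<omega>. H \<omega> \<omega>) = expectation (\<lambda>\<omega>. expectation (\<lambda>\<omega>'. H \<omega> \<omega>'))"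
proof -
  have id: "(\<lambda>\<omega>. \<omega>) \<in> measurable M Q" if "subalgebra M Q" for Q
    by (rule measurable_from_subalg[OF that measurable_ident_sets[OF refl]])
  have sig: "sigma_sets (space M) {(\<lambda>\<omega>. \<omega>) -` A \<inter> space M |A. A \<in> sets Q} = sets Q" if "subalgebra M Q" for Q
  proof -
    have sp: "space Q = space M" using that by (simp add: subalgebra_def)
    have "(\<lambda>\<omega>. \<omega>) -` A \<inter> space M = A" if "A \<in> sets Q" for A
      using sets.sets_into_space[OF that] by (auto simp: sp)
    then have "{(\<lambda>\<omega>. \<omega>) -` A \<inter> space M |A. A \<in> sets Q} = sets Q"
      unfolding Setcompr_eq_image by (simp cong: image_cong)
    then show ?thesis using sets.sigma_sets_eq[of Q] by (simp add: sp)
  qed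
  define G' where "G' = distr M G (\<lambda>\<omega>. \<omega>)"
  define F' where "F' = distr M F (\<lambda>\<omega>. \<omega>)"
  have "indep_var G (\<lambda>\<omega>. \<omega>) F (\<lambda>\<omega>. \<omega>)"
    unfolding indep_var_eq sig[OF G] sig[OF F] using indep id[OF G] id[OF F] by simp
  then have prod: "G' \<Otimes>\<^sub>M F' = distr M (G \<Otimes>\<^sub>M F) (\<lambda>\<omega>. (\<omega>, \<omega>))"
    by (simp add: indep_var_distribution_eq G'_def F'_def)
  interpret G': prob_space G' unfolding G'_def by (rule prob_space_distr[OF id[OF G]])
  interpret F': prob_space F' unfolding F'_def by (rule prob_space_distr[OF id[OF F]])
  interpret pair_sigma_finite G' F' ..
  have diag: "(\<lambda>\<omega>. (\<omega>, \<omega>)) \<in> measurable M (G \<Otimes>\<^sub>M F)"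
    by (intro measurable_Pair id G F)
  have sets': "sets (G' \<Otimes>\<^sub>M F') = sets (G \<Otimes>\<^sub>M F)"
    by (simp add: G'_def F'_def cong: sets_pair_measure_cong)
  have spG: "space G' = space M" "space G = space M" using G by (simp_all add: G'_def subalgebra_def)
  have int': "integrable (G' \<Otimes>\<^sub>M F') (\<lambda>(a, b). H a b)"
    unfolding prod using int by (subst integrable_distr_eq[OF diag H]) simp
  have inner: "(\<integral>b. H a b \<partial>F') = expectation (\<lambda>\<omega>'. H a \<omega>')" if "a \<in> space M" for a
    unfolding F'_def using measurable_compose_Pair1[OF _ H, of a] that spG
    by (subst integral_distr[OF id[OF F]]) simp_all
  have H': "(\<lambda>(a, b). H a b) \<in> borel_measurable (G \<Otimes>\<^sub>M F')"
    using H by (simp add: F'_def cong: measurable_cong_sets sets_pair_measure_cong)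
  have outer: "(\<lambda>a. \<integral>b. H a b \<partial>F') \<in> borel_measurable G"
    using F'.borel_measurable_lebesgue_integral[OF H'] .
  have "expectation (\<lambda>\<omega>. H \<omega> \<omega>) = integral\<^sup>L (G' \<Otimes>\<^sub>M F') (\<lambda>(a, b). H a b)"
    unfolding prod by (subst integral_distr[OF diag H]) simp
  also have "\<dots> = (\<integral>a. (\<integral>b. H a b \<partial>F') \<partial>G')"
    using integral_fst'[OF int'] by simp
  also have "\<dots> = expectation (\<lambda>a. \<integral>b. H a b \<partial>F')"
    unfolding G'_def by (rule integral_distr[OF id[OF G] outer])
  also have "\<dots> = expectation (\<lambda>\<omega>. expectation (\<lambda>\<omega>'. H \<omega> \<omega>'))"
    by (rule Bochner_Integration.integral_cong[OF refl inner])
  finally show ?thesis .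
qed

context stochastic_flow
begin

lemma flow_cont: "0 \<le> s \<Longrightarrow> s \<le> t \<Longrightarrow> \<omega> \<in> space M \<Longrightarrow> continuous_on UNIV (\<phi> s t \<omega>)"
  using flow_homeomorphism[of s t \<omega>] by (auto simp: homeomorphism_def)

lemma flow_measurable_at:
  assumes "0 \<le> s" "s \<le> t" "W \<in> measurable K M" "Z \<in> borel_measurable K"
  shows "(\<lambda>k. \<phi> s t (W k) (Z k)) \<in> borel_measurable K"
  by (rule caratheodory_measurable[OF flow_measurable flow_cont assms(3,4)]) (use assms in auto)

lemma AE_flow_id: "AE \<omega> in M. \<forall>s x. 0 \<le> s \<longrightarrow> \<phi> s s \<omega> x = x"
  using flow_compose
proof (rule AE_mp, intro AE_I2 impI allI)
  fix \<omega> s x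
  assume w: "\<omega> \<in> space M" and c: "\<forall>s u t. 0 \<le> s \<and> s \<le> u \<and> u \<le> t \<longrightarrow> \<phi> u t \<omega> \<circ> \<phi> s u \<omega> = \<phi> s t \<omega>" and s: "(0::real) \<le> s"
  then have "\<phi> s s \<omega> \<circ> \<phi> s s \<omega> = \<phi> s s \<omega>" by blast
  then have eq: "\<phi> s s \<omega> (\<phi> s s \<omega> x) = \<phi> s s \<omega> x" by (metis comp_apply)
  obtain g where "homeomorphism UNIV UNIV (\<phi> s s \<omega>) g" using flow_homeomorphism[OF s _ w] by blast
  then have "g (\<phi> s s \<omega> y) = y" for y by (simp add: homeomorphism_def)
  then show "\<phi> s s \<omega> x = x" using eq by metis
qed

text \<open>A sub-sigma-algebra of the sample space, rather than the law on \<open>map_space\<close>: evaluating a map at a point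
  is not jointly measurable for the product sigma-algebra on all maps, whereas
  the maps \<open>\<phi> s t \<omega>\<close> are continuous and can be evaluated at random points.\<close>

definition flow_algebra :: "real \<Rightarrow> real \<Rightarrow> 'w measure" where
  "flow_algebra s t = vimage_algebra (space M) (\<phi> s t) map_space"

lemma flow_map_measurable: "0 \<le> s \<Longrightarrow> s \<le> t \<Longrightarrow> \<phi> s t \<in> measurable M map_space"
  by (intro measurable_PiM_single' flow_measurable) auto

lemma space_flow_algebra [simp]: "space (flow_algebra s t) = space M"
  by (simp add: flow_algebra_def)

lemma sets_flow_algebra: "sets (flow_algebra s t) = {\<phi> s t -` A \<inter> space M | A. A \<in> sets map_space}"
  unfolding flow_algebra_def by (rule sets_vimage_algebra2) (simp add: space_PiM)

lemma subalgebra_flow_algebra: "0 \<le> s \<Longrightarrow> s \<le> t \<Longrightarrow> subalgebra M (flow_algebra s t)"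
  using measurable_sets[OF flow_map_measurable[of s t]] by (auto simp: subalgebra_def sets_flow_algebra)

lemma flow_algebra_measurable: "(\<lambda>\<omega>. \<phi> s t \<omega> x) \<in> borel_measurable (flow_algebra s t)"
proof -
  have "\<phi> s t \<in> measurable (flow_algebra s t) map_space"
    unfolding flow_algebra_def by (rule measurable_vimage_algebra1) (simp add: space_PiM)
  from measurable_compose[OF this measurable_component_singleton[of x UNIV "\<lambda>_. borel"]] show ?thesis by simp
qed

lemma flow_algebra_measurable_at:
  assumes "0 \<le> s" "s \<le> t" "W \<in> measurable K (flow_algebra s t)" "Z \<in> borel_measurable K"
  shows "(\<lambda>k. \<phi> s t (W k) (Z k)) \<in> borel_measurable K"
  by (rule caratheodory_measurable[OF flow_algebra_measurable flow_cont assms(3,4)]) (use assms in auto)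

definition past :: "(nat \<Rightarrow> real) \<Rightarrow> nat \<Rightarrow> 'w measure" where
  "past \<tau> k = sigma (space M) (\<Union>j<k. sets (flow_algebra (\<tau> j) (\<tau> (Suc j))))"

lemma past_generator: "(\<Union>j<k. sets (flow_algebra (\<tau> j) (\<tau> (Suc j)))) \<subseteq> Pow (space M)"
  using sets.sets_into_space by fastforce

lemma space_past [simp]: "space (past \<tau> k) = space M"
  unfolding past_def by (rule space_measure_of[OF past_generator])

lemma sets_past: "sets (past \<tau> k) = sigma_sets (space M) (\<Union>j<k. sets (flow_algebra (\<tau> j) (\<tau> (Suc j))))"
  unfolding past_def by (rule sets_measure_of[OF past_generator])

lemma flow_algebra_past: "j < k \<Longrightarrow> subalgebra (past \<tau> k) (flow_algebra (\<tau> j) (\<tau> (Suc j)))"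
  by (auto simp: subalgebra_def sets_past intro: sigma_sets.Basic)

lemma past_mono: "j \<le> k \<Longrightarrow> subalgebra (past \<tau> k) (past \<tau> j)"
  unfolding subalgebra_def sets_past by (intro conjI sigma_sets_mono' UN_mono) auto

text \<open>Almost surely this is \<open>\<phi> (\<tau> 0) (\<tau> k) \<omega> x\<close>.  Being built from the increments of the flow, it
  is measurable with respect to \<open>past \<tau> k\<close> exactly and not only up to null sets.\<close>

primrec position :: "(nat \<Rightarrow> real) \<Rightarrow> real ^ 'n \<Rightarrow> nat \<Rightarrow> 'w \<Rightarrow> real ^ 'n" where
  "position \<tau> x 0 \<omega> = x"
| "position \<tau> x (Suc k) \<omega> = \<phi> (\<tau> k) (\<tau> (Suc k)) \<omega> (position \<tau> x k \<omega>)"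

lemma times_mono:
  assumes "0 \<le> \<tau> 0" "mono \<tau>"
  shows "0 \<le> \<tau> k" "\<tau> k \<le> \<tau> (Suc k)"
  using assms monoD[OF assms(2), of 0 k] monoD[OF assms(2), of k "Suc k"] by auto

lemma position_measurable:
  assumes "0 \<le> \<tau> 0" "mono \<tau>"
  shows "position \<tau> x k \<in> borel_measurable (past \<tau> k)"
proof (induction k)
  case 0
  have "position \<tau> x 0 = (\<lambda>_. x)" by auto
  then show ?case by simp
next
  case (Suc k)
  have "(\<lambda>\<omega>. \<omega>) \<in> measurable (past \<tau> (Suc k)) (flow_algebra (\<tau> k) (\<tau> (Suc k)))"
    by (rule measurable_from_subalg[OF flow_algebra_past measurable_ident_sets[OF refl]]) simp
  moreover have "position \<tau> x k \<in> borel_measurable (past \<tau> (Suc k))"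
    by (rule measurable_from_subalg[OF past_mono Suc]) simp
  ultimately have "(\<lambda>\<omega>. \<phi> (\<tau> k) (\<tau> (Suc k)) \<omega> (position \<tau> x k \<omega>)) \<in> borel_measurable (past \<tau> (Suc k))"
    by (rule flow_algebra_measurable_at[OF times_mono[OF assms]])
  moreover have "position \<tau> x (Suc k) = (\<lambda>\<omega>. \<phi> (\<tau> k) (\<tau> (Suc k)) \<omega> (position \<tau> x k \<omega>))" by auto
  ultimately show ?case by simp
qed

lemma AE_position:
  assumes "0 \<le> \<tau> 0" "mono \<tau>"
  shows "AE \<omega> in M. \<forall>k. position \<tau> x k \<omega> = \<phi> (\<tau> 0) (\<tau> k) \<omega> x"
  using AE_flow_id flow_compose
proof eventually_elim
  case (elim \<omega>)
  show ?case
  proof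
    fix k
    show "position \<tau> x k \<omega> = \<phi> (\<tau> 0) (\<tau> k) \<omega> x"
    proof (induction k)
      case 0 then show ?case using elim(1) assms(1) by simp
    next
      case (Suc k)
      have "\<phi> (\<tau> k) (\<tau> (Suc k)) \<omega> \<circ> \<phi> (\<tau> 0) (\<tau> k) \<omega> = \<phi> (\<tau> 0) (\<tau> (Suc k)) \<omega>"
        using elim(2) assms(1) monoD[OF assms(2), of 0 k] monoD[OF assms(2), of k "Suc k"] by auto
      then show ?case using Suc by (metis comp_apply position.simps(2))
    qed
  qed
qed

end

context Brownian_flow
begin

lemma subalgebra_past:
  assumes "0 \<le> \<tau> 0" "mono \<tau>"
  shows "subalgebra M (past \<tau> k)"
proof -
  have "sets (flow_algebra (\<tau> j) (\<tau> (Suc j))) \<subseteq> sets M" for j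
    using subalgebra_flow_algebra[OF times_mono[OF assms]] by (auto simp: subalgebra_def)
  then have "sigma_sets (space M) (\<Union>j<k. sets (flow_algebra (\<tau> j) (\<tau> (Suc j)))) \<subseteq> sets M"
    by (intro sets.sigma_sets_subset) auto
  then show ?thesis by (simp add: subalgebra_def sets_past)
qed

lemma indep_past:
  assumes "0 \<le> \<tau> 0" "mono \<tau>"
  shows "indep_set (sets (past \<tau> k)) (sets (flow_algebra (\<tau> k) (\<tau> (Suc k))))"
proof -
  note \<tau> = times_mono[OF assms]
  define E where "E j = sets (flow_algebra (\<tau> j) (\<tau> (Suc j)))" for j
  define I where "I = case_bool {..<k} {k}"
  have union: "(\<Union>j\<in>UNIV. I j) = {..<Suc k}" by (auto simp: I_def UNIV_bool)
  have "indep_vars (\<lambda>_. map_space) (\<lambda>j \<omega>. \<phi> (\<tau> j) (\<tau> (Suc j)) \<omega>) {..<Suc k}"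
    by (rule independent_increments) (use \<tau> in auto)
  then have "indep_sets E {..<Suc k}"
    unfolding indep_vars_def2 E_def sets_flow_algebra by simp
  then have "indep_sets (\<lambda>j. sigma_sets (space M) (\<Union>i\<in>I j. E i)) UNIV"
  proof (intro indep_sets_collect_sigma)
    show "Int_stable (E i)" for i by (auto simp: E_def Int_stable_def)
    show "disjoint_family_on I UNIV" by (auto simp: disjoint_family_on_def I_def split: bool.splits)
  qed (simp only: union)
  moreover have "(\<lambda>j. sigma_sets (space M) (\<Union>i\<in>I j. E i))
      = case_bool (sets (past \<tau> k)) (sets (flow_algebra (\<tau> k) (\<tau> (Suc k))))"
    using sets.sigma_sets_eq[of "flow_algebra (\<tau> k) (\<tau> (Suc k))"]
    by (auto simp: fun_eq_iff I_def E_def sets_past split: bool.splits)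
  ultimately show ?thesis by (simp add: indep_set_def)
qed

lemma past_of_time:
  assumes st: "0 \<le> s" "s \<le> t"
  obtains G where "subalgebra M G" "indep_set (sets G) (sets (flow_algebra s t))"
    "\<And>z. (\<lambda>\<omega>. \<phi> 0 s \<omega> z) \<in> borel_measurable G"
proof (rule that)
  define \<tau> where "\<tau> j = (if j = 0 then 0 else if j = 1 then s else t)" for j :: nat
  have \<tau>: "0 \<le> \<tau> 0" "mono \<tau>" using st by (auto simp: \<tau>_def mono_def)
  have \<tau>1: "\<tau> 1 = s" "\<tau> (Suc 1) = t" by (simp_all add: \<tau>_def)
  have p1: "position \<tau> z 1 = (\<lambda>\<omega>. \<phi> 0 s \<omega> z)" for z by (intro ext) (simp add: \<tau>_def)
  show "subalgebra M (past \<tau> 1)" by (rule subalgebra_past[OF \<tau>])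
  show "indep_set (sets (past \<tau> 1)) (sets (flow_algebra s t))"
    using indep_past[OF \<tau>, of 1] unfolding \<tau>1 .
  show "(\<lambda>\<omega>. \<phi> 0 s \<omega> z) \<in> borel_measurable (past \<tau> 1)" for z
    using position_measurable[OF \<tau>, of z 1] unfolding p1 .
qed

end

context isotropic_Brownian_flow
begin

text \<open>The law of the whole flow determines the joint law of two of its coordinates.\<close>

lemma commutes_pair_law:
  assumes T: "T \<in> borel_measurable borel" and comm: "commutes_in_law M \<phi> T" and st: "0 \<le> s" "s \<le> t"
  shows "distr M (borel \<Otimes>\<^sub>M borel) (\<lambda>\<omega>. (T (\<phi> s t \<omega> x), T (\<phi> s t \<omega> y)))
    = distr M (borel \<Otimes>\<^sub>M borel) (\<lambda>\<omega>. (\<phi> s t \<omega> (T x), \<phi> s t \<omega> (T y)))"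
proof -
  let ?p = "\<lambda>f :: real \<times> real \<times> (real ^ 'n) \<Rightarrow> real ^ 'n. (f (s, t, x), f (s, t, y))"
  let ?Q = "Pi\<^sub>M flow_index (\<lambda>_. borel) :: (real \<times> real \<times> (real ^ 'n) \<Rightarrow> real ^ 'n) measure"
  have idx: "(s, t, z) \<in> flow_index" for z :: "real ^ 'n" using st by (simp add: flow_index_def)
  have p: "?p \<in> measurable ?Q (borel \<Otimes>\<^sub>M borel)"
    by (intro measurable_Pair measurable_component_singleton idx)
  have law: "distr (flow_law M \<psi>) (borel \<Otimes>\<^sub>M borel) ?p = distr M (borel \<Otimes>\<^sub>M borel) (\<lambda>\<omega>. (\<psi> s t \<omega> x, \<psi> s t \<omega> y))"
    if meas: "\<And>s t z. 0 \<le> s \<Longrightarrow> s \<le> t \<Longrightarrow> (\<lambda>\<omega>. \<psi> s t \<omega> z) \<in> borel_measurable M"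
    for \<psi> :: "real \<Rightarrow> real \<Rightarrow> 'w \<Rightarrow> real ^ 'n \<Rightarrow> real ^ 'n"
  proof -
    have r: "(\<lambda>\<omega>. restrict (\<lambda>(s, t, x). \<psi> s t \<omega> x) flow_index) \<in> measurable M ?Q"
      by (rule measurable_restrict) (use meas in \<open>auto simp: flow_index_def\<close>)
    show ?thesis
      unfolding flow_law_def distr_distr[OF p r] by (simp add: comp_def idx)
  qed
  have "distr M (borel \<Otimes>\<^sub>M borel) (\<lambda>\<omega>. (T (\<phi> s t \<omega> x), T (\<phi> s t \<omega> y)))
      = distr (flow_law M (\<lambda>s t \<omega>. T \<circ> \<phi> s t \<omega>)) (borel \<Otimes>\<^sub>M borel) ?p"
    by (subst law) (auto intro!: measurable_compose[OF flow_measurable T])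
  also have "\<dots> = distr (flow_law M (\<lambda>s t \<omega>. \<phi> s t \<omega> \<circ> T)) (borel \<Otimes>\<^sub>M borel) ?p"
    using comm by (simp add: commutes_in_law_def)
  also have "\<dots> = distr M (borel \<Otimes>\<^sub>M borel) (\<lambda>\<omega>. (\<phi> s t \<omega> (T x), \<phi> s t \<omega> (T y)))"
    by (subst law) (auto intro!: flow_measurable)
  finally show ?thesis .
qed

text \<open>Translation by \<open>- y\<close> moves the second particle to the origin, and temporal homogeneity moves the
  starting time to \<open>0\<close>.\<close>

lemma pair_law:
  assumes st: "0 \<le> s" "s \<le> t"
  shows "distr M (borel \<Otimes>\<^sub>M borel) (\<lambda>\<omega>. (\<phi> s t \<omega> x - y, \<phi> s t \<omega> y - y))
    = distr M (borel \<Otimes>\<^sub>M borel) (\<lambda>\<omega>. (\<phi> 0 (t - s) \<omega> (x - y), \<phi> 0 (t - s) \<omega> 0))"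
proof -
  let ?p = "\<lambda>f :: real ^ 'n \<Rightarrow> real ^ 'n. (f (x - y), f 0)"
  have p: "?p \<in> measurable map_space (borel \<Otimes>\<^sub>M borel)"
    by (intro measurable_Pair measurable_component_singleton) auto
  have "distr M (borel \<Otimes>\<^sub>M borel) (\<lambda>\<omega>. (\<phi> s t \<omega> x - y, \<phi> s t \<omega> y - y))
      = distr M (borel \<Otimes>\<^sub>M borel) (\<lambda>\<omega>. (\<phi> s t \<omega> (x - y), \<phi> s t \<omega> 0))"
    using commutes_pair_law[OF _ spatially_homogeneous[of "- y"] st, of x y] by simp
  also have "\<dots> = distr (distr M map_space (\<phi> s t)) (borel \<Otimes>\<^sub>M borel) ?p"
    by (subst distr_distr[OF p flow_map_measurable[OF st]]) (simp add: comp_def)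
  also have "distr M map_space (\<phi> s t) = distr M map_space (\<phi> 0 (t - s))"
    using temporally_homogeneous[of 0 "t - s" s] st by simp
  also have "distr \<dots> (borel \<Otimes>\<^sub>M borel) ?p = distr M (borel \<Otimes>\<^sub>M borel) (\<lambda>\<omega>. (\<phi> 0 (t - s) \<omega> (x - y), \<phi> 0 (t - s) \<omega> 0))"
    by (subst distr_distr[OF p flow_map_measurable]) (use st in \<open>simp_all add: comp_def\<close>)
  finally show ?thesis .
qed

text \<open>The law of \<open>\<phi>\<^bsub>s,s+h\<^esub>(x) - x\<close>, which depends on neither \<open>s\<close> nor \<open>x\<close>.\<close>

definition displacement :: "real \<Rightarrow> (real ^ 'n) measure" where
  "displacement h = distr M borel (\<lambda>\<omega>. \<phi> 0 h \<omega> 0)"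

lemma one_point_law:
  assumes st: "0 \<le> s" "s \<le> t"
  shows "distr M borel (\<lambda>\<omega>. \<phi> s t \<omega> x - x) = displacement (t - s)"
proof -
  note [measurable] = flow_measurable[OF st] flow_measurable[of 0 "t - s"]
  have "distr M borel (\<lambda>\<omega>. \<phi> s t \<omega> x - x)
      = distr (distr M (borel \<Otimes>\<^sub>M borel) (\<lambda>\<omega>. (\<phi> s t \<omega> x - x, \<phi> s t \<omega> x - x))) borel fst"
    by (subst distr_distr) (auto simp: comp_def)
  also have "\<dots> = distr M borel (\<lambda>\<omega>. \<phi> 0 (t - s) \<omega> 0)"
    unfolding pair_law[OF st] using st by (subst distr_distr) (auto simp: comp_def)
  finally show ?thesis by (simp add: displacement_def)
qed

lemma sets_displacement [simp, measurable_cong]: "sets (displacement h) = sets borel"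
  by (simp add: displacement_def)

lemma prob_space_displacement: "0 \<le> h \<Longrightarrow> prob_space (displacement h)"
  unfolding displacement_def by (rule prob_space_distr[OF flow_measurable]) auto

lemma one_point_expectation:
  fixes f :: "real ^ 'n \<Rightarrow> real"
  assumes st: "0 \<le> s" "s \<le> t" and [measurable]: "f \<in> borel_measurable borel"
  shows "(\<integral>\<omega>. f (\<phi> s t \<omega> x - x) \<partial>M) = (\<integral>z. f z \<partial>displacement (t - s))"
    and "integrable M (\<lambda>\<omega>. f (\<phi> s t \<omega> x - x)) \<longleftrightarrow> integrable (displacement (t - s)) f"
proof -
  note [measurable] = flow_measurable[OF st]
  show "(\<integral>\<omega>. f (\<phi> s t \<omega> x - x) \<partial>M) = (\<integral>z. f z \<partial>displacement (t - s))"
    unfolding one_point_law[OF st, of x, symmetric] by (subst integral_distr) auto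
  show "integrable M (\<lambda>\<omega>. f (\<phi> s t \<omega> x - x)) \<longleftrightarrow> integrable (displacement (t - s)) f"
    unfolding one_point_law[OF st, of x, symmetric] by (subst integrable_distr_eq) auto
qed

lemma displacement_orthogonal:
  fixes f :: "real ^ 'n \<Rightarrow> real"
  assumes U: "orthogonal_transformation U" and h: "0 \<le> h" and [measurable]: "f \<in> borel_measurable borel"
  shows "(\<integral>z. f (U z) \<partial>displacement h) = (\<integral>z. f z \<partial>displacement h)"
proof -
  note [measurable] = flow_measurable[OF order_refl h]
  have lin: "linear U" using U by (simp add: orthogonal_transformation_def)
  have [measurable]: "U \<in> borel_measurable borel"
    by (intro borel_measurable_continuous_onI linear_continuous_on linear_conv_bounded_linear[THEN iffD1] lin)
  have U0: "U 0 = 0" using lin by (rule linear_0)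
  have "distr (distr M (borel \<Otimes>\<^sub>M borel) (\<lambda>\<omega>. (U (\<phi> 0 h \<omega> 0), U (\<phi> 0 h \<omega> 0)))) borel fst
      = distr (distr M (borel \<Otimes>\<^sub>M borel) (\<lambda>\<omega>. (\<phi> 0 h \<omega> (U 0), \<phi> 0 h \<omega> (U 0)))) borel fst"
    by (subst commutes_pair_law[OF _ isotropic[OF U] order_refl h]) simp_all
  then have law: "distr M borel (\<lambda>\<omega>. U (\<phi> 0 h \<omega> 0)) = distr M borel (\<lambda>\<omega>. \<phi> 0 h \<omega> 0)"
    by (simp add: distr_distr comp_def U0)
  have "(\<integral>z. f (U z) \<partial>displacement h) = (\<integral>z. f z \<partial>distr M borel (\<lambda>\<omega>. U (\<phi> 0 h \<omega> 0)))"
    unfolding displacement_def by (simp add: integral_distr)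
  then show ?thesis unfolding law displacement_def .
qed

lemma increment_independent:
  fixes f :: "real ^ 'n \<Rightarrow> real"
  assumes st: "0 \<le> s" "s \<le> t"
    and G: "subalgebra M G" and indep: "indep_set (sets G) (sets (flow_algebra s t))"
    and Y: "Y \<in> borel_measurable G" and Z: "Z \<in> borel_measurable G"
    and f: "f \<in> borel_measurable borel"
    and int: "integrable M (\<lambda>\<omega>. Y \<omega> * f (\<phi> s t \<omega> (Z \<omega>) - Z \<omega>))"
  shows "(\<integral>\<omega>. Y \<omega> * f (\<phi> s t \<omega> (Z \<omega>) - Z \<omega>) \<partial>M)
    = (\<integral>\<omega>. Y \<omega> \<partial>M) * (\<integral>z. f z \<partial>displacement (t - s))"
proof -
  let ?H = "\<lambda>\<omega> \<omega>'. Y \<omega> * f (\<phi> s t \<omega>' (Z \<omega>) - Z \<omega>)"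
  note [measurable] = Y Z f
  have [measurable]: "(\<lambda>p. \<phi> s t (snd p) (Z (fst p))) \<in> borel_measurable (G \<Otimes>\<^sub>M flow_algebra s t)"
    by (rule flow_algebra_measurable_at[OF st]) measurable
  have H: "(\<lambda>(a, b). ?H a b) \<in> borel_measurable (G \<Otimes>\<^sub>M flow_algebra s t)"
    unfolding case_prod_beta by measurable
  have "(\<integral>\<omega>. ?H \<omega> \<omega> \<partial>M) = (\<integral>\<omega>. (\<integral>\<omega>'. ?H \<omega> \<omega>' \<partial>M) \<partial>M)"
    by (rule freezing[OF G subalgebra_flow_algebra[OF st] indep H int])
  then show ?thesis
    by (simp add: one_point_expectation(1)[OF st f])
qed

text \<open>The Markov property of the difference of two particles: freeze both positions at time \<open>s\<close>, and translate the
  second one to the origin.\<close>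

lemma two_point_markov:
  fixes f :: "real ^ 'n \<Rightarrow> real"
  assumes st: "0 \<le> s" "s \<le> t" and [measurable]: "f \<in> borel_measurable borel" and K: "\<And>z. \<bar>f z\<bar> \<le> K"
  shows "(\<integral>\<omega>. f (\<phi> 0 t \<omega> x - \<phi> 0 t \<omega> y) \<partial>M)
    = (\<integral>\<omega>. (\<integral>\<omega>'. f (\<phi> 0 (t - s) \<omega>' (\<phi> 0 s \<omega> x - \<phi> 0 s \<omega> y) - \<phi> 0 (t - s) \<omega>' 0) \<partial>M) \<partial>M)"
proof -
  obtain G where G: "subalgebra M G" "indep_set (sets G) (sets (flow_algebra s t))"
    and past [measurable]: "\<And>z. (\<lambda>\<omega>. \<phi> 0 s \<omega> z) \<in> borel_measurable G"
    using past_of_time[OF st] by blast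
  have [measurable]: "(\<lambda>p. \<phi> s t (snd p) (\<phi> 0 s (fst p) z)) \<in> borel_measurable (G \<Otimes>\<^sub>M flow_algebra s t)" for z
    by (rule flow_algebra_measurable_at[OF st]) measurable
  let ?H = "\<lambda>\<omega> \<omega>'. f (\<phi> s t \<omega>' (\<phi> 0 s \<omega> x) - \<phi> s t \<omega>' (\<phi> 0 s \<omega> y))"
  have H: "(\<lambda>(a, b). ?H a b) \<in> borel_measurable (G \<Otimes>\<^sub>M flow_algebra s t)"
    unfolding case_prod_beta by measurable
  have [measurable]: "(\<lambda>\<omega>. \<phi> 0 s \<omega> z) \<in> borel_measurable M" for z by (rule flow_measurable) (use st in auto)
  have [measurable]: "(\<lambda>\<omega>. \<phi> s t \<omega> (\<phi> 0 s \<omega> z)) \<in> borel_measurable M" for z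
    by (rule flow_measurable_at[OF st]) auto
  have int: "integrable M (\<lambda>\<omega>. ?H \<omega> \<omega>)"
    by (rule integrable_const_bound[where B=K]) (use K in auto)
  have "(\<integral>\<omega>. f (\<phi> 0 t \<omega> x - \<phi> 0 t \<omega> y) \<partial>M) = (\<integral>\<omega>. ?H \<omega> \<omega> \<partial>M)"
  proof (rule integral_cong_AE)
    have [measurable]: "(\<lambda>\<omega>. \<phi> 0 t \<omega> z) \<in> borel_measurable M" for z by (rule flow_measurable) (use st in auto)
    show "(\<lambda>\<omega>. f (\<phi> 0 t \<omega> x - \<phi> 0 t \<omega> y)) \<in> borel_measurable M" "(\<lambda>\<omega>. ?H \<omega> \<omega>) \<in> borel_measurable M"
      by measurable
    show "AE \<omega> in M. f (\<phi> 0 t \<omega> x - \<phi> 0 t \<omega> y) = ?H \<omega> \<omega>"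
      using flow_compose
    proof eventually_elim
      case (elim \<omega>)
      then have "\<phi> s t \<omega> \<circ> \<phi> 0 s \<omega> = \<phi> 0 t \<omega>" using st by blast
      then have "\<phi> 0 t \<omega> z = \<phi> s t \<omega> (\<phi> 0 s \<omega> z)" for z by (metis comp_apply)
      then show ?case by simp
    qed
  qed
  also have "\<dots> = (\<integral>\<omega>. (\<integral>\<omega>'. ?H \<omega> \<omega>' \<partial>M) \<partial>M)"
    by (rule freezing[OF G(1) subalgebra_flow_algebra[OF st] G(2) H int])
  finally have main: "(\<integral>\<omega>. f (\<phi> 0 t \<omega> x - \<phi> 0 t \<omega> y) \<partial>M) = (\<integral>\<omega>. (\<integral>\<omega>'. ?H \<omega> \<omega>' \<partial>M) \<partial>M)" .
  have inner: "(\<integral>\<omega>'. ?H \<omega> \<omega>' \<partial>M) = (\<integral>\<omega>'. f (\<phi> 0 (t - s) \<omega>' (\<phi> 0 s \<omega> x - \<phi> 0 s \<omega> y) - \<phi> 0 (t - s) \<omega>' 0) \<partial>M)" for \<omega>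
  proof -
    note [measurable] = flow_measurable[OF st] flow_measurable[of 0 "t - s"]
    let ?g = "\<lambda>p. f (fst p - snd p) :: real"
    have "(\<integral>\<omega>'. ?H \<omega> \<omega>' \<partial>M) = (\<integral>p. ?g p \<partial>distr M (borel \<Otimes>\<^sub>M borel) (\<lambda>\<omega>'. (\<phi> s t \<omega>' (\<phi> 0 s \<omega> x) - \<phi> 0 s \<omega> y, \<phi> s t \<omega>' (\<phi> 0 s \<omega> y) - \<phi> 0 s \<omega> y)))"
      by (subst integral_distr) auto
    also have "\<dots> = (\<integral>\<omega>'. f (\<phi> 0 (t - s) \<omega>' (\<phi> 0 s \<omega> x - \<phi> 0 s \<omega> y) - \<phi> 0 (t - s) \<omega>' 0) \<partial>M)"
      unfolding pair_law[OF st] using st by (subst integral_distr) auto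
    finally show ?thesis .
  qed
  show ?thesis unfolding main inner ..
qed

end

section \<open>The one-point motion is Gaussian\<close>

lemma orthogonal_transformation_uminus: "orthogonal_transformation (uminus :: 'a::real_inner \<Rightarrow> 'a)"
  unfolding orthogonal_transformation_def by (auto intro!: linearI)

lemma (in stochastic_flow) AE_path_continuous: "AE \<omega> in M. continuous_on {0..} (\<lambda>t. \<phi> 0 t \<omega> x)"
  using flow_continuous
proof eventually_elim
  case (elim \<omega>)
  have "continuous_on {0..} (\<lambda>t. (\<lambda>(s, t, x). \<phi> s t \<omega> x) (0, t, x))"
    by (rule continuous_on_compose2[OF elim]) (auto intro!: continuous_intros)
  then show ?case by simp
qed

context isotropic_Brownian_flow
begin

lemma later_increment_independent:
  fixes f g :: "real ^ 'n \<Rightarrow> real"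
  assumes st: "0 \<le> s" "s \<le> t" and [measurable]: "f \<in> borel_measurable borel" "g \<in> borel_measurable borel"
    and int: "integrable M (\<lambda>\<omega>. g (\<phi> 0 s \<omega> x) * f (\<phi> 0 t \<omega> y - \<phi> 0 s \<omega> y))"
  shows "(\<integral>\<omega>. g (\<phi> 0 s \<omega> x) * f (\<phi> 0 t \<omega> y - \<phi> 0 s \<omega> y) \<partial>M)
    = (\<integral>\<omega>. g (\<phi> 0 s \<omega> x) \<partial>M) * (\<integral>z. f z \<partial>displacement (t - s))"
proof -
  obtain G where G: "subalgebra M G" "indep_set (sets G) (sets (flow_algebra s t))"
    and Z [measurable]: "\<And>z. (\<lambda>\<omega>. \<phi> 0 s \<omega> z) \<in> borel_measurable G"
    using past_of_time[OF st] by blast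
  have [measurable]: "(\<lambda>\<omega>. \<phi> 0 s \<omega> z) \<in> borel_measurable M" "(\<lambda>\<omega>. \<phi> 0 t \<omega> z) \<in> borel_measurable M" for z
    using st by (auto intro!: flow_measurable)
  have [measurable]: "(\<lambda>\<omega>. \<phi> s t \<omega> (\<phi> 0 s \<omega> z)) \<in> borel_measurable M" for z
    by (rule flow_measurable_at[OF st]) auto
  have Y: "(\<lambda>\<omega>. g (\<phi> 0 s \<omega> x)) \<in> borel_measurable G" by measurable
  let ?A = "\<lambda>\<omega>. g (\<phi> 0 s \<omega> x) * f (\<phi> 0 t \<omega> y - \<phi> 0 s \<omega> y)"
  let ?B = "\<lambda>\<omega>. g (\<phi> 0 s \<omega> x) * f (\<phi> s t \<omega> (\<phi> 0 s \<omega> y) - \<phi> 0 s \<omega> y)"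
  have eq: "AE \<omega> in M. ?A \<omega> = ?B \<omega>"
    using flow_compose
  proof eventually_elim
    case (elim \<omega>)
    then have "\<phi> s t \<omega> \<circ> \<phi> 0 s \<omega> = \<phi> 0 t \<omega>" using st by blast
    then have "\<phi> 0 t \<omega> y = \<phi> s t \<omega> (\<phi> 0 s \<omega> y)" by (metis comp_apply)
    then show ?case by simp
  qed
  have m: "?A \<in> borel_measurable M" "?B \<in> borel_measurable M" by measurable
  have intB: "integrable M ?B"
    using int integrable_cong_AE[OF m eq] by blast
  have "(\<integral>\<omega>. ?A \<omega> \<partial>M) = (\<integral>\<omega>. ?B \<omega> \<partial>M)" by (rule integral_cong_AE[OF m eq])
  also have "\<dots> = (\<integral>\<omega>. g (\<phi> 0 s \<omega> x) \<partial>M) * (\<integral>z. f z \<partial>displacement (t - s))"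
    by (rule increment_independent[OF st G Y Z assms(3) intB])
  finally show ?thesis .
qed

text \<open>The characteristic function of the displacement, which is real since reflection at the origin
  preserves the law.\<close>

definition charf :: "real \<Rightarrow> real ^ 'n \<Rightarrow> real" where
  "charf t u = (\<integral>z. cos (u \<bullet> z) \<partial>displacement t)"

lemma displacement_integrable_bounded:
  fixes f :: "real ^ 'n \<Rightarrow> real"
  assumes "0 \<le> t" "f \<in> borel_measurable borel" "\<And>z. \<bar>f z\<bar> \<le> K"
  shows "integrable (displacement t) f"
  using assms by (intro integrable_bounded_borel[OF prob_space_displacement, where K=K]) auto

lemma displacement_sin: "0 \<le> t \<Longrightarrow> (\<integral>z. sin (u \<bullet> z) \<partial>displacement t) = 0"
  using displacement_orthogonal[OF orthogonal_transformation_uminus, of t "\<lambda>z. sin (u \<bullet> z)"] by simp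

lemma charf_eq: "0 \<le> t \<Longrightarrow> charf t u = (\<integral>\<omega>. cos (u \<bullet> \<phi> 0 t \<omega> 0) \<partial>M)"
  unfolding charf_def using one_point_expectation(1)[of 0 t "\<lambda>z. cos (u \<bullet> z)" 0] by simp

lemma charf_add:
  assumes s: "0 \<le> s" and t: "0 \<le> t"
  shows "charf (s + t) u = charf s u * charf t u"
proof -
  let ?X = "\<lambda>\<omega>. \<phi> 0 s \<omega> 0" and ?D = "\<lambda>\<omega>. \<phi> 0 (s + t) \<omega> 0 - \<phi> 0 s \<omega> 0"
  have [measurable]: "(\<lambda>\<omega>. \<phi> 0 s \<omega> 0) \<in> borel_measurable M" "(\<lambda>\<omega>. \<phi> 0 (s + t) \<omega> 0) \<in> borel_measurable M"
    using s t by (auto intro!: flow_measurable)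
  have le: "s \<le> s + t" using t by simp
  have i: "integrable M (\<lambda>\<omega>. cos (u \<bullet> ?X \<omega>) * cos (u \<bullet> ?D \<omega>))" "integrable M (\<lambda>\<omega>. sin (u \<bullet> ?X \<omega>) * sin (u \<bullet> ?D \<omega>))"
    by (rule integrable_const_bound[where B=1]; auto simp: abs_mult intro!: mult_le_one)+
  have "cos (u \<bullet> \<phi> 0 (s + t) \<omega> 0) = cos (u \<bullet> ?X \<omega>) * cos (u \<bullet> ?D \<omega>) - sin (u \<bullet> ?X \<omega>) * sin (u \<bullet> ?D \<omega>)" for \<omega>
    by (simp add: inner_diff_right flip: cos_add)
  then have "charf (s + t) u = (\<integral>\<omega>. cos (u \<bullet> ?X \<omega>) * cos (u \<bullet> ?D \<omega>) \<partial>M) - (\<integral>\<omega>. sin (u \<bullet> ?X \<omega>) * sin (u \<bullet> ?D \<omega>) \<partial>M)"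
    using s t i by (simp add: charf_eq)
  also have "(\<integral>\<omega>. cos (u \<bullet> ?X \<omega>) * cos (u \<bullet> ?D \<omega>) \<partial>M) = charf s u * charf t u"
    using later_increment_independent[OF s le, of "\<lambda>z. cos (u \<bullet> z)" "\<lambda>z. cos (u \<bullet> z)" 0 0] i(1) s
    by (simp add: charf_eq[OF s] charf_def[of t])
  also have "(\<integral>\<omega>. sin (u \<bullet> ?X \<omega>) * sin (u \<bullet> ?D \<omega>) \<partial>M) = 0"
    using later_increment_independent[OF s le, of "\<lambda>z. sin (u \<bullet> z)" "\<lambda>z. sin (u \<bullet> z)" 0 0] i(2) t
    by (simp add: displacement_sin)
  finally show ?thesis by simp
qed

lemma charf_le_1: "0 \<le> t \<Longrightarrow> charf t u \<le> 1"
proof -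
  assume t: "0 \<le> t"
  interpret D: prob_space "displacement t" by (rule prob_space_displacement[OF t])
  have "charf t u \<le> (\<integral>z. 1 \<partial>displacement t)"
    unfolding charf_def by (rule integral_mono) (auto intro!: displacement_integrable_bounded[OF t, where K=1])
  then show ?thesis by (simp add: D.prob_space)
qed

lemma charf_0: "charf 0 u = 1"
proof -
  have "(\<integral>\<omega>. cos (u \<bullet> \<phi> 0 0 \<omega> 0) \<partial>M) = (\<integral>\<omega>. 1 \<partial>M)"
  proof (rule integral_cong_AE)
    show "AE \<omega> in M. cos (u \<bullet> \<phi> 0 0 \<omega> 0) = 1"
      using AE_flow_id by eventually_elim simp
  qed (use flow_measurable[of 0 0 0] in auto)
  then show ?thesis by (simp add: charf_eq prob_space)
qed

lemma charf_power: "0 \<le> s \<Longrightarrow> charf (real k * s) u = charf s u ^ k"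
proof (induction k)
  case 0 then show ?case by (simp add: charf_0)
next
  case (Suc k)
  then show ?case using charf_add[of s "real k * s" u] by (simp add: distrib_right)
qed

text \<open>\<open>charf t u\<close> is the \<open>n\<close>-th power of \<open>charf (t / n) u\<close>, and the latter tends to \<open>1\<close> by continuity of the
  paths.\<close>

lemma charf_pos:
  assumes t: "0 \<le> t"
  shows "0 < charf t u"
proof -
  have "(\<lambda>n. charf (t / real (Suc n)) u) \<longlonglongrightarrow> 1"
  proof -
    have "(\<lambda>n. \<integral>\<omega>. cos (u \<bullet> \<phi> 0 (t / real (Suc n)) \<omega> 0) \<partial>M) \<longlonglongrightarrow> (\<integral>\<omega>. 1 \<partial>M)"
    proof (rule integral_dominated_convergence[where w="\<lambda>_. 1"])
      show "AE \<omega> in M. (\<lambda>n. cos (u \<bullet> \<phi> 0 (t / real (Suc n)) \<omega> 0)) \<longlonglongrightarrow> 1"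
        using AE_path_continuous[of 0] AE_flow_id
      proof eventually_elim
        case (elim \<omega>)
        have "(\<lambda>n. t / real (Suc n)) \<longlonglongrightarrow> 0"
          by (rule LIMSEQ_Suc[OF lim_const_over_n])
        then have "(\<lambda>n. \<phi> 0 (t / real (Suc n)) \<omega> 0) \<longlonglongrightarrow> \<phi> 0 0 \<omega> 0"
          by (rule continuous_on_tendsto_compose[OF elim(1)]) (use t in auto)
        then have "(\<lambda>n. cos (u \<bullet> \<phi> 0 (t / real (Suc n)) \<omega> 0)) \<longlonglongrightarrow> cos (u \<bullet> \<phi> 0 0 \<omega> 0)"
          by (intro tendsto_intros)
        moreover have "\<phi> 0 0 \<omega> 0 = 0" using elim(2) by blast
        ultimately show ?case by simp
      qed
      have "(\<lambda>\<omega>. \<phi> 0 (t / real (Suc n)) \<omega> 0) \<in> borel_measurable M" for n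
        by (rule flow_measurable) (use t in auto)
      note [measurable] = this
      show "(\<lambda>\<omega>. cos (u \<bullet> \<phi> 0 (t / real (Suc n)) \<omega> 0)) \<in> borel_measurable M" for n
        by measurable
    qed auto
    then show ?thesis using t by (simp add: charf_eq prob_space del: of_nat_Suc)
  qed
  then have "eventually (\<lambda>n. 0 < charf (t / real (Suc n)) u) sequentially"
    by (rule order_tendstoD) simp
  then obtain n where n: "0 < charf (t / real (Suc n)) u" by (auto dest: eventually_happens)
  have "charf t u = charf (t / real (Suc n)) u ^ Suc n"
    using charf_power[of "t / real (Suc n)" "Suc n" u] t by (simp del: of_nat_Suc power_Suc)
  then show ?thesis using n by (simp del: power_Suc)
qed

definition exponent :: "real ^ 'n \<Rightarrow> real" where
  "exponent u = - ln (charf 1 u)"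

lemma exponent_nonneg: "0 \<le> exponent u"
  using charf_le_1[of 1 u] charf_pos[of 1 u] by (simp add: exponent_def)

lemma charf_exponent:
  assumes t: "0 \<le> t"
  shows "charf t u = exp (- (t * exponent u))"
proof -
  have "- ln (charf t u) = t * (- ln (charf 1 u))"
  proof (rule nonneg_additive_linear[OF _ _ t])
    show "- ln (charf (s + r) u) = - ln (charf s u) + - ln (charf r u)" if "0 \<le> s" "0 \<le> r" for s r
      using that charf_pos[of s u] charf_pos[of r u] by (simp add: charf_add ln_mult)
    show "0 \<le> - ln (charf s u)" if "0 \<le> s" for s
      using that charf_pos[of s u] charf_le_1[of s u] by simp
  qed
  then have "ln (charf t u) = - (t * exponent u)" by (simp add: exponent_def)
  then show ?thesis using charf_pos[OF t, of u] by (metis exp_ln)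
qed

lemma prod_increments:
  fixes h :: "real ^ 'n \<Rightarrow> real"
  assumes d: "0 \<le> d" and h [measurable]: "h \<in> borel_measurable borel" and h01: "\<And>z. 0 \<le> h z" "\<And>z. h z \<le> 1"
  shows "(\<integral>\<omega>. (\<Prod>j<k. h (\<phi> 0 (real (Suc j) * d) \<omega> 0 - \<phi> 0 (real j * d) \<omega> 0)) \<partial>M)
    = (\<integral>z. h z \<partial>displacement d) ^ k"
proof -
  define \<tau> where "\<tau> j = real j * d" for j :: nat
  have \<tau>: "0 \<le> \<tau> 0" "mono \<tau>" using d by (auto simp: \<tau>_def mono_def intro!: mult_right_mono)
  have \<tau>d: "\<tau> (Suc k) - \<tau> k = d" for k by (simp add: \<tau>_def distrib_right)
  let ?Z = "position \<tau> 0"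
  let ?Y = "\<lambda>k \<omega>. \<Prod>j<k. h (?Z (Suc j) \<omega> - ?Z j \<omega>)"
  have Zm: "?Z j \<in> borel_measurable (past \<tau> k)" if "j \<le> k" for j k
    by (rule measurable_from_subalg[OF past_mono[OF that] position_measurable[OF \<tau>]])
  have Ym: "?Y k \<in> borel_measurable (past \<tau> k)" for k
  proof (rule borel_measurable_prod)
    fix j assume "j \<in> {..<k}"
    then have [measurable]: "?Z j \<in> borel_measurable (past \<tau> k)" "?Z (Suc j) \<in> borel_measurable (past \<tau> k)"
      by (auto intro!: Zm simp del: position.simps)
    show "(\<lambda>\<omega>. h (?Z (Suc j) \<omega> - ?Z j \<omega>)) \<in> borel_measurable (past \<tau> k)" by (measurable)
  qed
  have Y01: "0 \<le> ?Y k \<omega>" "?Y k \<omega> \<le> 1" for k \<omega>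
    using h01 by (auto intro!: prod_nonneg prod_le_1)
  have YM: "?Y k \<in> borel_measurable M" for k
    by (rule measurable_from_subalg[OF subalgebra_past[OF \<tau>] Ym])
  have Yint: "integrable M (?Y k)" for k
    by (rule integrable_const_bound[where B=1]) (use Y01 YM in \<open>auto simp del: position.simps\<close>)
  have "(\<integral>\<omega>. ?Y k \<omega> \<partial>M) = (\<integral>z. h z \<partial>displacement d) ^ k"
  proof (induction k)
    case 0 then show ?case by (simp add: prob_space)
  next
    case (Suc k)
    have eq: "?Y (Suc k) = (\<lambda>\<omega>. ?Y k \<omega> * h (\<phi> (\<tau> k) (\<tau> (Suc k)) \<omega> (?Z k \<omega>) - ?Z k \<omega>))"
      by (auto simp: mult.commute)
    have "(\<integral>\<omega>. ?Y (Suc k) \<omega> \<partial>M) = (\<integral>\<omega>. ?Y k \<omega> \<partial>M) * (\<integral>z. h z \<partial>displacement (\<tau> (Suc k) - \<tau> k))"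
      unfolding eq by (rule increment_independent[OF times_mono[OF \<tau>] subalgebra_past[OF \<tau>] indep_past[OF \<tau>] Ym Zm[OF order_refl] h]) (use Yint[of "Suc k"] in \<open>simp only: eq\<close>)
    then show ?case unfolding Suc.IH \<tau>d by simp
  qed
  moreover have "(\<integral>\<omega>. (\<Prod>j<k. h (\<phi> 0 (real (Suc j) * d) \<omega> 0 - \<phi> 0 (real j * d) \<omega> 0)) \<partial>M) = (\<integral>\<omega>. ?Y k \<omega> \<partial>M)"
  proof (rule integral_cong_AE[OF _ YM])
    have "(\<lambda>\<omega>. \<phi> 0 (real j * d) \<omega> 0) \<in> borel_measurable M" for j
      by (rule flow_measurable) (use d in auto)
    note [measurable] = this
    show "(\<lambda>\<omega>. \<Prod>j<k. h (\<phi> 0 (real (Suc j) * d) \<omega> 0 - \<phi> 0 (real j * d) \<omega> 0)) \<in> borel_measurable M"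
      by measurable
    show "AE \<omega> in M. (\<Prod>j<k. h (\<phi> 0 (real (Suc j) * d) \<omega> 0 - \<phi> 0 (real j * d) \<omega> 0)) = ?Y k \<omega>"
      using AE_position[OF \<tau>, of 0]
    proof eventually_elim
      case (elim \<omega>)
      then have "?Z j \<omega> = \<phi> 0 (real j * d) \<omega> 0" for j by (simp add: \<tau>_def)
      then show ?case by (simp only:)
    qed
  qed
  ultimately show ?thesis by simp
qed

text \<open>Let \<open>p\<close> be the probability that an increment over time \<open>1 / n\<close> exceeds \<open>\<epsilon>\<close>.  The \<open>n\<close> increments
  in \<open>[0,1]\<close> are independent, so none of them exceeds \<open>\<epsilon>\<close> with probability \<open>(1 - p)\<^sup>n\<close>.  By uniform
  continuity of the paths this tends to \<open>1\<close>, and \<open>(1 - p)\<^sup>n \<le> exp(- n p)\<close> then gives \<open>n p \<longlongrightarrow> 0\<close>.\<close>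

lemma large_increments_negligible:
  assumes "0 < \<epsilon>"
  shows "(\<lambda>n. real (Suc n) * measure (displacement (1 / real (Suc n))) {z. \<epsilon> < \<bar>u \<bullet> z\<bar>}) \<longlonglongrightarrow> 0"
proof -
  define p where "p n = measure (displacement (1 / real (Suc n))) {z. \<epsilon> < \<bar>u \<bullet> z\<bar>}" for n
  define h where "h z = (indicator {z. \<bar>u \<bullet> z\<bar> \<le> \<epsilon>} z :: real)" for z
  have hm [measurable]: "h \<in> borel_measurable borel" unfolding h_def by measurable
  define N where "N n = real (Suc n)" for n
  have N: "0 < N n" for n by (simp add: N_def)
  have hp: "(\<integral>z. h z \<partial>displacement (1 / N n)) = 1 - p n" for n
  proof -
    have t: "0 \<le> 1 / N n" using N[of n] by simp
    interpret D: prob_space "displacement (1 / N n)" by (rule prob_space_displacement[OF t])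
    have sp: "space (displacement (1 / N n)) = UNIV" by (simp add: displacement_def)
    have "{z. \<bar>u \<bullet> z\<bar> \<le> \<epsilon>} = space (displacement (1 / N n)) - {z. \<epsilon> < \<bar>u \<bullet> z\<bar>}" by (auto simp: sp)
    moreover have "{z. \<epsilon> < \<bar>u \<bullet> z\<bar>} \<in> D.events" by simp
    ultimately have "D.prob {z. \<bar>u \<bullet> z\<bar> \<le> \<epsilon>} = 1 - p n"
      using D.prob_compl[of "{z. \<epsilon> < \<bar>u \<bullet> z\<bar>}"] by (simp add: p_def N_def)
    then show ?thesis unfolding h_def by (simp add: sp)
  qed
  define Y where "Y n \<omega> = (\<Prod>j<Suc n. h (\<phi> 0 (real (Suc j) * (1 / N n)) \<omega> 0 - \<phi> 0 (real j * (1 / N n)) \<omega> 0))" for n \<omega>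
  have EY: "(\<integral>\<omega>. Y n \<omega> \<partial>M) = (1 - p n) ^ Suc n" for n
    unfolding Y_def hp[symmetric] by (rule prod_increments) (use N[of n] in \<open>auto simp: h_def\<close>)
  have "(\<lambda>n. \<integral>\<omega>. Y n \<omega> \<partial>M) \<longlonglongrightarrow> (\<integral>\<omega>. 1 \<partial>M)"
  proof (rule integral_dominated_convergence[where w="\<lambda>_. 1"])
    have "(\<lambda>\<omega>. \<phi> 0 (real j * (1 / N n)) \<omega> 0) \<in> borel_measurable M" for j n
      by (rule flow_measurable) (use N[of n] in auto)
    note [measurable] = this
    show "Y n \<in> borel_measurable M" for n unfolding Y_def by measurable
    have "\<bar>Y n \<omega>\<bar> \<le> 1" for n \<omega>
      unfolding Y_def abs_prod by (intro prod_le_1) (auto simp: h_def indicator_def)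
    then show "AE \<omega> in M. norm (Y n \<omega>) \<le> 1" for n by simp
    show "AE \<omega> in M. (\<lambda>n. Y n \<omega>) \<longlonglongrightarrow> 1"
      using AE_path_continuous[of 0]
    proof eventually_elim
      case (elim \<omega>)
      have "uniformly_continuous_on {0..1} (\<lambda>t. u \<bullet> \<phi> 0 t \<omega> 0)"
        by (intro compact_uniformly_continuous continuous_intros continuous_on_subset[OF elim]) auto
      then obtain \<delta> where \<delta>: "0 < \<delta>"
        "\<And>r r'. r \<in> {0..1} \<Longrightarrow> r' \<in> {0..1} \<Longrightarrow> dist r' r < \<delta> \<Longrightarrow> dist (u \<bullet> \<phi> 0 r' \<omega> 0) (u \<bullet> \<phi> 0 r \<omega> 0) < \<epsilon>"
        using assms unfolding uniformly_continuous_on_def by meson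
      have "(\<lambda>n. 1 / N n) \<longlonglongrightarrow> 0" unfolding N_def by (rule LIMSEQ_Suc[OF lim_const_over_n])
      then have "eventually (\<lambda>n. 1 / N n < \<delta>) sequentially" using \<delta>(1) by (rule order_tendstoD)
      then have "eventually (\<lambda>n. Y n \<omega> = 1) sequentially"
      proof eventually_elim
        case (elim n)
        have "h (\<phi> 0 (real (Suc j) * (1 / N n)) \<omega> 0 - \<phi> 0 (real j * (1 / N n)) \<omega> 0) = 1" if "j < Suc n" for j
        proof -
          have "real j * (1 / N n) \<in> {0..1}" "real (Suc j) * (1 / N n) \<in> {0..1}"
            using that N[of n] by (auto simp: N_def divide_simps)
          moreover have "dist (real (Suc j) * (1 / N n)) (real j * (1 / N n)) < \<delta>"
            using elim N[of n] by (simp add: dist_real_def diff_divide_distrib[symmetric])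
          ultimately have "dist (u \<bullet> \<phi> 0 (real (Suc j) * (1 / N n)) \<omega> 0) (u \<bullet> \<phi> 0 (real j * (1 / N n)) \<omega> 0) < \<epsilon>"
            by (intro \<delta>(2))
          then show ?thesis by (simp add: h_def dist_real_def inner_diff_right)
        qed
        then show ?case unfolding Y_def by (intro prod.neutral) auto
      qed
      then show ?case by (rule tendsto_eventually)
    qed
  qed auto
  then have lim: "(\<lambda>n. (1 - p n) ^ Suc n) \<longlonglongrightarrow> 1"
    unfolding EY by (simp add: prob_space)
  have p01: "0 \<le> p n" "p n \<le> 1" for n
    using prob_space.prob_le_1[OF prob_space_displacement[of "1 / real (Suc n)"]] by (auto simp: p_def)
  have "(\<lambda>n. inverse ((1 - p n) ^ Suc n) - 1) \<longlonglongrightarrow> inverse 1 - 1"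
    by (intro tendsto_intros lim) simp
  then have up: "(\<lambda>n. inverse ((1 - p n) ^ Suc n) - 1) \<longlonglongrightarrow> 0" by simp
  have "eventually (\<lambda>n. 0 < (1 - p n) ^ Suc n) sequentially" by (rule order_tendstoD[OF lim]) simp
  then have "eventually (\<lambda>n. real (Suc n) * p n \<le> inverse ((1 - p n) ^ Suc n) - 1) sequentially"
  proof eventually_elim
    case (elim n)
    have "(1 - p n) ^ Suc n \<le> exp (- p n) ^ Suc n"
      using p01[of n] exp_ge_add_one_self[of "- p n"] by (intro power_mono) auto
    also have "\<dots> = exp (- (real (Suc n) * p n))"
      by (simp only: exp_of_nat_mult[symmetric] mult_minus_right)
    finally have "exp (real (Suc n) * p n) \<le> inverse ((1 - p n) ^ Suc n)"
      using elim by (simp only: exp_minus) (metis inverse_inverse_eq le_imp_inverse_le)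
    then show ?case using exp_ge_add_one_self[of "real (Suc n) * p n"] by linarith
  qed
  then have "(\<lambda>n. real (Suc n) * p n) \<longlonglongrightarrow> 0"
    using p01 by (intro tendsto_sandwich[OF _ _ tendsto_const up]) (auto intro!: always_eventually)
  then show ?thesis by (simp only: p_def)
qed

text \<open>\<open>exponent v\<close> is the limit of \<open>n E(1 - cos(v \<bullet> Y))\<close> for the displacement \<open>Y\<close> over time \<open>1 / n\<close>.  On
  \<open>|u \<bullet> Y| \<le> \<epsilon>\<close> the integrands for \<open>r u\<close> and \<open>u\<close> differ by the factor \<open>r\<^sup>2\<close> up to a small relative
  error, and the complementary event has probability \<open>o(1 / n)\<close>.\<close>

lemma exponent_scale: "exponent (r *\<^sub>R u) = r\<^sup>2 * exponent u"
proof -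
  define N where "N n = real (Suc n)" for n
  have N: "0 < N n" for n by (simp add: N_def)
  have lim: "(\<lambda>n. N n * (1 - charf (1 / N n) v)) \<longlonglongrightarrow> exponent v" for v
  proof -
    have "(\<lambda>n. real (Suc n) * (1 - exp (- (1 / real (Suc n) * c)))) \<longlonglongrightarrow> c" for c :: real
    proof (cases c "0::real" rule: linorder_cases)
      case less then show ?thesis by real_asymp
    next
      case equal then show ?thesis by simp
    next
      case greater then show ?thesis by real_asymp
    qed
    then have "(\<lambda>n. real (Suc n) * (1 - exp (- (1 / real (Suc n) * exponent v)))) \<longlonglongrightarrow> exponent v" .
    moreover have "charf (1 / N n) v = exp (- (1 / real (Suc n) * exponent v))" for n
      using charf_exponent[of "1 / N n" v] N[of n] unfolding N_def by simp
    ultimately show ?thesis by (simp only: N_def)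
  qed
  have bound: "\<bar>exponent (r *\<^sub>R u) - r\<^sup>2 * exponent u\<bar> \<le> \<delta> * exponent u" if \<delta>: "0 < \<delta>" for \<delta>
  proof -
    obtain \<epsilon> where \<epsilon>: "0 < \<epsilon>"
      "\<And>y. \<bar>y\<bar> \<le> \<epsilon> \<Longrightarrow> \<bar>(1 - cos (r * y)) - r\<^sup>2 * (1 - cos y)\<bar> \<le> \<delta> * (1 - cos y)"
      using one_minus_cos_scale[OF \<delta>, of r] by metis
    define p where "p n = measure (displacement (1 / N n)) {z. \<epsilon> < \<bar>u \<bullet> z\<bar>}" for n
    have step: "\<bar>(1 - charf (1 / N n) (r *\<^sub>R u)) - r\<^sup>2 * (1 - charf (1 / N n) u)\<bar>
        \<le> \<delta> * (1 - charf (1 / N n) u) + (2 + 2 * r\<^sup>2) * p n" for n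
    proof -
      have t: "0 \<le> 1 / N n" using N[of n] by simp
      interpret D: prob_space "displacement (1 / N n)" by (rule prob_space_displacement[OF t])
      let ?D = "displacement (1 / N n)"
      have ic: "integrable ?D (\<lambda>z. cos (v \<bullet> z))" for v
        by (rule displacement_integrable_bounded[OF t, where K=1]) auto
      have ii: "integrable ?D (indicator {z. \<epsilon> < \<bar>u \<bullet> z\<bar>} :: _ \<Rightarrow> real)"
        by (rule displacement_integrable_bounded[OF t, where K=1]) (auto simp: indicator_def)
      have sp: "space ?D = UNIV" by (simp add: displacement_def)
      let ?f = "\<lambda>z. (1 - cos ((r *\<^sub>R u) \<bullet> z)) - r\<^sup>2 * (1 - cos (u \<bullet> z))"
      let ?g = "\<lambda>z. \<delta> * (1 - cos (u \<bullet> z)) + (2 + 2 * r\<^sup>2) * indicator {z. \<epsilon> < \<bar>u \<bullet> z\<bar>} z"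
      have "\<bar>\<integral>z. ?f z \<partial>?D\<bar> \<le> (\<integral>z. ?g z \<partial>?D)"
      proof (rule abs_integral_le)
        show "integrable ?D ?f" using ic[of u] ic[of "r *\<^sub>R u"] by simp
        show "integrable ?D ?g" using ic[of u] ii by simp
        fix z
        show "\<bar>?f z\<bar> \<le> ?g z"
        proof (cases "\<bar>u \<bullet> z\<bar> \<le> \<epsilon>")
          case True
          then show ?thesis using \<epsilon>(2)[of "u \<bullet> z"] by simp
        next
          case False
          have a: "\<bar>1 - cos ((r *\<^sub>R u) \<bullet> z)\<bar> \<le> 2" "\<bar>1 - cos (u \<bullet> z)\<bar> \<le> 2"
            using cos_ge_minus_one[of "(r *\<^sub>R u) \<bullet> z"] cos_le_one[of "(r *\<^sub>R u) \<bullet> z"]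
              cos_ge_minus_one[of "u \<bullet> z"] cos_le_one[of "u \<bullet> z"] by linarith+
          from a(2) have b: "\<bar>r\<^sup>2 * (1 - cos (u \<bullet> z))\<bar> \<le> r\<^sup>2 * 2"
            unfolding abs_mult by (intro mult_mono) auto
          have "0 \<le> \<delta> * (1 - cos (u \<bullet> z))" using \<delta> by simp
          moreover have "\<bar>?f z\<bar> \<le> 2 + r\<^sup>2 * 2" using a(1) b by linarith
          moreover have "?g z = \<delta> * (1 - cos (u \<bullet> z)) + (2 + 2 * r\<^sup>2)" using False by simp
          ultimately show ?thesis by linarith
        qed
      qed
      moreover have "(\<integral>z. ?f z \<partial>?D) = (1 - charf (1 / N n) (r *\<^sub>R u)) - r\<^sup>2 * (1 - charf (1 / N n) u)"
        using ic[of u] ic[of "r *\<^sub>R u"] D.prob_space by (simp add: charf_def)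
      moreover have "(\<integral>z. ?g z \<partial>?D) = \<delta> * (1 - charf (1 / N n) u) + (2 + 2 * r\<^sup>2) * p n"
        using ic[of u] ii D.prob_space by (simp add: charf_def p_def sp)
      ultimately show ?thesis by simp
    qed
    have "\<bar>N n * (1 - charf (1 / N n) (r *\<^sub>R u)) - r\<^sup>2 * (N n * (1 - charf (1 / N n) u))\<bar>
        \<le> \<delta> * (N n * (1 - charf (1 / N n) u)) + (2 + 2 * r\<^sup>2) * (N n * p n)" for n
    proof -
      have "\<bar>N n * ((1 - charf (1 / N n) (r *\<^sub>R u)) - r\<^sup>2 * (1 - charf (1 / N n) u))\<bar>
        \<le> N n * (\<delta> * (1 - charf (1 / N n) u) + (2 + 2 * r\<^sup>2) * p n)"
        unfolding abs_mult using N[of n] by (simp only: abs_of_pos) (intro mult_left_mono step, simp)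
      then show ?thesis by (simp add: algebra_simps)
    qed
    moreover have "(\<lambda>n. \<bar>N n * (1 - charf (1 / N n) (r *\<^sub>R u)) - r\<^sup>2 * (N n * (1 - charf (1 / N n) u))\<bar>)
        \<longlonglongrightarrow> \<bar>exponent (r *\<^sub>R u) - r\<^sup>2 * exponent u\<bar>"
      by (intro tendsto_intros lim)
    moreover have "(\<lambda>n. \<delta> * (N n * (1 - charf (1 / N n) u)) + (2 + 2 * r\<^sup>2) * (N n * p n))
        \<longlonglongrightarrow> \<delta> * exponent u + (2 + 2 * r\<^sup>2) * 0"
      unfolding p_def using large_increments_negligible[OF \<epsilon>(1), of u]
      by (intro tendsto_intros lim) (simp only: N_def)
    ultimately have "\<bar>exponent (r *\<^sub>R u) - r\<^sup>2 * exponent u\<bar> \<le> \<delta> * exponent u + (2 + 2 * r\<^sup>2) * 0"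
      by (intro LIMSEQ_le) auto
    then show ?thesis by simp
  qed
  have "\<bar>exponent (r *\<^sub>R u) - r\<^sup>2 * exponent u\<bar> \<le> 0 + e" if "0 < e" for e
  proof -
    define \<delta> where "\<delta> = e / (exponent u + 1)"
    have "0 < exponent u + 1" using exponent_nonneg[of u] by simp
    then have "0 < \<delta>" "\<delta> * exponent u \<le> e" using that by (simp_all add: \<delta>_def field_simps)
    then show ?thesis using bound[of \<delta>] by simp
  qed
  then have "\<bar>exponent (r *\<^sub>R u) - r\<^sup>2 * exponent u\<bar> \<le> 0" by (rule field_le_epsilon)
  then show ?thesis by simp
qed

text \<open>By isotropy, \<open>exponent u\<close> depends only on the norm of \<open>u\<close>.\<close>

lemma exponent_quadratic: "\<exists>\<kappa>\<ge>0. \<forall>u. exponent u = \<kappa> * (norm u)\<^sup>2"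
proof -
  obtain e :: "real ^ 'n" where e: "norm e = 1" using vector_choose_size[of 1] by auto
  have "exponent u = exponent e * (norm u)\<^sup>2" for u
  proof -
    have "norm (norm u *\<^sub>R e) = norm u" using e by simp
    then obtain U where U: "orthogonal_transformation U" "U (norm u *\<^sub>R e) = u"
      using orthogonal_transformation_exists by metis
    have "u \<bullet> U z = (norm u *\<^sub>R e) \<bullet> z" for z
      using U by (metis orthogonal_transformation_def)
    then have "charf 1 u = charf 1 (norm u *\<^sub>R e)"
      using displacement_orthogonal[OF U(1), of 1 "\<lambda>z. cos (u \<bullet> z)"] by (simp add: charf_def)
    then have "exponent u = exponent (norm u *\<^sub>R e)" by (simp add: exponent_def)
    then show ?thesis by (simp add: exponent_scale mult.commute)
  qed
  then show ?thesis using exponent_nonneg by blast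
qed

text \<open>Half of the variance of a coordinate of \<open>displacement 1\<close>.\<close>

definition \<kappa> :: real where "\<kappa> = (SOME \<kappa>. 0 \<le> \<kappa> \<and> (\<forall>u. exponent u = \<kappa> * (norm u)\<^sup>2))"

lemma \<kappa>_nonneg: "0 \<le> \<kappa>" and exponent_eq: "exponent u = \<kappa> * (norm u)\<^sup>2"
proof -
  have "0 \<le> \<kappa> \<and> (\<forall>u. exponent u = \<kappa> * (norm u)\<^sup>2)"
    unfolding \<kappa>_def by (rule someI_ex) (use exponent_quadratic in blast)
  then show "0 \<le> \<kappa>" "exponent u = \<kappa> * (norm u)\<^sup>2" by blast+
qed

lemma charf_gaussian: "0 \<le> t \<Longrightarrow> charf t u = exp (- (t * \<kappa> * (norm u)\<^sup>2))"
  by (simp add: charf_exponent exponent_eq)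

text \<open>Gives access to the moments of the displacement.  Writing the marginal as an image of the standard normal
  law includes the degenerate case \<open>\<kappa> = 0\<close>.\<close>

lemma displacement_marginal:
  assumes t: "0 \<le> t"
  shows "distr (displacement t) borel (\<lambda>z. u \<bullet> z)
    = distr std_normal_distribution borel (\<lambda>y. sqrt (2 * t * \<kappa>) * norm u * y)"
proof (rule Levy_uniqueness)
  interpret D: prob_space "displacement t" by (rule prob_space_displacement[OF t])
  interpret S: prob_space std_normal_distribution by (rule prob_space_normal_density) simp
  show "real_distribution (distr (displacement t) borel (\<lambda>z. u \<bullet> z))"
    by (rule D.real_distribution_distr) simp
  show "real_distribution (distr std_normal_distribution borel (\<lambda>y. sqrt (2 * t * \<kappa>) * norm u * y))"
    by (rule S.real_distribution_distr) simp
  show "char (distr (displacement t) borel (\<lambda>z. u \<bullet> z))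
      = char (distr std_normal_distribution borel (\<lambda>y. sqrt (2 * t * \<kappa>) * norm u * y))"
  proof
    fix \<theta>
    have i: "integrable (displacement t) (\<lambda>z. iexp (\<theta> * (u \<bullet> z)))"
      by (rule D.integrable_const_bound[where B=1]) auto
    have "Re (\<integral>z. iexp (\<theta> * (u \<bullet> z)) \<partial>displacement t) = charf t (\<theta> *\<^sub>R u)"
      "Im (\<integral>z. iexp (\<theta> * (u \<bullet> z)) \<partial>displacement t) = 0"
      unfolding integral_Re[OF i, symmetric] integral_Im[OF i, symmetric]
      using displacement_sin[OF t, of "\<theta> *\<^sub>R u"] by (simp_all add: charf_def Re_exp Im_exp)
    then have "char (distr (displacement t) borel (\<lambda>z. u \<bullet> z)) \<theta> = complex_of_real (charf t (\<theta> *\<^sub>R u))"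
      unfolding char_def by (subst integral_distr) (auto simp: complex_eq_iff)
    also have "charf t (\<theta> *\<^sub>R u) = exp (- ((\<theta> * (sqrt (2 * t * \<kappa>) * norm u))\<^sup>2) / 2)"
      using t \<kappa>_nonneg by (simp add: charf_gaussian power_mult_distrib)
    also have "complex_of_real \<dots> = char std_normal_distribution (\<theta> * (sqrt (2 * t * \<kappa>) * norm u))"
      by (simp only: char_std_normal_distribution)
    also have "\<dots> = char (distr std_normal_distribution borel (\<lambda>y. sqrt (2 * t * \<kappa>) * norm u * y)) \<theta>"
      unfolding char_def by (subst integral_distr) (auto simp: mult.assoc)
    finally show "char (distr (displacement t) borel (\<lambda>z. u \<bullet> z)) \<theta>
      = char (distr std_normal_distribution borel (\<lambda>y. sqrt (2 * t * \<kappa>) * norm u * y)) \<theta>" .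
  qed
qed

lemma displacement_moment:
  assumes t: "0 \<le> t"
  shows "integrable (displacement t) (\<lambda>z. (u \<bullet> z) ^ k)"
    and "(\<integral>z. (u \<bullet> z) ^ k \<partial>displacement t) = (sqrt (2 * t * \<kappa>) * norm u) ^ k * (\<integral>y. y ^ k \<partial>std_normal_distribution)"
proof -
  have "integrable (distr (displacement t) borel (\<lambda>z. u \<bullet> z)) (\<lambda>y. y ^ k)"
    unfolding displacement_marginal[OF t]
    by (subst integrable_distr_eq) (auto simp: power_mult_distrib intro!: integrable_std_normal_distribution_moment)
  then show "integrable (displacement t) (\<lambda>z. (u \<bullet> z) ^ k)"
    by (subst (asm) integrable_distr_eq) auto
  have "(\<integral>z. (u \<bullet> z) ^ k \<partial>displacement t) = (\<integral>y. y ^ k \<partial>distr (displacement t) borel (\<lambda>z. u \<bullet> z))"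
    by (subst integral_distr) auto
  also have "\<dots> = (sqrt (2 * t * \<kappa>) * norm u) ^ k * (\<integral>y. y ^ k \<partial>std_normal_distribution)"
    unfolding displacement_marginal[OF t] by (subst integral_distr) (auto simp: power_mult_distrib)
  finally show "(\<integral>z. (u \<bullet> z) ^ k \<partial>displacement t) = (sqrt (2 * t * \<kappa>) * norm u) ^ k * (\<integral>y. y ^ k \<partial>std_normal_distribution)" .
qed

lemma displacement_mean: "0 \<le> t \<Longrightarrow> (\<integral>z. u \<bullet> z \<partial>displacement t) = 0"
  using displacement_moment(2)[of t u 1] integral_std_normal_distribution_moment_odd[of 1] by simp

lemma displacement_second_moment: "0 \<le> t \<Longrightarrow> (\<integral>z. (u \<bullet> z)\<^sup>2 \<partial>displacement t) = 2 * \<kappa> * t * (norm u)\<^sup>2"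
  using displacement_moment(2)[of t u 2] std_normal_distribution_even_moments(1)[of 1] \<kappa>_nonneg
  by (simp add: power_mult_distrib)

lemma displacement_fourth_moment: "0 \<le> t \<Longrightarrow> (\<integral>z. (u \<bullet> z) ^ 4 \<partial>displacement t) = 3 * (2 * \<kappa> * t * (norm u)\<^sup>2)\<^sup>2"
  using displacement_moment(2)[of t u 4] std_normal_distribution_even_moments(1)[of 2] \<kappa>_nonneg
  by (simp add: power_mult_distrib fact_numeral power4_eq_xxxx power2_eq_square)

end

section \<open>The covariance tensor and the second moments of the flow\<close>

lemma integrable_mult_squares:
  fixes f g :: "'a \<Rightarrow> real"
  assumes [measurable]: "f \<in> borel_measurable M" "g \<in> borel_measurable M"
    and f: "integrable M (\<lambda>x. (f x)\<^sup>2)" and g: "integrable M (\<lambda>x. (g x)\<^sup>2)"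
  shows "integrable M (\<lambda>x. f x * g x)"
proof (rule Bochner_Integration.integrable_bound[OF Bochner_Integration.integrable_add[OF f g]])
  have "\<bar>a * b\<bar> \<le> a\<^sup>2 + b\<^sup>2" for a b :: real
  proof -
    have "2 * \<bar>a * b\<bar> \<le> a\<^sup>2 + b\<^sup>2"
      using sum_squares_bound[of "\<bar>a\<bar>" "\<bar>b\<bar>"] by (simp add: abs_mult mult.assoc)
    then show ?thesis using abs_ge_zero[of "a * b"] by linarith
  qed
  then show "AE x in M. norm (f x * g x) \<le> norm ((f x)\<^sup>2 + (g x)\<^sup>2)"
    by (intro AE_I2) simp
qed measurable

text \<open>Boundedness in \<open>L\<^sup>2\<close> implies uniform integrability, which turns convergence in probability into
  convergence of expectations.\<close>

lemma (in prob_space) expectation_tendsto_of_L2_bounded: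
  fixes R :: "nat \<Rightarrow> 'a \<Rightarrow> real"
  assumes R [measurable]: "\<And>m. R m \<in> borel_measurable M"
    and L2: "\<And>m. integrable M (\<lambda>\<omega>. (R m \<omega>)\<^sup>2)" "\<And>m. expectation (\<lambda>\<omega>. (R m \<omega>)\<^sup>2) \<le> K"
    and conv: "\<And>\<eta>. 0 < \<eta> \<Longrightarrow> (\<lambda>m. prob {\<omega> \<in> space M. \<eta> < \<bar>R m \<omega> - c\<bar>}) \<longlonglongrightarrow> 0"
  shows "(\<lambda>m. expectation (R m)) \<longlonglongrightarrow> c"
proof -
  have int: "integrable M (R m)" for m
    using integrable_mult_squares[of "R m" M "\<lambda>_. 1"] L2(1)[of m] by simp
  have sq: "(R m \<omega> - c)\<^sup>2 \<le> 2 * (R m \<omega>)\<^sup>2 + 2 * c\<^sup>2" for m \<omega>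
    using square_sum_le[of "R m \<omega>" "- c"] by simp
  have int2: "integrable M (\<lambda>\<omega>. (R m \<omega> - c)\<^sup>2)" for m
    unfolding power2_diff using L2(1)[of m] int[of m] by simp
  define K' where "K' = 2 * K + 2 * c\<^sup>2"
  have "0 \<le> K" using L2(2)[of 0] by (rule order_trans[rotated]) simp
  then have K': "0 \<le> K'" by (simp add: K'_def)
  have E2: "expectation (\<lambda>\<omega>. (R m \<omega> - c)\<^sup>2) \<le> K'" for m
  proof -
    have "expectation (\<lambda>\<omega>. (R m \<omega> - c)\<^sup>2) \<le> expectation (\<lambda>\<omega>. 2 * (R m \<omega>)\<^sup>2 + 2 * c\<^sup>2)"
      by (rule integral_mono[OF int2 _ sq]) (use L2(1) in simp)
    also have "\<dots> = 2 * expectation (\<lambda>\<omega>. (R m \<omega>)\<^sup>2) + 2 * c\<^sup>2"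
      using L2(1)[of m] by (simp add: prob_space)
    finally show ?thesis using L2(2)[of m] by (simp add: K'_def)
  qed
  \<comment> \<open>If \<open>a \<le> \<eta>\<close> there is nothing to show, and otherwise \<open>a \<le> L + a\<^sup>2 / L\<close>, for \<open>a = |R m - c|\<close>.\<close>
  have bound: "\<bar>expectation (R m) - c\<bar> \<le> \<eta> + L * prob {\<omega> \<in> space M. \<eta> < \<bar>R m \<omega> - c\<bar>} + K' / L"
    if "0 < \<eta>" "0 < L" for m \<eta> L
  proof -
    let ?S = "{\<omega> \<in> space M. \<eta> < \<bar>R m \<omega> - c\<bar>}"
    have "\<bar>expectation (\<lambda>\<omega>. R m \<omega> - c)\<bar> \<le> expectation (\<lambda>\<omega>. \<eta> + L * indicator ?S \<omega> + (R m \<omega> - c)\<^sup>2 / L)"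
    proof (rule abs_integral_le)
      show "integrable M (\<lambda>\<omega>. R m \<omega> - c)" using int by simp
      show "integrable M (\<lambda>\<omega>. \<eta> + L * indicator ?S \<omega> + (R m \<omega> - c)\<^sup>2 / L)"
        using int2[of m] by (intro Bochner_Integration.integrable_add) (auto simp: emeasure_eq_measure)
      fix \<omega> assume w: "\<omega> \<in> space M"
      show "\<bar>R m \<omega> - c\<bar> \<le> \<eta> + L * indicator ?S \<omega> + (R m \<omega> - c)\<^sup>2 / L"
      proof (cases "\<eta> < \<bar>R m \<omega> - c\<bar>")
        case False
        then have "\<bar>R m \<omega> - c\<bar> \<le> \<eta>" by simp
        moreover have "0 \<le> (R m \<omega> - c)\<^sup>2 / L" using that by simp
        moreover have "indicator ?S \<omega> = (0::real)" using False by simp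
        ultimately show ?thesis by simp
      next
        case True
        define a where "a = \<bar>R m \<omega> - c\<bar>"
        have "0 \<le> (a - L)\<^sup>2 + a * L" using that by (simp add: a_def)
        then have "a * L \<le> L\<^sup>2 + a\<^sup>2" by (simp add: power2_eq_square algebra_simps)
        then have "a \<le> (L\<^sup>2 + a\<^sup>2) / L" using that by (simp add: pos_le_divide_eq)
        also have "\<dots> = L + a\<^sup>2 / L" using that by (simp add: add_divide_distrib power2_eq_square)
        finally have "a \<le> L + (R m \<omega> - c)\<^sup>2 / L" by (simp add: a_def)
        then show ?thesis using True w that by (simp add: a_def)
      qed
    qed
    also have "\<dots> = \<eta> + L * prob ?S + expectation (\<lambda>\<omega>. (R m \<omega> - c)\<^sup>2) / L"
      using int2[of m] by (simp add: prob_space emeasure_eq_measure)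
    also have "\<dots> \<le> \<eta> + L * prob ?S + K' / L" using E2[of m] that by (simp add: divide_right_mono)
    finally show ?thesis using int[of m] by (simp add: prob_space)
  qed
  show ?thesis
  proof (rule LIM_zero_cancel, rule LIMSEQ_I)
    fix e :: real assume e: "0 < e"
    define L where "L = 4 * (K' + 1) / e"
    have L: "0 < L" "K' / L \<le> e / 4" using e K' by (simp_all add: L_def field_simps)
    have "(\<lambda>m. L * prob {\<omega> \<in> space M. e / 4 < \<bar>R m \<omega> - c\<bar>}) \<longlonglongrightarrow> L * 0"
      by (intro tendsto_intros conv) (use e in simp)
    then have "eventually (\<lambda>m. L * prob {\<omega> \<in> space M. e / 4 < \<bar>R m \<omega> - c\<bar>} < e / 4) sequentially"
      by (rule order_tendstoD) (use e in simp)
    then have "eventually (\<lambda>m. norm (expectation (R m) - c - 0) < e) sequentially"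
    proof eventually_elim
      case (elim m)
      have "e / 4 > 0" using e by simp
      have "\<bar>expectation (R m) - c\<bar> < e" using bound[OF \<open>e / 4 > 0\<close> L(1), of m] elim L(2) e by linarith
      then show ?case by simp
    qed
    then show "\<exists>no. \<forall>m\<ge>no. norm (expectation (R m) - c - 0) < e"
      by (simp add: eventually_sequentially)
  qed
qed

context isotropic_Brownian_flow
begin

lemma increment_law:
  assumes st: "0 \<le> s" "s \<le> t"
  shows "distr M borel (\<lambda>\<omega>. \<phi> 0 t \<omega> x - \<phi> 0 s \<omega> x) = displacement (t - s)"
proof (rule measure_eqI)
  have m: "(\<lambda>\<omega>. \<phi> 0 s \<omega> x) \<in> borel_measurable M" "(\<lambda>\<omega>. \<phi> 0 t \<omega> x) \<in> borel_measurable M"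
    using st by (auto intro!: flow_measurable)
  note [measurable] = m
  interpret D: prob_space "displacement (t - s)" by (rule prob_space_displacement) (use st in simp)
  have spD: "space (displacement (t - s)) = UNIV" by (simp add: displacement_def)
  interpret L: prob_space "distr M borel (\<lambda>\<omega>. \<phi> 0 t \<omega> x - \<phi> 0 s \<omega> x)"
    by (rule prob_space_distr) measurable
  show "sets (distr M borel (\<lambda>\<omega>. \<phi> 0 t \<omega> x - \<phi> 0 s \<omega> x)) = sets (displacement (t - s))" by simp
  fix A assume "A \<in> sets (distr M borel (\<lambda>\<omega>. \<phi> 0 t \<omega> x - \<phi> 0 s \<omega> x))"
  then have A [measurable]: "A \<in> sets borel" by simp
  let ?f = "indicator A :: real ^ 'n \<Rightarrow> real"
  have int: "integrable M (\<lambda>\<omega>. 1 * ?f (\<phi> 0 t \<omega> x - \<phi> 0 s \<omega> x))"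
    by (rule integrable_const_bound[where B=1]) (auto simp: indicator_def)
  have "(\<integral>\<omega>. 1 * ?f (\<phi> 0 t \<omega> x - \<phi> 0 s \<omega> x) \<partial>M) = (\<integral>\<omega>. 1 \<partial>M) * (\<integral>z. ?f z \<partial>displacement (t - s))"
    by (rule later_increment_independent[OF st _ _ int]) measurable
  then have "(\<integral>\<omega>. ?f (\<phi> 0 t \<omega> x - \<phi> 0 s \<omega> x) \<partial>M) = D.prob A"
    by (simp add: prob_space spD)
  moreover have "(\<integral>\<omega>. ?f (\<phi> 0 t \<omega> x - \<phi> 0 s \<omega> x) \<partial>M) = L.prob A"
    by (subst integral_distr[symmetric, where N=borel]) auto
  ultimately show "emeasure (distr M borel (\<lambda>\<omega>. \<phi> 0 t \<omega> x - \<phi> 0 s \<omega> x)) A = emeasure (displacement (t - s)) A"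
    by (simp add: D.emeasure_eq_measure L.emeasure_eq_measure)
qed

lemma
  assumes st: "0 \<le> s" "s \<le> t"
  shows increment_integrable: "integrable M (\<lambda>\<omega>. (u \<bullet> (\<phi> 0 t \<omega> x - \<phi> 0 s \<omega> x)) ^ k)"
    and increment_moment: "(\<integral>\<omega>. (u \<bullet> (\<phi> 0 t \<omega> x - \<phi> 0 s \<omega> x)) ^ k \<partial>M) = (\<integral>z. (u \<bullet> z) ^ k \<partial>displacement (t - s))"
proof -
  have m: "(\<lambda>\<omega>. \<phi> 0 s \<omega> x) \<in> borel_measurable M" "(\<lambda>\<omega>. \<phi> 0 t \<omega> x) \<in> borel_measurable M"
    using st by (auto intro!: flow_measurable)
  note [measurable] = m
  have ts: "0 \<le> t - s" using st by simp
  have "integrable (distr M borel (\<lambda>\<omega>. \<phi> 0 t \<omega> x - \<phi> 0 s \<omega> x)) (\<lambda>z. (u \<bullet> z) ^ k)"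
    unfolding increment_law[OF st] by (rule displacement_moment(1)[OF ts])
  then show "integrable M (\<lambda>\<omega>. (u \<bullet> (\<phi> 0 t \<omega> x - \<phi> 0 s \<omega> x)) ^ k)"
    by (subst (asm) integrable_distr_eq) auto
  show "(\<integral>\<omega>. (u \<bullet> (\<phi> 0 t \<omega> x - \<phi> 0 s \<omega> x)) ^ k \<partial>M) = (\<integral>z. (u \<bullet> z) ^ k \<partial>displacement (t - s))"
    unfolding increment_law[OF st, of x, symmetric] by (subst integral_distr) auto
qed

lemma
  assumes t: "0 \<le> t"
  shows motion_integrable: "integrable M (\<lambda>\<omega>. (u \<bullet> (\<phi> 0 t \<omega> x - x)) ^ k)"
    and motion_moment: "(\<integral>\<omega>. (u \<bullet> (\<phi> 0 t \<omega> x - x)) ^ k \<partial>M) = (\<integral>z. (u \<bullet> z) ^ k \<partial>displacement t)"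
  using one_point_expectation[of 0 t "\<lambda>z. (u \<bullet> z) ^ k" x] displacement_moment(1)[OF t, of u k] t by simp_all

definition cross_moment :: "real \<Rightarrow> real ^ 'n \<Rightarrow> real ^ 'n \<Rightarrow> real ^ 'n \<Rightarrow> real" where
  "cross_moment t u x v = (\<integral>\<omega>. (u \<bullet> (\<phi> 0 t \<omega> x - x)) * (v \<bullet> \<phi> 0 t \<omega> 0) \<partial>M)"

lemma motion_measurable: "0 \<le> t \<Longrightarrow> (\<lambda>\<omega>. \<phi> 0 t \<omega> x) \<in> borel_measurable M"
  by (rule flow_measurable) auto

lemma integrable_cross: "0 \<le> t \<Longrightarrow> integrable M (\<lambda>\<omega>. (u \<bullet> (\<phi> 0 t \<omega> x - x)) * (v \<bullet> \<phi> 0 t \<omega> 0))"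
  using motion_integrable[of t u x 2] motion_integrable[of t v 0 2] motion_measurable[of t x] motion_measurable[of t 0]
  by (intro integrable_mult_squares) auto

lemma cross_moment_0: "cross_moment 0 u x v = 0"
proof -
  have "(\<integral>\<omega>. (u \<bullet> (\<phi> 0 0 \<omega> x - x)) * (v \<bullet> \<phi> 0 0 \<omega> 0) \<partial>M) = (\<integral>\<omega>. 0 \<partial>M)"
  proof (rule integral_cong_AE)
    show "AE \<omega> in M. (u \<bullet> (\<phi> 0 0 \<omega> x - x)) * (v \<bullet> \<phi> 0 0 \<omega> 0) = 0"
      using AE_flow_id by eventually_elim simp
  qed (use motion_measurable[of 0 x] motion_measurable[of 0 0] in auto)
  then show ?thesis by (simp add: cross_moment_def)
qed

text \<open>An increment over \<open>[s,t]\<close> has mean \<open>0\<close> and is independent of the positions at time \<open>s\<close>, so the two mixed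
  terms in the expansion of the product vanish.\<close>

lemma cross_moment_increment:
  assumes st: "0 \<le> s" "s \<le> t"
  shows "integrable M (\<lambda>\<omega>. (u \<bullet> (\<phi> 0 t \<omega> x - \<phi> 0 s \<omega> x)) * (v \<bullet> (\<phi> 0 t \<omega> 0 - \<phi> 0 s \<omega> 0)))"
    and "(\<integral>\<omega>. (u \<bullet> (\<phi> 0 t \<omega> x - \<phi> 0 s \<omega> x)) * (v \<bullet> (\<phi> 0 t \<omega> 0 - \<phi> 0 s \<omega> 0)) \<partial>M)
      = cross_moment t u x v - cross_moment s u x v"
proof -
  have t: "0 \<le> t" using st by simp
  have m: "(\<lambda>\<omega>. \<phi> 0 s \<omega> z) \<in> borel_measurable M" "(\<lambda>\<omega>. \<phi> 0 t \<omega> z) \<in> borel_measurable M" for z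
    using st by (auto intro!: flow_measurable)
  note [measurable] = m
  let ?A = "\<lambda>\<omega>. u \<bullet> (\<phi> 0 s \<omega> x - x)" and ?B = "\<lambda>\<omega>. v \<bullet> \<phi> 0 s \<omega> 0"
  let ?dA = "\<lambda>\<omega>. u \<bullet> (\<phi> 0 t \<omega> x - \<phi> 0 s \<omega> x)" and ?dB = "\<lambda>\<omega>. v \<bullet> (\<phi> 0 t \<omega> 0 - \<phi> 0 s \<omega> 0)"
  note sq = motion_integrable[OF st(1), of u x 2] motion_integrable[OF st(1), of v 0 2]
    increment_integrable[OF st, of u x 2] increment_integrable[OF st, of v 0 2]
  show i1: "integrable M (\<lambda>\<omega>. ?dA \<omega> * ?dB \<omega>)" using sq by (intro integrable_mult_squares) auto
  have i2: "integrable M (\<lambda>\<omega>. ?A \<omega> * ?dB \<omega>)" using sq by (intro integrable_mult_squares) auto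
  have i3: "integrable M (\<lambda>\<omega>. ?B \<omega> * ?dA \<omega>)" using sq by (intro integrable_mult_squares) auto
  have i4: "integrable M (\<lambda>\<omega>. ?A \<omega> * ?B \<omega>)" using sq by (intro integrable_mult_squares) auto
  have ts: "0 \<le> t - s" using st by simp
  have z1: "(\<integral>\<omega>. ?A \<omega> * ?dB \<omega> \<partial>M) = 0"
    using later_increment_independent[OF st, of "\<lambda>z. v \<bullet> z" "\<lambda>z. u \<bullet> (z - x)" x 0] i2 displacement_mean[OF ts, of v] by simp
  have z2: "(\<integral>\<omega>. ?B \<omega> * ?dA \<omega> \<partial>M) = 0"
    using later_increment_independent[OF st, of "\<lambda>z. u \<bullet> z" "\<lambda>z. v \<bullet> z" 0 x] i3 displacement_mean[OF ts, of u] by simp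
  have "(u \<bullet> (\<phi> 0 t \<omega> x - x)) * (v \<bullet> \<phi> 0 t \<omega> 0) = ?A \<omega> * ?B \<omega> + ?A \<omega> * ?dB \<omega> + ?B \<omega> * ?dA \<omega> + ?dA \<omega> * ?dB \<omega>" for \<omega>
    by (simp add: inner_diff_right algebra_simps)
  then have "cross_moment t u x v = (\<integral>\<omega>. ?A \<omega> * ?B \<omega> + ?A \<omega> * ?dB \<omega> + ?B \<omega> * ?dA \<omega> + ?dA \<omega> * ?dB \<omega> \<partial>M)"
    unfolding cross_moment_def by (simp only:)
  also have "\<dots> = (\<integral>\<omega>. ?A \<omega> * ?B \<omega> \<partial>M) + (\<integral>\<omega>. ?A \<omega> * ?dB \<omega> \<partial>M) + (\<integral>\<omega>. ?B \<omega> * ?dA \<omega> \<partial>M) + (\<integral>\<omega>. ?dA \<omega> * ?dB \<omega> \<partial>M)"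
    by (simp only: Bochner_Integration.integral_add i1 i2 i3 i4 Bochner_Integration.integrable_add)
  finally show "(\<integral>\<omega>. ?dA \<omega> * ?dB \<omega> \<partial>M) = cross_moment t u x v - cross_moment s u x v"
    unfolding z1 z2 cross_moment_def by simp
qed

text \<open>By telescoping, the expectation of the Riemann sum for the covariation does not depend on the partition.
  Its second moment is bounded through the fourth moments of the single increments,
  with the Cauchy-Schwarz inequality \<open>(\<Sum>k<n. y\<^sub>k)\<^sup>2 \<le> n (\<Sum>k<n. y\<^sub>k\<^sup>2)\<close>; the factor \<open>n\<close> is
  compensated since each fourth moment is of order \<open>1 / n\<^sup>2\<close>.\<close>

lemma increment_products:
  fixes x :: "real ^ 'n" and d :: real and n :: nat
  assumes d: "0 \<le> d" and u: "norm u = 1" and v: "norm v = 1"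
  defines "a \<equiv> \<lambda>k \<omega>. u \<bullet> (\<phi> 0 (real (Suc k) * d) \<omega> x - \<phi> 0 (real k * d) \<omega> x)"
    and "c \<equiv> \<lambda>k \<omega>. v \<bullet> (\<phi> 0 (real (Suc k) * d) \<omega> 0 - \<phi> 0 (real k * d) \<omega> 0)"
  shows "(\<lambda>\<omega>. \<Sum>k<n. a k \<omega> * c k \<omega>) \<in> borel_measurable M"
    and "(\<integral>\<omega>. (\<Sum>k<n. a k \<omega> * c k \<omega>) \<partial>M) = cross_moment (real n * d) u x v"
    and "integrable M (\<lambda>\<omega>. (\<Sum>k<n. a k \<omega> * c k \<omega>)\<^sup>2)"
    and "(\<integral>\<omega>. (\<Sum>k<n. a k \<omega> * c k \<omega>)\<^sup>2 \<partial>M) \<le> 3 * (2 * \<kappa> * (real n * d))\<^sup>2"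
proof -
  have kd: "0 \<le> real k * d" "real k * d \<le> real (Suc k) * d" "real (Suc k) * d - real k * d = d" for k
    using d by (auto simp: distrib_right)
  have m: "(\<lambda>\<omega>. \<phi> 0 (real k * d) \<omega> z) \<in> borel_measurable M" for z k
    by (rule motion_measurable[OF kd(1)])
  note [measurable] = m
  have ac [measurable]: "a k \<in> borel_measurable M" "c k \<in> borel_measurable M" for k unfolding a_def c_def by measurable
  show meas: "(\<lambda>\<omega>. \<Sum>k<n. a k \<omega> * c k \<omega>) \<in> borel_measurable M" by measurable
  have i: "integrable M (\<lambda>\<omega>. a k \<omega> * c k \<omega>)" for k
    unfolding a_def c_def by (rule cross_moment_increment(1)[OF kd(1,2)])
  have "(\<integral>\<omega>. (\<Sum>k<n. a k \<omega> * c k \<omega>) \<partial>M) = (\<Sum>k<n. cross_moment (real (Suc k) * d) u x v - cross_moment (real k * d) u x v)"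
    unfolding Bochner_Integration.integral_sum[OF i] unfolding a_def c_def cross_moment_increment(2)[OF kd(1,2)] ..
  also have "\<dots> = cross_moment (real n * d) u x v"
    by (subst sum_lessThan_telescope) (simp add: cross_moment_0)
  finally show "(\<integral>\<omega>. (\<Sum>k<n. a k \<omega> * c k \<omega>) \<partial>M) = cross_moment (real n * d) u x v" .
  have i4: "integrable M (\<lambda>\<omega>. (a k \<omega>) ^ 4)" "integrable M (\<lambda>\<omega>. (c k \<omega>) ^ 4)" for k
    unfolding a_def c_def by (rule increment_integrable[OF kd(1,2)])+
  have e4: "(\<integral>\<omega>. (a k \<omega>) ^ 4 \<partial>M) = 3 * (2 * \<kappa> * d)\<^sup>2" "(\<integral>\<omega>. (c k \<omega>) ^ 4 \<partial>M) = 3 * (2 * \<kappa> * d)\<^sup>2" for k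
    unfolding a_def c_def increment_moment[OF kd(1,2)] kd(3) by (simp_all only: displacement_fourth_moment[OF d] u v) simp_all
  let ?D = "\<lambda>\<omega>. (\<Sum>k<n. ((a k \<omega>) ^ 4 + (c k \<omega>) ^ 4) / 2) * real n"
  have le: "(\<Sum>k<n. a k \<omega> * c k \<omega>)\<^sup>2 \<le> ?D \<omega>" for \<omega>
  proof -
    have "(\<Sum>k<n. a k \<omega> * c k \<omega>)\<^sup>2 \<le> (\<Sum>k<n. (a k \<omega> * c k \<omega>)\<^sup>2) * real (card {..<n})"
      by (rule sum_squared_le_sum_of_squares)
    also have "\<dots> \<le> ?D \<omega>"
    proof -
      have "(y * z)\<^sup>2 \<le> (y ^ 4 + z ^ 4) / 2" for y z :: real
        using sum_squares_bound[of "y\<^sup>2" "z\<^sup>2"] by (simp add: power_mult_distrib flip: power_mult)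
      then show ?thesis by (simp only: card_lessThan) (intro mult_right_mono sum_mono, auto)
    qed
    finally show ?thesis .
  qed
  have iD: "integrable M ?D"
    by (intro integrable_mult_left Bochner_Integration.integrable_sum Bochner_Integration.integrable_divide Bochner_Integration.integrable_add i4)
  show int: "integrable M (\<lambda>\<omega>. (\<Sum>k<n. a k \<omega> * c k \<omega>)\<^sup>2)"
  proof (rule Bochner_Integration.integrable_bound[OF iD])
    show "AE \<omega> in M. norm ((\<Sum>k<n. a k \<omega> * c k \<omega>)\<^sup>2) \<le> norm (?D \<omega>)"
      using le by (intro AE_I2) (auto intro: order_trans[OF _ abs_ge_self])
  qed measurable
  have "(\<integral>\<omega>. (\<Sum>k<n. a k \<omega> * c k \<omega>)\<^sup>2 \<partial>M) \<le> (\<integral>\<omega>. ?D \<omega> \<partial>M)"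
    by (rule integral_mono[OF int iD le])
  also have "\<dots> = 3 * (2 * \<kappa> * (real n * d))\<^sup>2"
    using i4 by (simp add: Bochner_Integration.integral_sum e4 power2_eq_square)
  finally show "(\<integral>\<omega>. (\<Sum>k<n. a k \<omega> * c k \<omega>)\<^sup>2 \<partial>M) \<le> 3 * (2 * \<kappa> * (real n * d))\<^sup>2" .
qed

text \<open>The partition of \<open>[0,0]\<close> without any interval has the Riemann sum \<open>0\<close>.\<close>

lemma covariation_zero:
  assumes C: "is_covariation M X Y C"
  shows "AE \<omega> in M. C 0 \<omega> = 0"
proof -
  have [measurable]: "C 0 \<in> borel_measurable M" using C by (simp add: is_covariation_def)
  have small: "prob {\<omega> \<in> space M. \<epsilon> < \<bar>C 0 \<omega>\<bar>} < \<epsilon>" if eps: "0 < \<epsilon>" for \<epsilon>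
  proof -
    have "\<forall>\<epsilon>>0. \<exists>\<delta>>0. \<forall>(n::nat) \<tau>.
      \<tau> 0 = 0 \<and> \<tau> n = 0 \<and> (\<forall>k<n. \<tau> k \<le> \<tau> (Suc k) \<and> \<tau> (Suc k) - \<tau> k < \<delta>) \<longrightarrow>
      prob {\<omega> \<in> space M.
        \<epsilon> < \<bar>(\<Sum>k<n. (X (\<tau> (Suc k)) \<omega> - X (\<tau> k) \<omega>) * (Y (\<tau> (Suc k)) \<omega> - Y (\<tau> k) \<omega>)) - C 0 \<omega>\<bar>} < \<epsilon>"
      using C unfolding is_covariation_def by blast
    then obtain \<delta> where "\<And>(n::nat) \<tau>.
      \<tau> 0 = 0 \<and> \<tau> n = 0 \<and> (\<forall>k<n. \<tau> k \<le> \<tau> (Suc k) \<and> \<tau> (Suc k) - \<tau> k < \<delta>) \<Longrightarrow>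
      prob {\<omega> \<in> space M.
        \<epsilon> < \<bar>(\<Sum>k<n. (X (\<tau> (Suc k)) \<omega> - X (\<tau> k) \<omega>) * (Y (\<tau> (Suc k)) \<omega> - Y (\<tau> k) \<omega>)) - C 0 \<omega>\<bar>} < \<epsilon>"
      using eps by meson
    from this[of "\<lambda>_. 0" 0] have "prob {\<omega> \<in> space M. \<epsilon> < \<bar>(\<Sum>k<(0::nat). (X 0 \<omega> - X 0 \<omega>) * (Y 0 \<omega> - Y 0 \<omega>)) - C 0 \<omega>\<bar>} < \<epsilon>"
      by simp
    then show ?thesis by simp
  qed
  have "prob {\<omega> \<in> space M. \<eta> < \<bar>C 0 \<omega>\<bar>} = 0" if "0 < \<eta>" for \<eta>
  proof (rule ccontr)
    let ?q = "prob {\<omega> \<in> space M. \<eta> < \<bar>C 0 \<omega>\<bar>}"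
    assume "?q \<noteq> 0"
    then have q: "0 < ?q" by (simp add: zero_less_measure_iff)
    define \<epsilon> where "\<epsilon> = min \<eta> ?q"
    have "?q \<le> prob {\<omega> \<in> space M. \<epsilon> < \<bar>C 0 \<omega>\<bar>}"
      by (rule finite_measure_mono) (auto simp: \<epsilon>_def)
    also have "\<dots> < \<epsilon>" by (rule small) (use q that in \<open>simp add: \<epsilon>_def\<close>)
    finally show False by (simp add: \<epsilon>_def)
  qed
  then have "AE \<omega> in M. \<not> 1 / real (Suc n) < \<bar>C 0 \<omega>\<bar>" for n
    by (intro AE_I[where N="{\<omega> \<in> space M. 1 / real (Suc n) < \<bar>C 0 \<omega>\<bar>}"]) (auto simp: emeasure_eq_measure simp del: of_nat_Suc)
  then have "AE \<omega> in M. \<forall>n. \<not> 1 / real (Suc n) < \<bar>C 0 \<omega>\<bar>"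
    by (simp add: AE_all_countable)
  then show ?thesis
  proof eventually_elim
    case (elim \<omega>)
    have "\<bar>C 0 \<omega>\<bar> \<le> 0"
    proof (rule LIMSEQ_le_const)
      show "(\<lambda>n. 1 / real (Suc n)) \<longlonglongrightarrow> 0" by real_asymp
    qed (use elim in \<open>auto simp: not_less\<close>)
    then show ?case by simp
  qed
qed

text \<open>For each \<open>h\<close> choose a partition of \<open>[0,h]\<close> whose Riemann sum is close to the covariation \<open>C h\<close>.
  Its expectation is the mixed moment.  Divided by \<open>h\<close>, the sums are bounded in \<open>L\<^sup>2\<close>, and they converge in
  probability to the derivative of \<open>C\<close> at \<open>0\<close>.\<close>

lemma cross_moment_tensor:
  assumes tensor: "is_covariance_tensor M \<phi> b"
  shows "((\<lambda>h. cross_moment h (axis i 1) x (axis j 1) / h) \<longlongrightarrow> b x $ i $ j) (at_right 0)"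
proof (rule tendsto_at_right_sequentially[where b=1])
  fix h :: "nat \<Rightarrow> real" assume h: "\<And>m. 0 < h m" "h \<longlonglongrightarrow> 0"
  let ?X = "\<lambda>t \<omega>. \<phi> 0 t \<omega> x $ i" and ?Y = "\<lambda>t \<omega>. \<phi> 0 t \<omega> 0 $ j"
  define c where "c = b x $ i $ j"
  obtain C where C: "is_covariation M ?X ?Y C"
    and dC: "AE \<omega> in M. ((\<lambda>t. C t \<omega>) has_real_derivative c) (at 0 within {0..})"
    using tensor unfolding is_covariance_tensor_def c_def by blast
  have Cm: "C (h m) \<in> borel_measurable M" for m
    using C h(1)[of m] less_imp_le unfolding is_covariation_def by blast
  note [measurable] = Cm
  \<comment> \<open>The tolerance \<open>h\<^sup>2\<close> leaves an error \<open>h\<close> after division by \<open>h\<close>.\<close>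
  define Q where "Q m n = prob {\<omega> \<in> space M. (h m)\<^sup>2 < \<bar>(\<Sum>k<n. (?X (real (Suc k) * (h m / real n)) \<omega> - ?X (real k * (h m / real n)) \<omega>)
      * (?Y (real (Suc k) * (h m / real n)) \<omega> - ?Y (real k * (h m / real n)) \<omega>)) - C (h m) \<omega>\<bar>}" for m n
  have part: "\<exists>n>0. Q m n < (h m)\<^sup>2" for m
  proof -
    have "\<forall>t\<ge>0. \<forall>\<epsilon>>0. \<exists>\<delta>>0. \<forall>(n::nat) \<tau>.
      \<tau> 0 = 0 \<and> \<tau> n = t \<and> (\<forall>k<n. \<tau> k \<le> \<tau> (Suc k) \<and> \<tau> (Suc k) - \<tau> k < \<delta>) \<longrightarrow>
      prob {\<omega> \<in> space M.
        \<epsilon> < \<bar>(\<Sum>k<n. (?X (\<tau> (Suc k)) \<omega> - ?X (\<tau> k) \<omega>) * (?Y (\<tau> (Suc k)) \<omega> - ?Y (\<tau> k) \<omega>)) - C t \<omega>\<bar>} < \<epsilon>"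
      using C unfolding is_covariation_def by blast
    moreover have "0 \<le> h m" "0 < (h m)\<^sup>2" using h(1)[of m] by auto
    ultimately obtain \<delta> where \<delta>: "0 < \<delta>" "\<And>(n::nat) \<tau>.
      \<tau> 0 = 0 \<and> \<tau> n = h m \<and> (\<forall>k<n. \<tau> k \<le> \<tau> (Suc k) \<and> \<tau> (Suc k) - \<tau> k < \<delta>) \<Longrightarrow>
      prob {\<omega> \<in> space M.
        (h m)\<^sup>2 < \<bar>(\<Sum>k<n. (?X (\<tau> (Suc k)) \<omega> - ?X (\<tau> k) \<omega>) * (?Y (\<tau> (Suc k)) \<omega> - ?Y (\<tau> k) \<omega>)) - C (h m) \<omega>\<bar>} < (h m)\<^sup>2"
      by meson
    obtain n :: nat where n: "h m / \<delta> < real n" using reals_Archimedean2 by blast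
    moreover have "0 < h m / \<delta>" using h(1)[of m] \<delta>(1) by simp
    ultimately have n0: "0 < real n" by linarith
    have nd: "h m / real n < \<delta>" using n n0 \<delta>(1) by (simp add: field_simps)
    define e where "e = h m / real n"
    have e: "0 \<le> e" "e < \<delta>" "real n * e = h m" using h(1)[of m] n0 nd by (auto simp: e_def)
    have mono: "real k * e \<le> real (Suc k) * e" "real (Suc k) * e - real k * e = e" for k
      using e(1) by (auto simp: distrib_right)
    have "real 0 * e = 0 \<and> real n * e = h m \<and> (\<forall>k<n. real k * e \<le> real (Suc k) * e \<and> real (Suc k) * e - real k * e < \<delta>)"
      using e mono by (simp del: of_nat_Suc)
    note P = \<delta>(2)[of "\<lambda>k. real k * e" n, OF this, unfolded e_def]
    show ?thesis using n0 P by (intro exI[of _ n] conjI) (simp_all only: of_nat_0_less_iff Q_def)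
  qed
  then obtain n where n: "\<And>m. 0 < n m" "\<And>m. Q m (n m) < (h m)\<^sup>2"
    by metis
  define S where "S m \<omega> = (\<Sum>k<n m. (axis i 1 \<bullet> (\<phi> 0 (real (Suc k) * (h m / real (n m))) \<omega> x - \<phi> 0 (real k * (h m / real (n m))) \<omega> x))
      * (axis j 1 \<bullet> (\<phi> 0 (real (Suc k) * (h m / real (n m))) \<omega> 0 - \<phi> 0 (real k * (h m / real (n m))) \<omega> 0)))" for m \<omega>
  have Sn: "prob {\<omega> \<in> space M. (h m)\<^sup>2 < \<bar>S m \<omega> - C (h m) \<omega>\<bar>} < (h m)\<^sup>2" for m
    using n(2)[of m] unfolding S_def Q_def by (simp add: inner_axis' del: of_nat_Suc)
  have nh: "real (n m) * (h m / real (n m)) = h m" "0 \<le> h m / real (n m)" for m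
    using n(1)[of m] h(1)[of m] by auto
  have ax: "norm (axis i (1::real)) = 1" for i :: 'n by simp
  have Sm: "S m \<in> borel_measurable M"
    and ES: "(\<integral>\<omega>. S m \<omega> \<partial>M) = cross_moment (h m) (axis i 1) x (axis j 1)"
    and IS: "integrable M (\<lambda>\<omega>. (S m \<omega>)\<^sup>2)"
    and ES2: "(\<integral>\<omega>. (S m \<omega>)\<^sup>2 \<partial>M) \<le> 3 * (2 * \<kappa> * h m)\<^sup>2" for m
    using increment_products[OF nh(2)[of m] ax[of i] ax[of j], where x=x and n="n m"]
    unfolding nh(1)[of m] S_def by - (assumption+)
  note [measurable] = Sm
  have "(\<lambda>m. expectation (\<lambda>\<omega>. S m \<omega> / h m)) \<longlonglongrightarrow> c"
  proof (rule expectation_tendsto_of_L2_bounded[where K="3 * (2 * \<kappa>)\<^sup>2"])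
    show "(\<lambda>\<omega>. S m \<omega> / h m) \<in> borel_measurable M" for m by measurable
    show "integrable M (\<lambda>\<omega>. (S m \<omega> / h m)\<^sup>2)" for m using IS[of m] by (simp add: power_divide)
    show "expectation (\<lambda>\<omega>. (S m \<omega> / h m)\<^sup>2) \<le> 3 * (2 * \<kappa>)\<^sup>2" for m
    proof -
      have "expectation (\<lambda>\<omega>. (S m \<omega> / h m)\<^sup>2) = expectation (\<lambda>\<omega>. (S m \<omega>)\<^sup>2) / (h m)\<^sup>2" by (simp add: power_divide)
      also have "\<dots> \<le> 3 * (2 * \<kappa> * h m)\<^sup>2 / (h m)\<^sup>2" by (rule divide_right_mono[OF ES2]) simp
      also have "\<dots> = 3 * (2 * \<kappa>)\<^sup>2" using h(1)[of m] by (simp add: power_mult_distrib)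
      finally show ?thesis .
    qed
    fix \<eta> :: real assume \<eta>: "0 < \<eta>"
    let ?Q = "\<lambda>m. {\<omega> \<in> space M. \<eta> / 2 < \<bar>C (h m) \<omega> / h m - c\<bar>}"
    have "(\<lambda>m. expectation (indicator (?Q m) :: 'w \<Rightarrow> real)) \<longlonglongrightarrow> expectation (\<lambda>_. 0)"
    proof (rule integral_dominated_convergence[where w="\<lambda>_. 1"])
      show "AE \<omega> in M. (\<lambda>m. indicator (?Q m) \<omega> :: real) \<longlonglongrightarrow> 0"
        using dC covariation_zero[OF C]
      proof eventually_elim
        case (elim \<omega>)
        have "((\<lambda>t. (C t \<omega> - C 0 \<omega>) / (t - 0)) \<longlongrightarrow> c) (at 0 within {0..})"
          using elim(1) by (simp add: has_field_derivative_iff)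
        moreover have "filterlim h (at 0 within {0..}) sequentially"
          using h by (auto simp: filterlim_at less_imp_le less_imp_neq[symmetric] intro!: always_eventually)
        ultimately have "(\<lambda>m. (C (h m) \<omega> - C 0 \<omega>) / (h m - 0)) \<longlonglongrightarrow> c"
          by (rule filterlim_compose)
        then have "(\<lambda>m. C (h m) \<omega> / h m) \<longlonglongrightarrow> c" using elim(2) by simp
        then have "eventually (\<lambda>m. dist (C (h m) \<omega> / h m) c < \<eta> / 2) sequentially"
          by (rule tendstoD) (use \<eta> in simp)
        then have "eventually (\<lambda>m. indicator (?Q m) \<omega> = (0::real)) sequentially"
          by eventually_elim (auto simp: dist_real_def)
        then show ?case by (rule tendsto_eventually)
      qed
    qed (auto simp: indicator_def)
    then have "(\<lambda>m. prob (?Q m) + (h m)\<^sup>2) \<longlonglongrightarrow> 0 + 0\<^sup>2"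
      by (intro tendsto_intros h(2)) (simp add: emeasure_eq_measure)
    then have up: "(\<lambda>m. prob (?Q m) + (h m)\<^sup>2) \<longlonglongrightarrow> 0" by simp
    have "eventually (\<lambda>m. h m < \<eta> / 2) sequentially"
      by (rule order_tendstoD[OF h(2)]) (use \<eta> in simp)
    then have ev: "eventually (\<lambda>m. prob {\<omega> \<in> space M. \<eta> < \<bar>S m \<omega> / h m - c\<bar>} \<le> prob (?Q m) + (h m)\<^sup>2) sequentially"
    proof eventually_elim
      case (elim m)
      let ?P = "{\<omega> \<in> space M. (h m)\<^sup>2 < \<bar>S m \<omega> - C (h m) \<omega>\<bar>}"
      have "{\<omega> \<in> space M. \<eta> < \<bar>S m \<omega> / h m - c\<bar>} \<subseteq> ?Q m \<union> ?P"
      proof (rule subsetI, rule ccontr)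
        fix \<omega> assume w: "\<omega> \<in> {\<omega> \<in> space M. \<eta> < \<bar>S m \<omega> / h m - c\<bar>}" and n: "\<omega> \<notin> ?Q m \<union> ?P"
        have "\<bar>S m \<omega> - C (h m) \<omega>\<bar> / h m \<le> (h m)\<^sup>2 / h m"
          using n w h(1)[of m] by (intro divide_right_mono) auto
        then have "\<bar>S m \<omega> / h m - C (h m) \<omega> / h m\<bar> \<le> h m"
          using h(1)[of m] by (simp add: diff_divide_distrib[symmetric] power2_eq_square)
        moreover have "\<bar>C (h m) \<omega> / h m - c\<bar> \<le> \<eta> / 2" using n w by auto
        ultimately have "\<bar>S m \<omega> / h m - c\<bar> \<le> \<eta>" using elim by linarith
        then show False using w by simp
      qed
      then have "prob {\<omega> \<in> space M. \<eta> < \<bar>S m \<omega> / h m - c\<bar>} \<le> prob (?Q m \<union> ?P)"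
        by (intro finite_measure_mono) auto
      also have "\<dots> \<le> prob (?Q m) + prob ?P"
        by (rule measure_Un_le) auto
      finally show ?case using Sn[of m] by simp
    qed
    show "(\<lambda>m. prob {\<omega> \<in> space M. \<eta> < \<bar>S m \<omega> / h m - c\<bar>}) \<longlonglongrightarrow> 0"
      by (rule tendsto_sandwich[OF _ ev tendsto_const up]) simp
  qed
  then show "(\<lambda>m. cross_moment (h m) (axis i 1) x (axis j 1) / h m) \<longlonglongrightarrow> b x $ i $ j"
    by (simp add: ES c_def)
qed simp

text \<open>For a single particle the mixed moment of a coordinate with itself is its variance \<open>2 \<kappa> h\<close>.\<close>

lemma \<kappa>_eq:
  assumes tensor: "is_covariance_tensor M \<phi> b" and b0: "b 0 = mat 1"
  shows "\<kappa> = 1 / 2"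
proof -
  fix i :: 'n
  have lim: "((\<lambda>h. cross_moment h (axis i 1) 0 (axis i 1) / h) \<longlongrightarrow> 1) (at_right 0)"
    using cross_moment_tensor[OF tensor, of i 0 i] by (simp add: b0 mat_def)
  have "eventually (\<lambda>h. cross_moment h (axis i 1) 0 (axis i 1) / h = 2 * \<kappa>) (at_right 0)"
    using eventually_at_right_less[of 0]
  proof eventually_elim
    case (elim h)
    have "cross_moment h (axis i 1) 0 (axis i 1) = 2 * \<kappa> * h"
      using motion_moment[of h "axis i 1" 0 2] displacement_second_moment[of h "axis i 1"] elim
      by (simp add: cross_moment_def power2_eq_square)
    then show ?case using elim by simp
  qed
  then have "((\<lambda>h. cross_moment h (axis i 1) 0 (axis i 1) / h) \<longlongrightarrow> 2 * \<kappa>) (at_right 0)"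
    by (rule tendsto_eventually)
  from tendsto_unique[OF _ this lim] show ?thesis by simp
qed

text \<open>The quadratic form \<open>u \<bullet> b(x) u\<close>.\<close>

definition tensor_form :: "(real ^ 'n \<Rightarrow> real ^ 'n ^ 'n) \<Rightarrow> real ^ 'n \<Rightarrow> real ^ 'n \<Rightarrow> real" where
  "tensor_form b u x = (\<Sum>i\<in>UNIV. \<Sum>j\<in>UNIV. u $ i * u $ j * b x $ i $ j)"

lemma cross_moment_form:
  assumes tensor: "is_covariance_tensor M \<phi> b"
  shows "((\<lambda>h. cross_moment h u x u / h) \<longlongrightarrow> tensor_form b u x) (at_right 0)"
proof -
  have eq: "cross_moment h u x u = (\<Sum>i\<in>UNIV. \<Sum>j\<in>UNIV. u $ i * u $ j * cross_moment h (axis i 1) x (axis j 1))"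
    if "0 \<le> h" for h
  proof -
    have "(u \<bullet> y) * (u \<bullet> z) = (\<Sum>i\<in>UNIV. \<Sum>j\<in>UNIV. u $ i * u $ j * ((axis i 1 \<bullet> y) * (axis j 1 \<bullet> z)))" for y z
      by (simp add: inner_vec_def[of u] sum_product inner_axis' mult_ac)
    then show ?thesis
      unfolding cross_moment_def using integrable_cross[OF that]
      by (simp add: Bochner_Integration.integral_sum)
  qed
  have "((\<lambda>h. \<Sum>i\<in>UNIV. \<Sum>j\<in>UNIV. u $ i * u $ j * (cross_moment h (axis i 1) x (axis j 1) / h)) \<longlongrightarrow> tensor_form b u x) (at_right 0)"
    unfolding tensor_form_def by (intro tendsto_intros cross_moment_tensor[OF tensor])
  moreover have "eventually (\<lambda>h. (\<Sum>i\<in>UNIV. \<Sum>j\<in>UNIV. u $ i * u $ j * (cross_moment h (axis i 1) x (axis j 1) / h))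
      = cross_moment h u x u / h) (at_right 0)"
    using eventually_at_right_less[of 0]
    by eventually_elim (simp add: eq sum_divide_distrib)
  ultimately show ?thesis by (rule Lim_transform_eventually)
qed

end

section \<open>Decorrelation of two particles\<close>

text \<open>Applied with \<open>c = sqrt h\<close>, this bounds the third moment of a variable whose second and fourth
  moments are \<open>O(h)\<close> and \<open>O(h\<^sup>2)\<close> by \<open>O(h sqrt h)\<close>.\<close>

lemma cube_le: "0 < c \<Longrightarrow> \<bar>x\<bar> ^ 3 \<le> c * x\<^sup>2 + x ^ 4 / (c::real)"
proof -
  assume c: "0 < c"
  have "0 \<le> (\<bar>x\<bar> - c)\<^sup>2 + \<bar>x\<bar> * c" using c by simp
  then have "\<bar>x\<bar> * c \<le> c\<^sup>2 + x\<^sup>2" by (simp add: power2_eq_square algebra_simps)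
  then have "\<bar>x\<bar> \<le> (c\<^sup>2 + x\<^sup>2) / c" using c by (simp add: pos_le_divide_eq)
  then have "\<bar>x\<bar> * x\<^sup>2 \<le> (c\<^sup>2 + x\<^sup>2) / c * x\<^sup>2" by (rule mult_right_mono) simp
  moreover have "\<bar>x\<bar> * x\<^sup>2 = \<bar>x\<bar> ^ 3" by (simp add: power3_eq_cube power2_eq_square flip: abs_mult)
  moreover have "(c\<^sup>2 + x\<^sup>2) / c * x\<^sup>2 = c * x\<^sup>2 + x ^ 4 / c"
    using c by (simp add: field_simps power2_eq_square power4_eq_xxxx)
  ultimately show ?thesis by simp
qed

lemma fourth_power_sum_le: "(a - b) ^ 4 \<le> 8 * a ^ 4 + 8 * (b::real) ^ 4"
proof -
  have "((a - b)\<^sup>2)\<^sup>2 \<le> (2 * a\<^sup>2 + 2 * b\<^sup>2)\<^sup>2"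
    using square_sum_le[of a "- b"] by (intro power_mono) simp_all
  also have "\<dots> \<le> 2 * (2 * a\<^sup>2)\<^sup>2 + 2 * (2 * b\<^sup>2)\<^sup>2" by (rule square_sum_le)
  finally show ?thesis by (simp add: power_mult_distrib flip: power_mult)
qed

context isotropic_Brownian_flow
begin

text \<open>The transition operator of the difference of two particles, applied to the function \<open>cos(v \<bullet> z)\<close>.\<close>

definition cos_transition :: "real ^ 'n \<Rightarrow> real \<Rightarrow> real ^ 'n \<Rightarrow> real" where
  "cos_transition v h z = (\<integral>\<omega>. cos (v \<bullet> (\<phi> 0 h \<omega> z - \<phi> 0 h \<omega> 0)) \<partial>M)"

definition remainder_const :: "real ^ 'n \<Rightarrow> real" where
  "remainder_const v = 4 * (norm v)\<^sup>2 + 48 * (norm v) ^ 4"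

lemma cos_transition_measurable:
  assumes h: "0 \<le> h"
  shows "cos_transition v h \<in> borel_measurable borel"
proof -
  have 1: "(\<lambda>p. \<phi> 0 h (snd p) (fst p)) \<in> borel_measurable (borel \<Otimes>\<^sub>M M)"
    by (rule flow_measurable_at) (use h in auto)
  have 2: "(\<lambda>p. \<phi> 0 h (snd p) 0) \<in> borel_measurable (borel \<Otimes>\<^sub>M M)"
    by (rule flow_measurable_at) (use h in auto)
  note [measurable] = 1 2
  show ?thesis
    unfolding cos_transition_def by (intro borel_measurable_lebesgue_integral) (simp add: case_prod_beta)
qed

text \<open>Expand the cosine to second order in the increment \<open>\<xi>\<close> of \<open>v \<bullet> z\<close>.  It has mean \<open>0\<close>, its second moment is
  \<open>2 (h |v|\<^sup>2 - cross_moment h v z v)\<close>, and its third absolute moment is at most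
  \<open>remainder_const v h sqrt h\<close>.\<close>

lemma cos_transition_expansion:
  assumes \<kappa>: "\<kappa> = 1 / 2" and h: "0 < h"
  shows "\<bar>cos_transition v h z - cos (v \<bullet> z) + (h * (norm v)\<^sup>2 - cross_moment h v z v) * cos (v \<bullet> z)\<bar>
      \<le> remainder_const v * (h * sqrt h)"
    and "\<bar>cos_transition v h z - cos (v \<bullet> z)\<bar> \<le> 2 * (norm v)\<^sup>2 * h + remainder_const v * (h * sqrt h)"
proof -
  have h0: "0 \<le> h" using h by simp
  note [measurable] = motion_measurable[OF h0]
  define A where "A \<omega> = v \<bullet> (\<phi> 0 h \<omega> z - z)" for \<omega>
  define B where "B \<omega> = v \<bullet> \<phi> 0 h \<omega> 0" for \<omega>
  define \<xi> where "\<xi> \<omega> = A \<omega> - B \<omega>" for \<omega>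
  define w where "w = v \<bullet> z"
  have [measurable]: "A \<in> borel_measurable M" "B \<in> borel_measurable M" "\<xi> \<in> borel_measurable M"
    unfolding A_def B_def \<xi>_def by measurable
  have iA: "integrable M (\<lambda>\<omega>. A \<omega> ^ k)" and iB: "integrable M (\<lambda>\<omega>. B \<omega> ^ k)" for k
    using motion_integrable[OF h0, of v z k] motion_integrable[OF h0, of v 0 k] by (simp_all add: A_def B_def)
  have mA: "(\<integral>\<omega>. A \<omega> ^ k \<partial>M) = (\<integral>y. (v \<bullet> y) ^ k \<partial>displacement h)"
    and mB: "(\<integral>\<omega>. B \<omega> ^ k \<partial>M) = (\<integral>y. (v \<bullet> y) ^ k \<partial>displacement h)" for k
    using motion_moment[OF h0, of v z k] motion_moment[OF h0, of v 0 k] by (simp_all add: A_def B_def)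
  have iAB: "integrable M (\<lambda>\<omega>. A \<omega> * B \<omega>)" unfolding A_def B_def by (rule integrable_cross[OF h0])
  have i1: "integrable M \<xi>" unfolding \<xi>_def using iA[of 1] iB[of 1] by simp
  have i2: "integrable M (\<lambda>\<omega>. (\<xi> \<omega>)\<^sup>2)"
    unfolding \<xi>_def power2_diff using iA[of 2] iB[of 2] iAB by (simp add: mult.assoc)
  have i4: "integrable M (\<lambda>\<omega>. \<xi> \<omega> ^ 4)"
  proof (rule Bochner_Integration.integrable_bound)
    show "integrable M (\<lambda>\<omega>. 8 * A \<omega> ^ 4 + 8 * B \<omega> ^ 4)" using iA[of 4] iB[of 4] by simp
    show "AE \<omega> in M. norm (\<xi> \<omega> ^ 4) \<le> norm (8 * A \<omega> ^ 4 + 8 * B \<omega> ^ 4)"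
      using fourth_power_sum_le by (intro AE_I2) (simp add: \<xi>_def)
  qed measurable
  have e1: "expectation \<xi> = 0"
    unfolding \<xi>_def using iA[of 1] iB[of 1] mA[of 1] mB[of 1] by simp
  have m2: "(\<integral>y. (v \<bullet> y)\<^sup>2 \<partial>displacement h) = h * (norm v)\<^sup>2"
    using displacement_second_moment[OF h0, of v] \<kappa> by simp
  have e2: "expectation (\<lambda>\<omega>. (\<xi> \<omega>)\<^sup>2) = 2 * (h * (norm v)\<^sup>2 - cross_moment h v z v)"
    unfolding \<xi>_def power2_diff using iA[of 2] iB[of 2] iAB mA[of 2] mB[of 2]
    by (simp add: mult.assoc m2 cross_moment_def A_def[symmetric] B_def[symmetric])
  have e2': "expectation (\<lambda>\<omega>. (\<xi> \<omega>)\<^sup>2) \<le> 4 * h * (norm v)\<^sup>2"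
  proof -
    have "expectation (\<lambda>\<omega>. (\<xi> \<omega>)\<^sup>2) \<le> expectation (\<lambda>\<omega>. 2 * (A \<omega>)\<^sup>2 + 2 * (B \<omega>)\<^sup>2)"
    proof (rule integral_mono[OF i2])
      show "integrable M (\<lambda>\<omega>. 2 * (A \<omega>)\<^sup>2 + 2 * (B \<omega>)\<^sup>2)" using iA[of 2] iB[of 2] by simp
      show "(\<xi> \<omega>)\<^sup>2 \<le> 2 * (A \<omega>)\<^sup>2 + 2 * (B \<omega>)\<^sup>2" for \<omega>
        using square_sum_le[of "A \<omega>" "- B \<omega>"] by (simp add: \<xi>_def)
    qed
    also have "\<dots> = 4 * h * (norm v)\<^sup>2" using iA[of 2] iB[of 2] mA[of 2] mB[of 2] m2 by simp
    finally show ?thesis .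
  qed
  have e4: "expectation (\<lambda>\<omega>. \<xi> \<omega> ^ 4) \<le> 48 * h\<^sup>2 * norm v ^ 4"
  proof -
    have "expectation (\<lambda>\<omega>. \<xi> \<omega> ^ 4) \<le> expectation (\<lambda>\<omega>. 8 * A \<omega> ^ 4 + 8 * B \<omega> ^ 4)"
    proof (rule integral_mono[OF i4])
      show "integrable M (\<lambda>\<omega>. 8 * A \<omega> ^ 4 + 8 * B \<omega> ^ 4)" using iA[of 4] iB[of 4] by simp
      show "\<xi> \<omega> ^ 4 \<le> 8 * A \<omega> ^ 4 + 8 * B \<omega> ^ 4" for \<omega>
        unfolding \<xi>_def by (rule fourth_power_sum_le)
    qed
    also have "\<dots> = 48 * h\<^sup>2 * norm v ^ 4"
      using iA[of 4] iB[of 4] mA[of 4] mB[of 4] displacement_fourth_moment[OF h0, of v] \<kappa>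
      by (simp add: power_mult_distrib flip: power_mult)
    finally show ?thesis .
  qed
  have sh: "0 < sqrt h" "h / sqrt h = sqrt h" using h by (simp_all add: real_div_sqrt)
  have cube: "\<bar>\<xi> \<omega>\<bar> ^ 3 \<le> sqrt h * (\<xi> \<omega>)\<^sup>2 + \<xi> \<omega> ^ 4 / sqrt h" for \<omega>
    by (rule cube_le[OF sh(1)])
  have i3': "integrable M (\<lambda>\<omega>. sqrt h * (\<xi> \<omega>)\<^sup>2 + \<xi> \<omega> ^ 4 / sqrt h)" using i2 i4 by simp
  have e3: "expectation (\<lambda>\<omega>. sqrt h * (\<xi> \<omega>)\<^sup>2 + \<xi> \<omega> ^ 4 / sqrt h) \<le> remainder_const v * (h * sqrt h)"
  proof -
    have "expectation (\<lambda>\<omega>. sqrt h * (\<xi> \<omega>)\<^sup>2 + \<xi> \<omega> ^ 4 / sqrt h)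
      = sqrt h * expectation (\<lambda>\<omega>. (\<xi> \<omega>)\<^sup>2) + expectation (\<lambda>\<omega>. \<xi> \<omega> ^ 4) / sqrt h"
      using i2 i4 by simp
    also have "\<dots> \<le> sqrt h * (4 * h * (norm v)\<^sup>2) + 48 * h\<^sup>2 * norm v ^ 4 / sqrt h"
      using e2' e4 sh(1) by (intro add_mono mult_left_mono divide_right_mono) auto
    also have "48 * h\<^sup>2 * norm v ^ 4 / sqrt h = 48 * h * norm v ^ 4 * (h / sqrt h)"
      by (simp add: power2_eq_square)
    also have "sqrt h * (4 * h * (norm v)\<^sup>2) + 48 * h * norm v ^ 4 * (h / sqrt h) = remainder_const v * (h * sqrt h)"
      unfolding sh(2) by (simp add: remainder_const_def algebra_simps)
    finally show ?thesis .
  qed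
  have ic: "integrable M (\<lambda>\<omega>. cos (w + \<xi> \<omega>))" by (rule integrable_const_bound[where B=1]) auto
  have "v \<bullet> (\<phi> 0 h \<omega> z - \<phi> 0 h \<omega> 0) = w + \<xi> \<omega>" for \<omega>
    by (simp add: w_def \<xi>_def A_def B_def inner_diff_right)
  then have tr: "cos_transition v h z = expectation (\<lambda>\<omega>. cos (w + \<xi> \<omega>))"
    by (simp add: cos_transition_def)
  let ?T = "\<lambda>\<omega>. cos (w + \<xi> \<omega>) - cos w + \<xi> \<omega> * sin w + (\<xi> \<omega>)\<^sup>2 / 2 * cos w"
  have "\<bar>expectation ?T\<bar> \<le> expectation (\<lambda>\<omega>. sqrt h * (\<xi> \<omega>)\<^sup>2 + \<xi> \<omega> ^ 4 / sqrt h)"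
  proof (rule abs_integral_le)
    show "integrable M ?T" using ic i1 i2 by simp
    show "\<bar>?T \<omega>\<bar> \<le> sqrt h * (\<xi> \<omega>)\<^sup>2 + \<xi> \<omega> ^ 4 / sqrt h" for \<omega>
      by (rule order_trans[OF cos_taylor2 cube])
  qed (rule i3')
  moreover have "expectation ?T = cos_transition v h z - cos w + (h * (norm v)\<^sup>2 - cross_moment h v z v) * cos w"
    using ic i1 i2 by (simp add: tr e1 e2 prob_space)
  ultimately have main: "\<bar>cos_transition v h z - cos w + (h * (norm v)\<^sup>2 - cross_moment h v z v) * cos w\<bar>
      \<le> remainder_const v * (h * sqrt h)" using e3 by linarith
  then show "\<bar>cos_transition v h z - cos (v \<bullet> z) + (h * (norm v)\<^sup>2 - cross_moment h v z v) * cos (v \<bullet> z)\<bar>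
      \<le> remainder_const v * (h * sqrt h)" by (simp add: w_def)
  have "\<bar>(h * (norm v)\<^sup>2 - cross_moment h v z v) * cos w\<bar> \<le> (2 * (norm v)\<^sup>2 * h) * 1"
  proof -
    have "0 \<le> expectation (\<lambda>\<omega>. (\<xi> \<omega>)\<^sup>2)" by simp
    then have "\<bar>h * (norm v)\<^sup>2 - cross_moment h v z v\<bar> \<le> 2 * (norm v)\<^sup>2 * h"
      using e2 e2' by (simp add: abs_le_iff)
    then show ?thesis unfolding abs_mult by (intro mult_mono) (use h0 in auto)
  qed
  then show "\<bar>cos_transition v h z - cos (v \<bullet> z)\<bar> \<le> 2 * (norm v)\<^sup>2 * h + remainder_const v * (h * sqrt h)"
    using main unfolding w_def by linarith
qed

definition two_point_cos :: "real ^ 'n \<Rightarrow> real ^ 'n \<Rightarrow> real ^ 'n \<Rightarrow> real \<Rightarrow> real" where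
  "two_point_cos v x y s = (\<integral>\<omega>. cos (v \<bullet> (\<phi> 0 s \<omega> x - \<phi> 0 s \<omega> y)) \<partial>M)"

lemma two_point_cos_increment:
  assumes s: "0 \<le> s" and h: "0 \<le> h"
  shows "two_point_cos v x y (s + h) - two_point_cos v x y s
    = (\<integral>\<omega>. cos_transition v h (\<phi> 0 s \<omega> x - \<phi> 0 s \<omega> y) - cos (v \<bullet> (\<phi> 0 s \<omega> x - \<phi> 0 s \<omega> y)) \<partial>M)"
proof -
  note [measurable] = motion_measurable[OF s] cos_transition_measurable[OF h]
  have le1: "\<bar>cos_transition v h z\<bar> \<le> 1" for z
  proof -
    have m: "(\<lambda>\<omega>. \<phi> 0 h \<omega> z) \<in> borel_measurable M" "(\<lambda>\<omega>. \<phi> 0 h \<omega> 0) \<in> borel_measurable M"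
      by (rule motion_measurable[OF h])+
    note [measurable] = m
    have "\<bar>cos_transition v h z\<bar> \<le> expectation (\<lambda>_. 1)"
      unfolding cos_transition_def by (rule abs_integral_le) (auto intro!: integrable_const_bound[where B=1])
    then show ?thesis by (simp add: prob_space)
  qed
  have i: "integrable M (\<lambda>\<omega>. cos_transition v h (\<phi> 0 s \<omega> x - \<phi> 0 s \<omega> y))"
    "integrable M (\<lambda>\<omega>. cos (v \<bullet> (\<phi> 0 s \<omega> x - \<phi> 0 s \<omega> y)))"
    using le1 by (auto intro!: integrable_const_bound[where B=1])
  have "two_point_cos v x y (s + h) = (\<integral>\<omega>. cos_transition v h (\<phi> 0 s \<omega> x - \<phi> 0 s \<omega> y) \<partial>M)"
    unfolding two_point_cos_def cos_transition_def
    using two_point_markov[OF s, of "s + h" "\<lambda>z. cos (v \<bullet> z)" 1 x y] h by simp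
  then show ?thesis using i by (simp add: two_point_cos_def)
qed

text \<open>By the uniform bound on \<open>cos_transition\<close>, the function is Lipschitz.\<close>

lemma two_point_cos_continuous:
  assumes \<kappa>: "\<kappa> = 1 / 2"
  shows "continuous_on {0..} (two_point_cos v x y)"
proof -
  define L where "L = 2 * (norm v)\<^sup>2 + remainder_const v + 1"
  have L: "0 < L" unfolding L_def remainder_const_def by (intro add_nonneg_pos add_nonneg_nonneg) auto
  have step: "\<bar>two_point_cos v x y (s + h) - two_point_cos v x y s\<bar> \<le> L * h" if "0 \<le> s" "0 \<le> h" "h \<le> 1" for s h
  proof (cases "h = 0")
    case True then show ?thesis by simp
  next
    case False
    then have h: "0 < h" using that by simp
    note [measurable] = motion_measurable[OF that(1)] cos_transition_measurable[OF that(2)]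
    have bound: "\<bar>cos_transition v h z - cos (v \<bullet> z)\<bar> \<le> L * h" for z
    proof -
      have "sqrt h \<le> 1" using that by simp
      then have "remainder_const v * (h * sqrt h) \<le> remainder_const v * (h * 1)"
        using h by (intro mult_left_mono) (auto simp: remainder_const_def)
      then have "2 * (norm v)\<^sup>2 * h + remainder_const v * (h * sqrt h) \<le> L * h"
        using h unfolding L_def distrib_right by simp
      then show ?thesis using cos_transition_expansion(2)[OF \<kappa> h, of v z] by linarith
    qed
    have "\<bar>two_point_cos v x y (s + h) - two_point_cos v x y s\<bar> \<le> expectation (\<lambda>_. L * h)"
      unfolding two_point_cos_increment[OF that(1,2)]
      by (rule abs_integral_le) (auto intro!: integrable_const_bound[where B="L * h"] bound)
    then show ?thesis by (simp add: prob_space)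
  qed
  show ?thesis
    unfolding continuous_on_iff
  proof (intro ballI allI impI)
    fix s e :: real assume s: "s \<in> {0..}" and e: "0 < e"
    show "\<exists>d>0. \<forall>s'\<in>{0..}. dist s' s < d \<longrightarrow> dist (two_point_cos v x y s') (two_point_cos v x y s) < e"
    proof (intro exI[of _ "min 1 (e / L)"] conjI ballI impI)
      show "0 < min 1 (e / L)" using e L by simp
      fix s' :: real assume s': "s' \<in> {0..}" and d: "dist s' s < min 1 (e / L)"
      have "\<bar>two_point_cos v x y s' - two_point_cos v x y s\<bar> \<le> L * \<bar>s' - s\<bar>"
      proof (cases "s \<le> s'")
        case True
        then show ?thesis using step[of s "s' - s"] s d by (simp add: dist_real_def)
      next
        case False
        then show ?thesis using step[of s' "s - s'"] s' d by (simp add: dist_real_def abs_minus_commute)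
      qed
      also have "\<dots> < e" using d L by (simp add: dist_real_def field_simps)
      finally show "dist (two_point_cos v x y s') (two_point_cos v x y s) < e" by (simp add: dist_real_def)
    qed
  qed
qed

text \<open>By the Markov property, the difference quotient at \<open>s\<close> is the expectation of the difference quotient of
  \<open>cos_transition\<close> at the random point \<open>D\<close>.  The latter quotients are bounded and converge pointwise, since
  \<open>cross_moment h v z v / h\<close> tends to \<open>tensor_form b v z\<close>.\<close>

lemma two_point_cos_derivative:
  assumes \<kappa>: "\<kappa> = 1 / 2" and tensor: "is_covariance_tensor M \<phi> b" and s: "0 \<le> s"
    and meas: "tensor_form b v \<in> borel_measurable borel"
  shows "(two_point_cos v x y has_real_derivative
      (\<integral>\<omega>. - ((norm v)\<^sup>2 - tensor_form b v (\<phi> 0 s \<omega> x - \<phi> 0 s \<omega> y)) * cos (v \<bullet> (\<phi> 0 s \<omega> x - \<phi> 0 s \<omega> y)) \<partial>M))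
    (at_right s)"
proof -
  note [measurable] = motion_measurable[OF s] meas
  define D where "D \<omega> = \<phi> 0 s \<omega> x - \<phi> 0 s \<omega> y" for \<omega>
  have [measurable]: "D \<in> borel_measurable M" unfolding D_def by measurable
  define L where "L z = - ((norm v)\<^sup>2 - tensor_form b v z) * cos (v \<bullet> z)" for z
  have [measurable]: "L \<in> borel_measurable borel" unfolding L_def by measurable
  define q where "q h z = (cos_transition v h z - cos (v \<bullet> z)) / h" for h z
  have lim: "((\<lambda>h. q h z) \<longlongrightarrow> L z) (at_right 0)" for z
  proof -
    define p where "p h = - ((norm v)\<^sup>2 - cross_moment h v z v / h) * cos (v \<bullet> z)" for h
    have "(p \<longlongrightarrow> L z) (at_right 0)"
      unfolding p_def L_def by (intro tendsto_intros cross_moment_form[OF tensor])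
    moreover have "((\<lambda>h. q h z - p h) \<longlongrightarrow> 0) (at_right 0)"
    proof (rule Lim_null_comparison)
      show "\<forall>\<^sub>F h in at_right 0. norm (q h z - p h) \<le> remainder_const v * sqrt h"
        using eventually_at_right_less[of 0]
      proof eventually_elim
        case (elim h)
        have "q h z - p h = (cos_transition v h z - cos (v \<bullet> z) + (h * (norm v)\<^sup>2 - cross_moment h v z v) * cos (v \<bullet> z)) / h"
          using elim by (simp add: q_def p_def field_simps)
        then have "\<bar>q h z - p h\<bar> = \<bar>cos_transition v h z - cos (v \<bullet> z) + (h * (norm v)\<^sup>2 - cross_moment h v z v) * cos (v \<bullet> z)\<bar> / h"
          using elim by simp
        also have "\<dots> \<le> remainder_const v * (h * sqrt h) / h"
          by (rule divide_right_mono[OF cos_transition_expansion(1)[OF \<kappa> elim]]) (use elim in simp)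
        finally have "\<bar>q h z - p h\<bar> \<le> remainder_const v * (h * sqrt h) / h" .
        then show ?case using elim by simp
      qed
      have "((\<lambda>h. remainder_const v * sqrt h) \<longlongrightarrow> remainder_const v * sqrt 0) (at_right 0)"
        by (intro tendsto_intros)
      then show "((\<lambda>h. remainder_const v * sqrt h) \<longlongrightarrow> 0) (at_right 0)" by simp
    qed
    ultimately have "((\<lambda>h. (q h z - p h) + p h) \<longlongrightarrow> 0 + L z) (at_right 0)" by (intro tendsto_add)
    then show ?thesis by simp
  qed
  have qm: "q h \<in> borel_measurable borel" if "0 < h" for h
  proof -
    note [measurable] = cos_transition_measurable[OF less_imp_le[OF that]]
    show ?thesis unfolding q_def by measurable
  qed
  have qb: "\<bar>q h z\<bar> \<le> 2 * (norm v)\<^sup>2 + remainder_const v" if "0 < h" "h < 1" for h z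
  proof -
    have "\<bar>q h z\<bar> \<le> (2 * (norm v)\<^sup>2 * h + remainder_const v * (h * sqrt h)) / h"
      using cos_transition_expansion(2)[OF \<kappa> that(1), of v z] that(1) by (simp add: q_def divide_right_mono)
    also have "\<dots> = 2 * (norm v)\<^sup>2 + remainder_const v * sqrt h" using that by (simp add: add_divide_distrib)
    also have "\<dots> \<le> 2 * (norm v)\<^sup>2 + remainder_const v * 1"
      using that by (intro add_left_mono mult_left_mono) (auto simp: remainder_const_def)
    finally show ?thesis by simp
  qed
  have "((\<lambda>h. expectation (\<lambda>\<omega>. q h (D \<omega>))) \<longlongrightarrow> expectation (\<lambda>\<omega>. L (D \<omega>))) (at_right 0)"
  proof (rule tendsto_at_right_sequentially[where b=1])
    fix h :: "nat \<Rightarrow> real" assume h: "\<And>n. 0 < h n" "\<And>n. h n < 1" "h \<longlonglongrightarrow> 0"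
    have [measurable]: "q (h n) \<in> borel_measurable borel" for n by (rule qm[OF h(1)])
    show "(\<lambda>n. expectation (\<lambda>\<omega>. q (h n) (D \<omega>))) \<longlonglongrightarrow> expectation (\<lambda>\<omega>. L (D \<omega>))"
    proof (rule integral_dominated_convergence[where w="\<lambda>_. 2 * (norm v)\<^sup>2 + remainder_const v"])
      have "filterlim h (at_right 0) sequentially"
        using h(3) less_imp_neq[OF h(1)] h(1) by (auto simp: filterlim_at intro!: always_eventually)
      then show "AE \<omega> in M. (\<lambda>n. q (h n) (D \<omega>)) \<longlonglongrightarrow> L (D \<omega>)"
        using filterlim_compose[OF lim] by (intro AE_I2)
      show "AE \<omega> in M. norm (q (h n) (D \<omega>)) \<le> 2 * (norm v)\<^sup>2 + remainder_const v" for n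
        using qb[OF h(1,2)] by simp
    qed auto
  qed simp
  moreover have "eventually (\<lambda>h. expectation (\<lambda>\<omega>. q h (D \<omega>)) = (two_point_cos v x y (h + s) - two_point_cos v x y s) / (h + s - s)) (at_right 0)"
    using eventually_at_right_less[of 0]
  proof eventually_elim
    case (elim h)
    then show ?case
      using two_point_cos_increment[OF s, of h v x y] by (simp add: q_def D_def add.commute)
  qed
  ultimately have "((\<lambda>h. (two_point_cos v x y (h + s) - two_point_cos v x y s) / (h + s - s)) \<longlongrightarrow> expectation (\<lambda>\<omega>. L (D \<omega>))) (at_right 0)"
    by (rule Lim_transform_eventually)
  then have "((\<lambda>r. (two_point_cos v x y r - two_point_cos v x y s) / (r - s)) \<longlongrightarrow> expectation (\<lambda>\<omega>. L (D \<omega>))) (at_right s)"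
    using filterlim_at_right_to_0[of "\<lambda>r. (two_point_cos v x y r - two_point_cos v x y s) / (r - s)" "nhds (expectation (\<lambda>\<omega>. L (D \<omega>)))" s]
    by simp
  then show ?thesis
    unfolding has_field_derivative_iff L_def D_def .
qed

lemma tensor_form_scale: "tensor_form b (a *\<^sub>R u) z = a\<^sup>2 * tensor_form b u z"
  by (simp add: tensor_form_def sum_distrib_left power2_eq_square mult_ac)

lemma tensor_form_continuous: "continuous_on UNIV b \<Longrightarrow> continuous_on UNIV (tensor_form b u)"
  unfolding tensor_form_def by (intro continuous_intros continuous_on_component)

lemma tensor_form_at_infinity: "(b \<longlongrightarrow> 0) at_infinity \<Longrightarrow> (tensor_form b u \<longlongrightarrow> 0) at_infinity"
proof -
  assume b: "(b \<longlongrightarrow> 0) at_infinity"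
  have "(tensor_form b u \<longlongrightarrow> (\<Sum>i\<in>UNIV. \<Sum>j\<in>UNIV. u $ i * u $ j * (0::real^'n^'n) $ i $ j)) at_infinity"
    unfolding tensor_form_def by (intro tendsto_intros b)
  then show ?thesis by simp
qed

lemma tensor_form_bounded:
  assumes cont: "continuous_on UNIV b" and inf: "(b \<longlongrightarrow> 0) at_infinity"
  shows "\<exists>K\<ge>0. \<forall>z. \<bar>tensor_form b u z\<bar> \<le> K"
proof -
  have "eventually (\<lambda>z. \<bar>tensor_form b u z\<bar> < 1) at_infinity"
    using tendstoD[OF tensor_form_at_infinity[OF inf], of 1] by (simp add: dist_real_def)
  then obtain R where R: "\<And>z. R \<le> norm z \<Longrightarrow> \<bar>tensor_form b u z\<bar> < 1"
    unfolding eventually_at_infinity by blast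
  have "compact (tensor_form b u ` cball 0 R)"
    by (intro compact_continuous_image continuous_on_subset[OF tensor_form_continuous[OF cont]]) auto
  then obtain K where K: "\<And>z. norm z \<le> R \<Longrightarrow> \<bar>tensor_form b u z\<bar> \<le> K"
    using compact_imp_bounded[of "tensor_form b u ` cball 0 R"] unfolding bounded_iff by fastforce
  have "\<bar>tensor_form b u z\<bar> \<le> max 1 K" for z
    using R[of z] K[of z] by (cases "norm z \<le> R") (auto intro: order_trans)
  then show ?thesis by (intro exI[of _ "max 1 K"]) auto
qed

lemma tensor_form_vanishes:
  assumes cont: "continuous_on UNIV b" and inf: "(b \<longlongrightarrow> 0) at_infinity"
    and trans: "transient M \<phi>" and xy: "x \<noteq> y"
  shows "((\<lambda>s. \<integral>\<omega>. \<bar>tensor_form b u (\<phi> 0 s \<omega> x - \<phi> 0 s \<omega> y)\<bar> \<partial>M) \<longlongrightarrow> 0) at_top"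
proof -
  obtain K where K: "0 \<le> K" "\<And>z. \<bar>tensor_form b u z\<bar> \<le> K" using tensor_form_bounded[OF cont inf] by blast
  have [measurable]: "tensor_form b u \<in> borel_measurable borel"
    by (rule borel_measurable_continuous_onI[OF tensor_form_continuous[OF cont]])
  show ?thesis
  proof (rule tendstoI)
    fix e :: real assume e: "0 < e"
    have "eventually (\<lambda>z. \<bar>tensor_form b u z\<bar> < e / 2) at_infinity"
      using tendstoD[OF tensor_form_at_infinity[OF inf], of "e / 2"] e by (simp add: dist_real_def)
    then obtain R where R: "\<And>z. R \<le> norm z \<Longrightarrow> \<bar>tensor_form b u z\<bar> < e / 2"
      unfolding eventually_at_infinity by blast
    let ?P = "\<lambda>s. {\<omega> \<in> space M. R < norm (\<phi> 0 s \<omega> x - \<phi> 0 s \<omega> y)}"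
    have "((\<lambda>s. prob (?P s)) \<longlongrightarrow> 1) at_top" using trans xy by (simp add: transient_def)
    then have "((\<lambda>s. K * (1 - prob (?P s))) \<longlongrightarrow> K * (1 - 1)) at_top" by (intro tendsto_intros)
    then have "eventually (\<lambda>s. K * (1 - prob (?P s)) < e / 2) at_top"
      by (rule order_tendstoD) (use e in simp)
    then show "\<forall>\<^sub>F s in at_top. dist (\<integral>\<omega>. \<bar>tensor_form b u (\<phi> 0 s \<omega> x - \<phi> 0 s \<omega> y)\<bar> \<partial>M) 0 < e"
      using eventually_ge_at_top[of 0]
    proof eventually_elim
      case (elim s)
      note [measurable] = motion_measurable[OF elim(2)]
      have sets: "?P s \<in> events" by measurable
      let ?f = "\<lambda>\<omega>. \<bar>tensor_form b u (\<phi> 0 s \<omega> x - \<phi> 0 s \<omega> y)\<bar>"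
      have "(\<integral>\<omega>. ?f \<omega> \<partial>M) \<le> (\<integral>\<omega>. e / 2 + K * (1 - indicator (?P s) \<omega>) \<partial>M)"
      proof (rule integral_mono)
        show "integrable M ?f" by (rule integrable_const_bound[where B=K]) (use K in auto)
        show "integrable M (\<lambda>\<omega>. e / 2 + K * (1 - indicator (?P s) \<omega>))"
          using sets by (auto simp: emeasure_eq_measure)
        fix \<omega> assume "\<omega> \<in> space M"
        then show "?f \<omega> \<le> e / 2 + K * (1 - indicator (?P s) \<omega>)"
          using R[of "\<phi> 0 s \<omega> x - \<phi> 0 s \<omega> y"] K(2)[of "\<phi> 0 s \<omega> x - \<phi> 0 s \<omega> y"] e by (auto simp: indicator_def)
      qed
      also have "\<dots> = e / 2 + K * (1 - prob (?P s))"
        using sets by (simp add: prob_space emeasure_eq_measure)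
      finally show ?case using elim(1) by (simp add: dist_real_def abs_of_nonneg)
    qed
  qed
qed

text \<open>After multiplication with the integrating factor \<open>exp(|u|\<^sup>2 s / t)\<close> the derivative of
  \<open>two_point_cos (u / sqrt t) x y\<close> is at most \<open>exp(|u|\<^sup>2) r(s) / t\<close>, where \<open>r(s)\<close> tends to \<open>0\<close>.  Up to a
  fixed time \<open>S\<close> only the boundedness of \<open>r\<close> is used, which contributes \<open>O(1 / t)\<close>; after \<open>S\<close> the
  function \<open>r\<close> is small.\<close>

theorem two_point_cos_limit:
  assumes \<kappa>: "\<kappa> = 1 / 2" and tensor: "is_covariance_tensor M \<phi> b"
    and cont: "continuous_on UNIV b" and inf: "(b \<longlongrightarrow> 0) at_infinity"
    and trans: "transient M \<phi>" and xy: "x \<noteq> y"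
  shows "((\<lambda>t. two_point_cos (u /\<^sub>R sqrt t) x y t) \<longlongrightarrow> exp (- (norm u)\<^sup>2)) at_top"
proof -
  define r where "r s = (\<integral>\<omega>. \<bar>tensor_form b u (\<phi> 0 s \<omega> x - \<phi> 0 s \<omega> y)\<bar> \<partial>M)" for s
  obtain K where K: "0 \<le> K" "\<And>z. \<bar>tensor_form b u z\<bar> \<le> K" using tensor_form_bounded[OF cont inf] by blast
  have meas [measurable]: "tensor_form b v \<in> borel_measurable borel" for v
    by (rule borel_measurable_continuous_onI[OF tensor_form_continuous[OF cont]])
  have ir: "integrable M (\<lambda>\<omega>. \<bar>tensor_form b u (\<phi> 0 s \<omega> x - \<phi> 0 s \<omega> y)\<bar>)" if "0 \<le> s" for s
  proof -
    note [measurable] = motion_measurable[OF that]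
    show ?thesis by (rule integrable_const_bound[where B=K]) (use K in auto)
  qed
  have rK: "r s \<le> K" if "0 \<le> s" for s
  proof -
    have "r s \<le> expectation (\<lambda>_. K)" unfolding r_def by (rule integral_mono[OF ir[OF that]]) (use K in auto)
    then show ?thesis by (simp add: prob_space)
  qed
  define N where "N = (norm u)\<^sup>2"
  have N0: "0 \<le> N" by (simp add: N_def)
  define F where "F t s = exp (N / t * s) * two_point_cos (u /\<^sub>R sqrt t) x y s" for t s
  have Fcont: "continuous_on {p..q} (F t)" if "0 \<le> p" for p q t
    unfolding F_def by (intro continuous_intros continuous_on_subset[OF two_point_cos_continuous[OF \<kappa>]]) (use that in auto)
  define F' where "F' t s = exp (N / t * s) * (1 / t * (\<integral>\<omega>. tensor_form b u (\<phi> 0 s \<omega> x - \<phi> 0 s \<omega> y) *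
      cos ((u /\<^sub>R sqrt t) \<bullet> (\<phi> 0 s \<omega> x - \<phi> 0 s \<omega> y)) \<partial>M))" for t s
  have deriv: "(F t has_real_derivative F' t s) (at_right s)" if t: "0 < t" and s: "0 \<le> s" for t s
  proof -
    note [measurable] = motion_measurable[OF s]
    define v where "v = u /\<^sub>R sqrt t"
    have nv: "(norm v)\<^sup>2 = N / t" using t by (simp add: v_def N_def power_divide divide_inverse power_mult_distrib power_inverse)
    have tv: "tensor_form b v z = 1 / t * tensor_form b u z" for z
      using t by (simp add: v_def tensor_form_scale inverse_eq_divide power_divide)
    let ?D = "\<lambda>\<omega>. \<phi> 0 s \<omega> x - \<phi> 0 s \<omega> y"
    have i1: "integrable M (\<lambda>\<omega>. cos (v \<bullet> ?D \<omega>))" by (rule integrable_const_bound[where B=1]) auto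
    have i2: "integrable M (\<lambda>\<omega>. tensor_form b u (?D \<omega>) * cos (v \<bullet> ?D \<omega>))"
    proof (rule integrable_const_bound[where B="K * 1"])
      show "AE \<omega> in M. norm (tensor_form b u (?D \<omega>) * cos (v \<bullet> ?D \<omega>)) \<le> K * 1"
        unfolding real_norm_def abs_mult using K by (intro AE_I2 mult_mono) auto
    qed measurable
    have "(\<integral>\<omega>. - ((norm v)\<^sup>2 - tensor_form b v (?D \<omega>)) * cos (v \<bullet> ?D \<omega>) \<partial>M)
       = (\<integral>\<omega>. 1 / t * (tensor_form b u (?D \<omega>) * cos (v \<bullet> ?D \<omega>)) - N / t * cos (v \<bullet> ?D \<omega>) \<partial>M)"
      unfolding nv tv by (intro Bochner_Integration.integral_cong) (auto simp: algebra_simps)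
    also have "\<dots> = 1 / t * (\<integral>\<omega>. tensor_form b u (?D \<omega>) * cos (v \<bullet> ?D \<omega>) \<partial>M) - N / t * two_point_cos v x y s"
      using i1 i2 by (simp add: two_point_cos_def)
    finally have d: "(two_point_cos v x y has_real_derivative
       (1 / t * (\<integral>\<omega>. tensor_form b u (?D \<omega>) * cos (v \<bullet> ?D \<omega>) \<partial>M) - N / t * two_point_cos v x y s)) (at_right s)"
      using two_point_cos_derivative[OF \<kappa> tensor s meas, of v x y] by simp
    have e: "((\<lambda>s. exp (N / t * s)) has_real_derivative exp (N / t * s) * (N / t)) (at_right s)"
      using t by (auto intro!: derivative_eq_intros)
    have "((\<lambda>s. exp (N / t * s) * two_point_cos v x y s) has_real_derivative
       (exp (N / t * s) * (N / t)) * two_point_cos v x y s +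
       (1 / t * (\<integral>\<omega>. tensor_form b u (?D \<omega>) * cos (v \<bullet> ?D \<omega>) \<partial>M) - N / t * two_point_cos v x y s) * exp (N / t * s)) (at_right s)"
      by (rule DERIV_mult[OF e d])
    moreover have "(exp (N / t * s) * (N / t)) * two_point_cos v x y s +
       (1 / t * (\<integral>\<omega>. tensor_form b u (?D \<omega>) * cos (v \<bullet> ?D \<omega>) \<partial>M) - N / t * two_point_cos v x y s) * exp (N / t * s)
       = F' t s"
      by (simp only: F'_def v_def[symmetric]) (simp add: algebra_simps)
    moreover have "(\<lambda>s. exp (N / t * s) * two_point_cos v x y s) = F t" by (simp add: F_def v_def fun_eq_iff)
    ultimately show ?thesis by simp
  qed
  have F'_le: "\<bar>F' t s\<bar> \<le> exp N * (r s / t)" if t: "0 < t" and s: "0 \<le> s" "s \<le> t" for t s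
  proof -
    note [measurable] = motion_measurable[OF s(1)]
    let ?D = "\<lambda>\<omega>. \<phi> 0 s \<omega> x - \<phi> 0 s \<omega> y" and ?v = "u /\<^sub>R sqrt t"
    have le: "\<bar>tensor_form b u z * cos c\<bar> \<le> \<bar>tensor_form b u z\<bar>" for z c
      unfolding abs_mult using mult_left_mono[OF abs_cos_le_one[of c], of "\<bar>tensor_form b u z\<bar>"] by simp
    have "integrable M (\<lambda>\<omega>. tensor_form b u (?D \<omega>) * cos (?v \<bullet> ?D \<omega>))"
    proof (rule integrable_const_bound[where B=K])
      show "AE \<omega> in M. norm (tensor_form b u (?D \<omega>) * cos (?v \<bullet> ?D \<omega>)) \<le> K"
        by (intro AE_I2, unfold real_norm_def, rule order_trans[OF le K(2)])
    qed measurable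
    then have "\<bar>\<integral>\<omega>. tensor_form b u (?D \<omega>) * cos (?v \<bullet> ?D \<omega>) \<partial>M\<bar> \<le> r s"
      unfolding r_def by (rule abs_integral_le[OF _ ir[OF s(1)] le])
    then have 1: "\<bar>1 / t * (\<integral>\<omega>. tensor_form b u (?D \<omega>) * cos (?v \<bullet> ?D \<omega>) \<partial>M)\<bar> \<le> r s / t"
      using t by (simp add: abs_mult divide_right_mono)
    have "N / t * s \<le> N" using mult_left_mono[OF s(2), of "N / t"] N0 t by simp
    then have "exp (N / t * s) \<le> exp N" by simp
    then show ?thesis unfolding F'_def abs_mult[of "exp _"] abs_exp_cancel using 1 by (intro mult_mono) auto
  qed
  have F0: "F t 0 = cos ((u /\<^sub>R sqrt t) \<bullet> (x - y))" for t
  proof -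
    have "(\<integral>\<omega>. cos ((u /\<^sub>R sqrt t) \<bullet> (\<phi> 0 0 \<omega> x - \<phi> 0 0 \<omega> y)) \<partial>M) = (\<integral>\<omega>. cos ((u /\<^sub>R sqrt t) \<bullet> (x - y)) \<partial>M)"
    proof (rule integral_cong_AE)
      show "AE \<omega> in M. cos ((u /\<^sub>R sqrt t) \<bullet> (\<phi> 0 0 \<omega> x - \<phi> 0 0 \<omega> y)) = cos ((u /\<^sub>R sqrt t) \<bullet> (x - y))"
        using AE_flow_id by eventually_elim simp
    qed (use motion_measurable[of 0 x] motion_measurable[of 0 y] in auto)
    then show ?thesis by (simp add: F_def two_point_cos_def prob_space)
  qed
  have "((\<lambda>t. F t t - F t 0) \<longlongrightarrow> 0) at_top"
  proof (rule tendstoI)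
    fix e :: real assume e: "0 < e"
    define \<epsilon> where "\<epsilon> = e / (2 * exp N)"
    have \<epsilon>: "0 < \<epsilon>" "exp N * \<epsilon> = e / 2" using e by (simp_all add: \<epsilon>_def)
    have "eventually (\<lambda>s. dist (r s) 0 < \<epsilon>) at_top"
      using tensor_form_vanishes[OF cont inf trans xy, of u] \<epsilon>(1) unfolding r_def by (rule tendstoD)
    then obtain S0 where S0: "\<And>s. S0 \<le> s \<Longrightarrow> \<bar>r s\<bar> < \<epsilon>"
      by (auto simp: eventually_at_top_linorder dist_real_def)
    define S where "S = max 0 S0"
    have S: "0 \<le> S" "\<And>s. S \<le> s \<Longrightarrow> r s \<le> \<epsilon>" using S0 by (auto simp: S_def intro: less_imp_le order.strict_trans1[OF abs_ge_self])
    have "((\<lambda>t. exp N * K * S / t) \<longlongrightarrow> 0) at_top" by real_asymp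
    then have "eventually (\<lambda>t. exp N * K * S / t < e / 2) at_top" by (rule order_tendstoD) (use e in simp)
    then show "\<forall>\<^sub>F t in at_top. dist (F t t - F t 0) 0 < e"
      using eventually_gt_at_top[of S]
    proof eventually_elim
      case (elim t)
      then have t: "0 < t" "S \<le> t" using S(1) by auto
      have "\<bar>F t S - F t 0\<bar> \<le> exp N * (K / t) * (S - 0)"
      proof (rule right_derivative_abs_le[OF S(1) Fcont])
        fix s assume s: "0 \<le> s" "s < S"
        show "(F t has_real_derivative F' t s) (at_right s)" by (rule deriv[OF t(1) s(1)])
        have "exp N * (r s / t) \<le> exp N * (K / t)" using rK[OF s(1)] t by (intro mult_left_mono divide_right_mono) auto
        then show "\<bar>F' t s\<bar> \<le> exp N * (K / t)" using F'_le[OF t(1) s(1)] s t by auto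
      qed simp
      also have "\<dots> = exp N * K * S / t" by simp
      also have "\<dots> < e / 2" by (rule elim(1))
      finally have 1: "\<bar>F t S - F t 0\<bar> < e / 2" .
      have "\<bar>F t t - F t S\<bar> \<le> exp N * (\<epsilon> / t) * (t - S)"
      proof (rule right_derivative_abs_le[OF t(2) Fcont[OF S(1)]])
        fix s assume s: "S \<le> s" "s < t"
        then have s0: "0 \<le> s" using S(1) by simp
        show "(F t has_real_derivative F' t s) (at_right s)" by (rule deriv[OF t(1) s0])
        have "exp N * (r s / t) \<le> exp N * (\<epsilon> / t)" using S(2)[OF s(1)] t by (intro mult_left_mono divide_right_mono) auto
        then show "\<bar>F' t s\<bar> \<le> exp N * (\<epsilon> / t)" using F'_le[OF t(1) s0] s by auto
      qed
      also have "\<dots> \<le> exp N * (\<epsilon> / t) * t" using S(1) \<epsilon>(1) t by (intro mult_left_mono) auto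
      also have "\<dots> = e / 2" using t \<epsilon>(2) by simp
      finally have "\<bar>F t t - F t S\<bar> \<le> e / 2" .
      with 1 have "\<bar>F t t - F t 0\<bar> < e" by linarith
      then show ?case by (simp add: dist_real_def)
    qed
  qed
  moreover have "((\<lambda>t. F t 0) \<longlongrightarrow> cos 0) at_top"
  proof -
    have "((\<lambda>t. inverse (sqrt t) * (u \<bullet> (x - y))) \<longlongrightarrow> 0 * (u \<bullet> (x - y))) at_top"
      by (intro tendsto_intros tendsto_inverse_0_at_top sqrt_at_top)
    then have "((\<lambda>t. cos (inverse (sqrt t) * (u \<bullet> (x - y)))) \<longlongrightarrow> cos (0 * (u \<bullet> (x - y)))) at_top"
      by (intro tendsto_cos)
    then show ?thesis by (simp add: F0)
  qed
  ultimately have "((\<lambda>t. (F t t - F t 0) + F t 0) \<longlongrightarrow> 0 + cos 0) at_top" by (intro tendsto_add)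
  then have "((\<lambda>t. exp (- N) * F t t) \<longlongrightarrow> exp (- N) * 1) at_top" by (intro tendsto_intros) simp
  moreover have "eventually (\<lambda>t. exp (- N) * F t t = two_point_cos (u /\<^sub>R sqrt t) x y t) at_top"
    using eventually_gt_at_top[of 0]
    by eventually_elim (simp add: F_def flip: exp_add mult.assoc)
  ultimately show ?thesis unfolding N_def by (simp add: tendsto_cong)
qed

end

section \<open>The rescaled image measures\<close>

context isotropic_Brownian_flow
begin

lemma displacement_gaussian:
  assumes \<kappa>: "\<kappa> = 1 / 2" and t: "0 \<le> t"
  shows "displacement t = distr std_gaussian borel (\<lambda>z. sqrt t *\<^sub>R z)"
proof (rule characteristic_function_unique)
  interpret G: prob_space "std_gaussian :: (real ^ 'n) measure" by (rule prob_space_std_gaussian)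
  show "prob_space (displacement t)" by (rule prob_space_displacement[OF t])
  show "prob_space (distr std_gaussian borel (\<lambda>z::real^'n. sqrt t *\<^sub>R z))" by (rule G.prob_space_distr) measurable
  fix u :: "real ^ 'n"
  have "(\<integral>x. cos (u \<bullet> x) \<partial>distr std_gaussian borel (\<lambda>z. sqrt t *\<^sub>R z)) = (\<integral>z. cos ((sqrt t *\<^sub>R u) \<bullet> z) \<partial>std_gaussian)"
    by (subst integral_distr) auto
  also have "\<dots> = charf t u"
    unfolding std_gaussian_cos using t by (simp add: charf_gaussian \<kappa> power_mult_distrib)
  finally show "(\<integral>x. cos (u \<bullet> x) \<partial>displacement t) = (\<integral>x. cos (u \<bullet> x) \<partial>distr std_gaussian borel (\<lambda>z. sqrt t *\<^sub>R z))"
    by (simp add: charf_def)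
  have "(\<integral>x. sin (u \<bullet> x) \<partial>distr std_gaussian borel (\<lambda>z. sqrt t *\<^sub>R z)) = (\<integral>z. sin ((sqrt t *\<^sub>R u) \<bullet> z) \<partial>std_gaussian)"
    by (subst integral_distr) auto
  also have "\<dots> = 0" by (rule std_gaussian_sin)
  finally show "(\<integral>x. sin (u \<bullet> x) \<partial>displacement t) = (\<integral>x. sin (u \<bullet> x) \<partial>distr std_gaussian borel (\<lambda>z. sqrt t *\<^sub>R z))"
    by (simp add: displacement_sin[OF t])
qed simp_all

text \<open>The rescaled position is a standard Gaussian variable translated by \<open>x / sqrt t\<close>.\<close>

lemma one_point_limit:
  fixes f :: "real ^ 'n \<Rightarrow> real"
  assumes \<kappa>: "\<kappa> = 1 / 2" and f [measurable]: "f \<in> borel_measurable borel" and K: "\<And>z. \<bar>f z\<bar> \<le> K"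
  shows "((\<lambda>t. \<integral>\<omega>. f (\<phi> 0 t \<omega> x /\<^sub>R sqrt t) \<partial>M) \<longlongrightarrow> (\<integral>z. f z \<partial>std_gaussian)) at_top"
proof -
  have "((\<lambda>t. inverse (sqrt t) *\<^sub>R x) \<longlongrightarrow> 0 *\<^sub>R x) at_top"
    by (intro tendsto_intros tendsto_inverse_0_at_top sqrt_at_top)
  then have "((\<lambda>t. inverse (sqrt t) *\<^sub>R x) \<longlongrightarrow> 0) at_top" by simp
  from isCont_tendsto_compose[OF std_gaussian_translate_continuous[OF f K] this]
  have "((\<lambda>t. \<integral>z. f (z + x /\<^sub>R sqrt t) \<partial>std_gaussian) \<longlongrightarrow> (\<integral>z. f z \<partial>std_gaussian)) at_top" by simp
  moreover have "eventually (\<lambda>t. (\<integral>z. f (z + x /\<^sub>R sqrt t) \<partial>std_gaussian) = (\<integral>\<omega>. f (\<phi> 0 t \<omega> x /\<^sub>R sqrt t) \<partial>M)) at_top"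
    using eventually_gt_at_top[of 0]
  proof eventually_elim
    case (elim t)
    let ?g = "\<lambda>y. f (y /\<^sub>R sqrt t + x /\<^sub>R sqrt t)"
    have "(\<integral>\<omega>. f (\<phi> 0 t \<omega> x /\<^sub>R sqrt t) \<partial>M) = (\<integral>\<omega>. ?g (\<phi> 0 t \<omega> x - x) \<partial>M)"
      by (simp add: scaleR_diff_right)
    also have "\<dots> = (\<integral>y. ?g y \<partial>displacement t)"
      using one_point_expectation(1)[of 0 t ?g x] elim by simp
    also have "\<dots> = (\<integral>z. ?g (sqrt t *\<^sub>R z) \<partial>std_gaussian)"
      unfolding displacement_gaussian[OF \<kappa> less_imp_le[OF elim]] by (subst integral_distr) auto
    also have "\<dots> = (\<integral>z. f (z + x /\<^sub>R sqrt t) \<partial>std_gaussian)" using elim by simp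
    finally show ?case by simp
  qed
  ultimately show ?thesis by (rule Lim_transform_eventually)
qed

end

lemma atomless_singleton:
  assumes "atomless m" "{x} \<in> sets m"
  shows "emeasure m {x} = 0"
proof (rule ccontr)
  assume "emeasure m {x} \<noteq> 0"
  then have "0 < emeasure m {x}" by (simp add: zero_less_iff_neq_zero)
  then obtain B where B: "B \<subseteq> {x}" "0 < emeasure m B" "emeasure m B < emeasure m {x}"
    using assms unfolding atomless_def by blast
  then have "B = {} \<or> B = {x}" by auto
  then show False using B by auto
qed

lemma C_differentiable_imp_continuous: "C_differentiable k f \<Longrightarrow> continuous_on UNIV f"
proof (cases k)
  case (Suc j)
  moreover assume "C_differentiable k f"
  ultimately have "f differentiable (at x)" for x by simp
  then show ?thesis by (simp add: continuous_on_eq_continuous_at differentiable_imp_continuous_within)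
qed simp

theorem theorem3p1:
  fixes M :: "'w measure"
    and \<phi> :: "real \<Rightarrow> real \<Rightarrow> 'w \<Rightarrow> real ^ 'n \<Rightarrow> real ^ 'n"
    and b :: "real ^ 'n \<Rightarrow> real ^ 'n ^ 'n"
    and m :: "(real ^ 'n) measure"
  assumes "CARD('n) \<ge> 2"
    and "isotropic_Brownian_flow M \<phi>"
    and "is_covariance_tensor M \<phi> b"
    and "b 0 = mat 1"
    and "C_differentiable 4 b"
    and "(b \<longlongrightarrow> 0) at_infinity"
    and "transient M \<phi>"
    and "finite_measure m"
    and "sets m = sets borel"
    and "atomless m"
    and "emeasure m UNIV \<noteq> 0"
  shows "(\<forall>A\<in>sets borel.
            tendsto_L2 M (\<lambda>t \<omega>. measure (rescaled_image m \<phi> t \<omega>) A) (measure std_gaussian A) at_top)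
       \<and> weakly_in_probability M (rescaled_image m \<phi>) std_gaussian at_top"
proof -
  interpret isotropic_Brownian_flow M \<phi> by fact
  have \<kappa>: "\<kappa> = 1 / 2" by (rule \<kappa>_eq) fact+
  have cont: "continuous_on UNIV b" using assms(5) by (rule C_differentiable_imp_continuous)
  define \<mu> where "\<mu> = scale_measure (1 / emeasure m UNIV) m"
  have sets_\<mu> [measurable_cong]: "sets \<mu> = sets borel" by (simp add: \<mu>_def assms(9))
  have space_m: "space m = UNIV" and space_\<mu>: "space \<mu> = UNIV"
    using sets_eq_imp_space_eq[OF assms(9)] sets_eq_imp_space_eq[OF sets_\<mu>] by simp_all
  have fin: "emeasure m UNIV < top"
    using finite_measure.emeasure_finite[OF assms(8), of UNIV] by (simp add: less_top)
  have prob: "prob_space \<mu>"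
  proof (rule prob_spaceI)
    have "emeasure \<mu> UNIV = emeasure m UNIV / emeasure m UNIV"
      by (simp add: \<mu>_def ennreal_times_divide mult.commute)
    then show "emeasure \<mu> (space \<mu>) = 1"
      using fin assms(11) by (simp add: space_\<mu> ennreal_divide_self)
  qed
  \<comment> \<open>Only positive times matter; the absolute value makes \<open>X t\<close> measurable for every real \<open>t\<close>.\<close>
  define X where "X t \<omega> x = \<phi> 0 \<bar>t\<bar> \<omega> x /\<^sub>R sqrt \<bar>t\<bar>" for t \<omega> x
  interpret asymptotically_independent M \<mu> std_gaussian X
  proof -
    interpret \<mu>: prob_space \<mu> by (rule prob)
    interpret \<gamma>: prob_space "std_gaussian :: (real ^ 'n) measure" by (rule prob_space_std_gaussian)
    show "asymptotically_independent M \<mu> std_gaussian X"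
    proof unfold_locales
      show "sets std_gaussian = sets (borel :: (real ^ 'n) measure)" by simp
      show "(\<lambda>(\<omega>, x). X t \<omega> x) \<in> borel_measurable (M \<Otimes>\<^sub>M \<mu>)" for t
      proof -
        have "snd \<in> borel_measurable (M \<Otimes>\<^sub>M \<mu>)" by measurable
        then have "(\<lambda>p. \<phi> 0 \<bar>t\<bar> (fst p) (snd p)) \<in> borel_measurable (M \<Otimes>\<^sub>M \<mu>)"
          by (intro flow_measurable_at) auto
        then show ?thesis unfolding X_def case_prod_beta by measurable
      qed
      show "((\<lambda>t. \<integral>\<omega>. f (X t \<omega> x) \<partial>M) \<longlongrightarrow> (\<integral>z. f z \<partial>std_gaussian)) at_top"
        if "f \<in> borel_measurable borel" "\<And>z. \<bar>f z\<bar> \<le> K" for f :: "real ^ 'n \<Rightarrow> real" and K x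
      proof (rule Lim_transform_eventually[OF one_point_limit[OF \<kappa> that]])
        show "\<forall>\<^sub>F t in at_top. (\<integral>\<omega>. f (\<phi> 0 t \<omega> x /\<^sub>R sqrt t) \<partial>M) = (\<integral>\<omega>. f (X t \<omega> x) \<partial>M)"
          using eventually_gt_at_top[of 0] by eventually_elim (simp add: X_def)
      qed
      fix u :: "real ^ 'n"
      have lim: "((\<lambda>t. \<integral>\<omega>. cos (u \<bullet> (X t \<omega> x - X t \<omega> y)) \<partial>M)
          \<longlongrightarrow> (\<integral>z. cos (u \<bullet> z) \<partial>std_gaussian)\<^sup>2 + (\<integral>z. sin (u \<bullet> z) \<partial>std_gaussian)\<^sup>2) at_top"
        if "x \<noteq> y" for x y
      proof -
        have "(\<integral>z. cos (u \<bullet> z) \<partial>std_gaussian)\<^sup>2 + (\<integral>z. sin (u \<bullet> z) \<partial>std_gaussian)\<^sup>2 = exp (- (norm u)\<^sup>2)"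
          unfolding std_gaussian_cos std_gaussian_sin by (simp flip: exp_double)
        moreover have "\<forall>\<^sub>F t in at_top. two_point_cos (u /\<^sub>R sqrt t) x y t = (\<integral>\<omega>. cos (u \<bullet> (X t \<omega> x - X t \<omega> y)) \<partial>M)"
          using eventually_gt_at_top[of 0]
        proof eventually_elim
          case (elim t)
          then show ?case
            unfolding two_point_cos_def X_def by (simp add: scaleR_diff_right[symmetric])
        qed
        ultimately show ?thesis
          using Lim_transform_eventually[OF two_point_cos_limit[OF \<kappa> assms(3) cont assms(6,7) that]] by simp
      qed
      show "AE x in \<mu>. AE y in \<mu>. ((\<lambda>t. \<integral>\<omega>. cos (u \<bullet> (X t \<omega> x - X t \<omega> y)) \<partial>M)
          \<longlongrightarrow> (\<integral>z. cos (u \<bullet> z) \<partial>std_gaussian)\<^sup>2 + (\<integral>z. sin (u \<bullet> z) \<partial>std_gaussian)\<^sup>2) at_top"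
      proof (rule AE_I2)
        fix x
        have "emeasure \<mu> {x} = 0" using atomless_singleton[OF assms(10), of x] by (simp add: \<mu>_def assms(9))
        then have "AE y in \<mu>. y \<noteq> x"
          by (intro AE_I[where N="{x}"]) (auto simp: sets_\<mu>)
        then show "AE y in \<mu>. ((\<lambda>t. \<integral>\<omega>. cos (u \<bullet> (X t \<omega> x - X t \<omega> y)) \<partial>M)
          \<longlongrightarrow> (\<integral>z. cos (u \<bullet> z) \<partial>std_gaussian)\<^sup>2 + (\<integral>z. sin (u \<bullet> z) \<partial>std_gaussian)\<^sup>2) at_top"
          by eventually_elim (rule lim, simp)
      qed
    qed
  qed
  have X_meas: "X t \<omega> \<in> measurable \<mu> borel" if "\<omega> \<in> space M" for t \<omega>
    using X_measurable'[of "\<lambda>_. \<omega>" \<mu> "\<lambda>x. x" t] that by simp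
  have image: "rescaled_image m \<phi> t \<omega> = distr \<mu> borel (X t \<omega>)" if t: "0 < t" and w: "\<omega> \<in> space M" for t \<omega>
  proof -
    have sf: "stochastic_flow M \<phi>" by unfold_locales
    have X: "X t \<omega> = (\<lambda>x. \<phi> 0 t \<omega> x /\<^sub>R sqrt t)" using t by (simp add: X_def fun_eq_iff)
    have Xm: "X t \<omega> \<in> measurable m borel" using X_meas[OF w, of t] by (simp add: \<mu>_def)
    show ?thesis
      unfolding rescaled_image_eq[OF sf w assms(9) t] X[symmetric]
    proof (rule measure_eqI)
      fix A assume "A \<in> sets (scale_measure (1 / emeasure m UNIV) (distr m borel (X t \<omega>)))"
      then show "emeasure (scale_measure (1 / emeasure m UNIV) (distr m borel (X t \<omega>))) A = emeasure (distr \<mu> borel (X t \<omega>)) A"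
        using Xm X_meas[OF w, of t] by (simp add: emeasure_distr space_m space_\<mu>) (simp add: \<mu>_def)
    qed simp
  qed
  have measure_image: "measure (rescaled_image m \<phi> t \<omega>) A = average (indicator A) t \<omega>"
    if "0 < t" "\<omega> \<in> space M" "A \<in> sets borel" for t \<omega> A
  proof -
    have "measure (rescaled_image m \<phi> t \<omega>) A = (\<integral>z. indicator A z \<partial>distr \<mu> borel (X t \<omega>))"
      unfolding image[OF that(1,2)] using that(3) by simp
    also have "\<dots> = average (indicator A) t \<omega>"
      unfolding average_def by (rule integral_distr[OF X_meas[OF that(2)]]) (use that(3) in simp)
    finally show ?thesis .
  qed
  have integral_image: "(\<integral>z. f z \<partial>rescaled_image m \<phi> t \<omega>) = average f t \<omega>"
    if "0 < t" "\<omega> \<in> space M" "f \<in> borel_measurable borel" for t \<omega> and f :: "real ^ 'n \<Rightarrow> real"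
    unfolding image[OF that(1,2)] average_def by (rule integral_distr[OF X_meas[OF that(2)] that(3)])
  show ?thesis
  proof (intro conjI ballI)
    fix A :: "(real ^ 'n) set" assume A [measurable]: "A \<in> sets borel"
    let ?f = "indicator A :: real ^ 'n \<Rightarrow> real"
    have f: "?f \<in> borel_measurable borel" "\<bar>?f z\<bar> \<le> 1" for z by (auto simp: indicator_def)
    show "tendsto_L2 M (\<lambda>t \<omega>. measure (rescaled_image m \<phi> t \<omega>) A) (measure std_gaussian A) at_top"
      unfolding tendsto_L2_def
    proof
      show "\<forall>\<^sub>F t in at_top. (\<lambda>\<omega>. measure (rescaled_image m \<phi> t \<omega>) A) \<in> borel_measurable M \<and>
          integrable M (\<lambda>\<omega>. (measure (rescaled_image m \<phi> t \<omega>) A)\<^sup>2)"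
        using eventually_gt_at_top[of 0]
      proof eventually_elim
        case (elim t)
        show ?case
          using average_measurable[OF f(1), of t] integrable_average(2)[OF f, of t]
          by (simp add: measure_image[OF elim _ A] cong: measurable_cong Bochner_Integration.integrable_cong)
      qed
      have "((\<lambda>t. \<integral>\<omega>. (average ?f t \<omega> - (\<integral>z. ?f z \<partial>std_gaussian))\<^sup>2 \<partial>M) \<longlongrightarrow> 0) at_top"
        by (rule convergingD(3)[OF converging_bounded_borel[OF f]])
      moreover have "\<forall>\<^sub>F t in at_top. (\<integral>\<omega>. (average ?f t \<omega> - (\<integral>z. ?f z \<partial>std_gaussian))\<^sup>2 \<partial>M)
          = (\<integral>\<omega>. (measure (rescaled_image m \<phi> t \<omega>) A - measure std_gaussian A)\<^sup>2 \<partial>M)"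
        using eventually_gt_at_top[of 0]
        by eventually_elim (simp add: measure_image[OF _ _ A] cong: Bochner_Integration.integral_cong)
      ultimately show "((\<lambda>t. \<integral>\<omega>. (measure (rescaled_image m \<phi> t \<omega>) A - measure std_gaussian A)\<^sup>2 \<partial>M) \<longlongrightarrow> 0) at_top"
        by (rule Lim_transform_eventually)
    qed
  next
    show "weakly_in_probability M (rescaled_image m \<phi>) std_gaussian at_top"
      unfolding weakly_in_probability_def tendsto_in_probability_def
    proof (intro allI impI conjI)
      fix f :: "real ^ 'n \<Rightarrow> real" assume "continuous_on UNIV f \<and> bounded (range f)"
      then obtain K where f: "f \<in> borel_measurable borel" and K: "\<And>z. \<bar>f z\<bar> \<le> K"
        by (auto simp: bounded_iff intro: borel_measurable_continuous_onI)
      show "\<forall>\<^sub>F t in at_top. (\<lambda>\<omega>. \<integral>z. f z \<partial>rescaled_image m \<phi> t \<omega>) \<in> borel_measurable M"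
        using eventually_gt_at_top[of 0]
      proof eventually_elim
        case (elim t)
        show ?case
          using average_measurable[OF f, of t] by (simp add: integral_image[OF elim _ f] cong: measurable_cong)
      qed
      fix \<epsilon> :: real assume \<epsilon>: "0 < \<epsilon>"
      let ?c = "\<integral>z. f z \<partial>std_gaussian"
      have "((\<lambda>t. (\<integral>\<omega>. (average f t \<omega> - ?c)\<^sup>2 \<partial>M) / \<epsilon>\<^sup>2) \<longlongrightarrow> 0 / \<epsilon>\<^sup>2) at_top"
        by (intro tendsto_intros convergingD(3)[OF converging_bounded_borel[OF f K]]) (use \<epsilon> in simp)
      then have up: "((\<lambda>t. (\<integral>\<omega>. (average f t \<omega> - ?c)\<^sup>2 \<partial>M) / \<epsilon>\<^sup>2) \<longlongrightarrow> 0) at_top" by simp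
      have "\<forall>\<^sub>F t in at_top. prob {\<omega> \<in> space M. \<epsilon> < \<bar>(\<integral>z. f z \<partial>rescaled_image m \<phi> t \<omega>) - ?c\<bar>}
          \<le> (\<integral>\<omega>. (average f t \<omega> - ?c)\<^sup>2 \<partial>M) / \<epsilon>\<^sup>2"
        using eventually_gt_at_top[of 0]
      proof eventually_elim
        case (elim t)
        note [measurable] = average_measurable[OF f]
        let ?S = "{\<omega> \<in> space M. \<epsilon> < \<bar>average f t \<omega> - ?c\<bar>}"
        have "{\<omega> \<in> space M. \<epsilon> < \<bar>(\<integral>z. f z \<partial>rescaled_image m \<phi> t \<omega>) - ?c\<bar>} = ?S"
          using integral_image[OF elim _ f] by auto
        moreover have "expectation (indicator ?S :: 'w \<Rightarrow> real) \<le> (\<integral>\<omega>. (average f t \<omega> - ?c)\<^sup>2 / \<epsilon>\<^sup>2 \<partial>M)"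
        proof (rule integral_mono)
          show "integrable M (indicator ?S :: 'w \<Rightarrow> real)" by (simp add: emeasure_eq_measure)
          show "integrable M (\<lambda>\<omega>. (average f t \<omega> - ?c)\<^sup>2 / \<epsilon>\<^sup>2)"
            using integrable_average(3)[OF f K, of t ?c] by simp
          fix \<omega>
          show "indicator ?S \<omega> \<le> (average f t \<omega> - ?c)\<^sup>2 / \<epsilon>\<^sup>2"
          proof (cases "\<omega> \<in> ?S")
            case True
            then have "\<epsilon>\<^sup>2 \<le> \<bar>average f t \<omega> - ?c\<bar>\<^sup>2" using \<epsilon> by (intro power_mono) auto
            then show ?thesis using True \<epsilon> by (simp add: pos_le_divide_eq)
          qed simp
        qed
        ultimately show ?case by (simp add: emeasure_eq_measure)
      qed
      then show "((\<lambda>t. prob {\<omega> \<in> space M. \<epsilon> < \<bar>(\<integral>z. f z \<partial>rescaled_image m \<phi> t \<omega>) - ?c\<bar>}) \<longlongrightarrow> 0) at_top"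
        by (intro tendsto_sandwich[OF _ _ tendsto_const up]) auto
    qed
  qed
qed

end
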